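(* Let $1<p<\infty$, $N\ge 2$, $q>1$, let $\lambda_1,\dots,\lambda_N>0$ with $\sum_{i=1}^N\lambda_i=1$, and let $\mu_1,\dots,\mu_N$ be Borel probability measures on $\mathbb{R}^d$ such that, for some $M>0$, $\operatorname{spt}\mu_i\subset B_{M/2}$ for every $i=1,\dots,N$. Assume that $\mu_1=f_1\,\mathcal{L}^d$ with $f_1\in L^q(\mathbb{R}^d)$, and let $\nu_p=g_p\,\mathcal{L}^d$ be the $p$-Wasserstein barycenter of $(\mu_i,\lambda_i)_{i=1,\dots,N}$. Set $\alpha_p:=\frac{p-2}{p-1}$ and let $q'$ be the conjugate exponent of $q$. Then there exists a constant $C=C(d,M)\in(0,\infty)$ ($p$ and $q$ being fixed) such that the following hold. (i) If $p\ge 2$ and $$\mathcal{D}:=\inf_{(x_1,\dots,x_N)\in \operatorname{spt}\mu_1\times\cdots\times\operatorname{spt}\mu_N}\big|\overline{x}_p(x_1,x_2,\dots,x_N)-\overline{x}_p(x_2,\dots,x_N)\big|>0,$$ then $g_p\in L^q(\mathbb{R}^d)$ and $$\|g_p\|_{L^q}\le \frac{C}{\big(\lambda_1^{d(1-\alpha_p)}\mathcal{D}^{d(p-2)}\big)^{q'}}\,\|f_1\|_{L^q}.$$ (ii) If $p\in(1,2)$ and $$m:=\inf_{i\in\{1,\dots,N\}}\ \inf_{(x_1,\dots,x_N)\in \operatorname{spt}\mu_1\times\cdots\times\operatorname{spt}\mu_N}\big|x_i-\overline{x}_p(x_1,\dots,x_N)\big|>0,$$ then $g_p\in L^q(\mathbb{R}^d)$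 and $$\|g_p\|_{L^q}\le \frac{C}{\big(\lambda_1^{d(1-\alpha_p)}m^{d(2-p)}\big)^{q'}}\,\|f_1\|_{L^q}.$$
   Context: $\mathcal{L}^d$ is Lebesgue measure on $\mathbb{R}^d$ and $B_r$ is the open ball of radius $r$ centered at the origin. $\mathcal{P}_p(\mathbb{R}^d)$ is the set of Borel probability measures with finite $p$-th moment and $W_p(\mu,\nu)=\min_{\eta\in\Pi(\mu,\nu)}\big(\int|x-y|^p\,d\eta\big)^{1/p}$ is the $p$-Wasserstein distance ($\Pi(\mu,\nu)$ = couplings of $\mu$ and $\nu$). The $p$-Wasserstein barycenter of $(\mu_i,\lambda_i)_{i=1,\dots,N}$ is the minimizer $\nu_p$ of $\nu\mapsto\sum_{i=1}^N\lambda_iW_p^p(\mu_i,\nu)$ over $\mathcal{P}_p(\mathbb{R}^d)$; when $\mu_1\ll\mathcal{L}^d$ it is unique and absolutely continuous, and $g_p$ denotes its density. The Euclidean $p$-barycenters are $\overline{x}_p(x_1,\dots,x_N):=\operatorname{argmin}_{z\in\mathbb{R}^d}\sum_{i=1}^N\lambda_i|x_i-z|^p$ and, for the last $N-1$ points with the same weights $\lambda_2,\dots,\lambda_N$, $\overline{x}_p(x_2,\dots,x_N):=\operatorname{argmin}_{z\in\mathbb{R}^d}\sum_{i=2}^N\lambda_i|x_i-z|^p$ (both minimizers are unique). *)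

theory Defs
  imports "HOL-Probability.Probability"
begin

text \<open>The product of Borel sigma-algebras on a Euclidean space is the Borel sigma-algebra of the
  product, so couplings are measures on \<^term>\<open>borel\<close> over the pair type.\<close>

definition borel_prob :: "'a::euclidean_space measure \<Rightarrow> bool" where
  "borel_prob \<mu> \<longleftrightarrow> prob_space \<mu> \<and> sets \<mu> = sets borel"

definition spt :: "'a::euclidean_space measure \<Rightarrow> 'a set" where
  "spt \<mu> = {x. \<forall>U. open U \<and> x \<in> U \<longrightarrow> 0 < emeasure \<mu> U}"

definition Prob_p :: "real \<Rightarrow> 'a::euclidean_space measure set" where
  "Prob_p p = {\<mu>. borel_prob \<mu> \<and> integrable \<mu> (\<lambda>x. norm x powr p)}"

definition couplings ::
    "'a::euclidean_space measure \<Rightarrow> 'a measure \<Rightarrow> ('a \<times> 'a) measure set" where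
  "couplings \<mu> \<nu> = {\<eta>. borel_prob \<eta> \<and> distr \<eta> borel fst = \<mu> \<and> distr \<eta> borel snd = \<nu>}"

text \<open>Real-valued, hence meaningful only on \<^term>\<open>Prob_p p\<close>: there the product measure is a
  coupling and the cost is integrable against every coupling. The infimum is attained.\<close>

definition wasserstein :: "real \<Rightarrow> 'a::euclidean_space measure \<Rightarrow> 'a measure \<Rightarrow> real" where
  "wasserstein p \<mu> \<nu> =
     (INF \<eta>\<in>couplings \<mu> \<nu>. (\<integral>z. norm (fst z - snd z) powr p \<partial>\<eta>) powr (1 / p))"

definition is_wasserstein_barycenter ::
    "real \<Rightarrow> nat \<Rightarrow> (nat \<Rightarrow> real) \<Rightarrow> (nat \<Rightarrow> 'a::euclidean_space measure) \<Rightarrow> 'a measure \<Rightarrow> bool" where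
  "is_wasserstein_barycenter p N w \<mu> \<nu> \<longleftrightarrow>
     is_arg_min (\<lambda>\<rho>. \<Sum>i=1..N. w i * wasserstein p (\<mu> i) \<rho> powr p) (\<lambda>\<rho>. \<rho> \<in> Prob_p p) \<nu>"

text \<open>The weights \<^term>\<open>w\<close> over \<^term>\<open>I\<close> need not sum to one; the points \<open>x\<^sub>2, \<dots>, x\<^sub>N\<close> keep their
  original weights.\<close>

definition euclidean_barycenter ::
    "real \<Rightarrow> nat set \<Rightarrow> (nat \<Rightarrow> real) \<Rightarrow> (nat \<Rightarrow> 'a::euclidean_space) \<Rightarrow> 'a" where
  "euclidean_barycenter p I w x = arg_min (\<lambda>z. \<Sum>i\<in>I. w i * norm (x i - z) powr p) (\<lambda>z. True)"

definition bary_separation ::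
    "real \<Rightarrow> nat \<Rightarrow> (nat \<Rightarrow> real) \<Rightarrow> (nat \<Rightarrow> 'a::euclidean_space measure) \<Rightarrow> real" where
  "bary_separation p N w \<mu> =
     (INF x\<in>(\<Pi>\<^sub>E i\<in>{1..N}. spt (\<mu> i)).
        norm (euclidean_barycenter p {1..N} w x - euclidean_barycenter p {2..N} w x))"

definition bary_point_distance ::
    "real \<Rightarrow> nat \<Rightarrow> (nat \<Rightarrow> real) \<Rightarrow> (nat \<Rightarrow> 'a::euclidean_space measure) \<Rightarrow> real" where
  "bary_point_distance p N w \<mu> =
     (INF i\<in>{1..N}. INF x\<in>(\<Pi>\<^sub>E i\<in>{1..N}. spt (\<mu> i)).
        norm (x i - euclidean_barycenter p {1..N} w x))"

definition has_lebesgue_density :: "'a::euclidean_space measure \<Rightarrow> ('a \<Rightarrow> real) \<Rightarrow> bool" where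
  "has_lebesgue_density \<mu> f \<longleftrightarrow>
     f \<in> borel_measurable borel \<and> (AE x in lborel. 0 \<le> f x) \<and>
     \<mu> = density lborel (\<lambda>x. ennreal (f x))"

definition in_Lq :: "real \<Rightarrow> ('a::euclidean_space \<Rightarrow> real) \<Rightarrow> bool" where
  "in_Lq q f \<longleftrightarrow> f \<in> borel_measurable borel \<and> integrable lborel (\<lambda>x. \<bar>f x\<bar> powr q)"

definition Lq_norm :: "real \<Rightarrow> ('a::euclidean_space \<Rightarrow> real) \<Rightarrow> real" where
  "Lq_norm q f = (\<integral>x. \<bar>f x\<bar> powr q \<partial>lborel) powr (1 / q)"

definition alpha_exp :: "real \<Rightarrow> real" where
  "alpha_exp p = (p - 2) / (p - 1)"

end

theory Submission
  imports Defs
begin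

text \<open>
  Only approximately optimal couplings are used. Couplings of the measures \<open>\<mu>\<^sub>i\<close> with \<open>\<nu>\<close> that are optimal
  up to an error are glued, approximately, into one law of random points \<open>X\<^sub>1, \<dots>, X\<^sub>N, Z\<close>. Since \<open>\<nu>\<close> minimises
  the barycenter functional, two independent copies of this law can, up to events of small probability,
  not be improved by moving \<open>Z\<close>, nor by exchanging the first coordinates of the two copies. A compactness
  argument reduces the consequences to pairs of configurations for which neither is possible at all. For such
  a pair, testing the exchange at two points near \<open>Z\<close> and \<open>Z'\<close> gives \<open>|X\<^sub>1 - X\<^sub>1'| \<le> L |Z - Z'|\<close> directly,
  without differentiating Kantorovich potentials: the lower bound on \<open>\<D>\<close> or \<open>m\<close> controls the modulus of
  convexity of the first cost relative to the curvature of the others.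

  Hence, up to small errors, most of the mass that \<open>\<nu>\<close> gives to a ball of radius \<open>s\<close> comes from a ball of
  radius \<open>3 L s\<close> under \<open>\<mu>\<^sub>1\<close>. Young's inequality turns this into
  \<open>\<integral> \<phi> d\<nu> \<le> (3 L)\<^sup>d / q' \<integral> \<phi>\<^sup>q\<^sup>' + 1 / q \<integral> f\<^sub>1\<^sup>q\<close> for test functions \<open>\<phi> \<ge> 0\<close>, which by duality bounds
  the \<open>L\<^sup>q\<close> norm of the density of \<open>\<nu>\<close>.
\<close>

subsection \<open>Powers of the norm and the duality map\<close>

text \<open>The Lipschitz estimate is a competition between two moduli. The exchange gains from the
  convexity of the first cost, with coefficient \<open>w 1\<close> times max(|z - x_1|, |z' -
  x_1'|)^(p-2), and loses by the curvature of the other costs, whose total weight is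
  \<open>1 - w 1\<close>; so the number of points never enters. For p >= 2 the gain degenerates at z
  = x_1. Stationarity of z equates, up to sign, the gradients of the first and of the remaining
  costs, and the distance D from z to the barycenter of the remaining points keeps the latter away
  from 0: |z - x_1| >= ((1 - w 1) / w 1)^(1/(p-1)) D / 2. In the ratio of the moduli this leaves 1 /
  w 1 to the power 1 - (p-2)/(p-1) = 1 - alpha_p and 1 / D to the power p - 2. For p < 2 the loss is
  singular, at z = x_i, which m excludes. With approximate plans no event is known to have measure
  0, only small measure, uniformly over all plans of small error. This survives finite unions only,
  hence the role of compactness. Each competitor is a fixed point used on an open event, so no
  barycenter has to be selected measurably.\<close>

definition duality_map :: "real \<Rightarrow> 'a::real_inner \<Rightarrow> 'a" where
  "duality_map p y = norm y powr (p - 2) *\<^sub>R y"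

lemma powr_diff_one_mult:
  fixes x :: real
  assumes "0 \<le> x"
  shows "x powr (s - 2) * x = x powr (s - 1)"
  using powr_add[of x "s - 2" 1] assms by (cases "x = 0") auto

text \<open>\<open>p *\<^sub>R duality_map p a\<close> is the gradient of the p-th power of the norm
  at a, so this is the supporting hyperplane inequality. It comes from Young's inequality for
  |a|^(p-1) |b| with exponents p / (p - 1) and p, without differentiation.\<close>

lemma norm_powr_tangent:
  fixes a b :: "'a::real_inner"
  assumes "1 < p"
  shows "norm a powr p + p * (duality_map p a \<bullet> (b - a)) \<le> norm b powr p"
proof (cases "a = 0")
  case True
  then show ?thesis by (simp add: duality_map_def)
next
  case False
  define n where "n = norm a"
  have n: "n > 0" using False n_def by simp
  have e1: "n powr (p - 2) * (n * norm b) = n powr (p - 1) * norm b"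
    using n powr_diff_one_mult[of n p] by (simp add: mult.assoc[symmetric])
  have e2: "n powr (p - 2) * (a \<bullet> a) = n powr p"
  proof -
    have "a \<bullet> a = n powr 2"
      using n by (simp add: n_def power2_norm_eq_inner)
    then show ?thesis using n powr_add[of n "p - 2" 2] by (simp del: powr_numeral)
  qed
  have "n powr (p - 1) * norm b
      \<le> (n powr (p - 1)) powr (p / (p - 1)) / (p / (p - 1)) + norm b powr p / p"
  proof (rule Youngs_inequality)
    show "p / (p - 1) > 1" "1 / (p / (p - 1)) + 1 / p = 1" using assms by (auto simp: field_simps)
  qed (use assms in auto)
  also have "(n powr (p - 1)) powr (p / (p - 1)) = n powr p"
    using assms by (simp add: powr_powr)
  finally have y: "p * (n powr (p - 1) * norm b) \<le> (p - 1) * n powr p + norm b powr p"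
    using assms by (simp add: field_simps)
  have "duality_map p a \<bullet> (b - a) = n powr (p - 2) * (a \<bullet> b) - n powr p"
    using e2 by (simp add: duality_map_def inner_diff_right right_diff_distrib n_def)
  also have "\<dots> \<le> n powr (p - 1) * norm b - n powr p"
    using mult_left_mono[OF norm_cauchy_schwarz[of a b], of "n powr (p - 2)", OF powr_ge_zero] e1
    unfolding n_def[symmetric] by linarith
  finally have "p * (duality_map p a \<bullet> (b - a)) \<le> p * (n powr (p - 1) * norm b - n powr p)"
    using assms by (intro mult_left_mono) auto
  then show ?thesis using y by (simp add: algebra_simps n_def)
qed

text \<open>For exponents above 1 this is the tangent inequality on the real line at 1; for an
  exponent u below 1 it is the same inequality for 1 / u, evaluated at t^u. It controls the radial
  parts of the two estimates that follow.\<close>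

lemma Bernoulli_powr:
  fixes t s :: real
  assumes "0 \<le> t" "t \<le> 1" "0 < s"
  shows "1 - t powr s \<le> max 1 s * (1 - t)" and "min 1 s * (1 - t) \<le> 1 - t powr s"
proof -
  have conv: "1 + u * (t - 1) \<le> t powr u" if "1 < u" for u
  proof -
    have "duality_map u (1::real) = 1" by (simp add: duality_map_def)
    then show ?thesis
      using norm_powr_tangent[of u "1::real" t] that assms by simp
  qed
  have conc: "t powr u \<le> 1 + u * (t - 1)" if "0 < u" "u < 1" for u
  proof -
    have "duality_map (1 / u) (1::real) = 1" by (simp add: duality_map_def)
    then have "1 + (1 / u) * (t powr u - 1) \<le> (t powr u) powr (1 / u)"
      using norm_powr_tangent[of "1 / u" "1::real" "t powr u"] that assms by simp
    then show ?thesis using that assms by (simp add: powr_powr field_simps)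
  qed
  have low: "t \<le> t powr s" if "s \<le> 1"
    using powr_mono'[of s 1 t] that assms by (cases "t = 0") auto
  have high: "t powr s \<le> t" if "1 \<le> s"
    using powr_mono'[of 1 s t] that assms by (cases "t = 0") auto
  show "1 - t powr s \<le> max 1 s * (1 - t)"
    using conv[of s] low assms by (cases "1 < s") (auto simp: algebra_simps max_def)
  show "min 1 s * (1 - t) \<le> 1 - t powr s"
    using conc[of s] high assms by (cases "s < 1") (auto simp: algebra_simps min_def)
qed

text \<open>With |y'| <= |y|, the difference splits into |y|^(p-2) (y - y') and the change of the
  scalar factor times y'. The second part depends only on t = |y'| / |y| and reduces to |t -
  t^(p-1)| <= p (1 - t). The factor contains the larger norm, so for p < 2 the bound stays finite
  when one vector approaches 0, and it matches the factor in the monotonicity estimate.\<close>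

lemma duality_map_lipschitz:
  fixes y y' :: "'a::real_inner"
  assumes "1 < p"
  shows "norm (duality_map p y - duality_map p y')
    \<le> (p + 1) * max (norm y) (norm y') powr (p - 2) * norm (y - y')"
proof -
  have main: "norm (duality_map p y - duality_map p y')
      \<le> (p + 1) * norm y powr (p - 2) * norm (y - y')"
    if le: "norm y' \<le> norm y" for y y' :: 'a
  proof (cases "y = 0")
    case True
    then show ?thesis using le by simp
  next
    case False
    define a b t where "a = norm y" and "b = norm y'" and "t = b / a"
    have a: "a > 0" and b: "b \<ge> 0" "b \<le> a" using False le by (auto simp: a_def b_def)
    have t: "0 \<le> t" "t \<le> 1" "b = t * a" using a b by (auto simp: t_def)
    have bp: "b powr (p - 2) * b = a powr (p - 1) * t powr (p - 1)"
      unfolding powr_diff_one_mult[OF b(1)] unfolding t(3) using t(1) a by (simp add: powr_mult)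
    have ap: "a powr (p - 2) * a = a powr (p - 1)"
      using a by (intro powr_diff_one_mult) simp
    have "\<bar>a powr (p - 2) - b powr (p - 2)\<bar> * b = \<bar>(a powr (p - 2) * a) * t - b powr (p - 2) * b\<bar>"
    proof -
      have "\<bar>a powr (p - 2) - b powr (p - 2)\<bar> * b = \<bar>(a powr (p - 2) - b powr (p - 2)) * b\<bar>"
        using b by (simp add: abs_mult)
      also have "(a powr (p - 2) - b powr (p - 2)) * b = (a powr (p - 2) * a) * t - b powr (p - 2) * b"
        using t(3) by (simp add: left_diff_distrib mult.assoc mult.commute[of a])
      finally show ?thesis .
    qed
    also have "\<dots> = a powr (p - 1) * \<bar>t - t powr (p - 1)\<bar>"
      unfolding bp ap by (simp add: abs_mult right_diff_distrib[symmetric])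
    also have "\<dots> \<le> a powr (p - 1) * (p * (1 - t))"
    proof (rule mult_left_mono)
      have pw: "t powr (p - 1) \<le> 1" using t assms by (simp add: powr_le1)
      have "max 1 (p - 1) * (1 - t) \<le> p * (1 - t)"
        using t assms by (intro mult_right_mono) auto
      then have "1 - t powr (p - 1) \<le> p * (1 - t)"
        using Bernoulli_powr(1)[of t "p - 1"] t assms by linarith
      moreover have "1 - t \<le> p * (1 - t)" using t assms mult_right_mono[of 1 p "1 - t"] by simp
      ultimately show "\<bar>t - t powr (p - 1)\<bar> \<le> p * (1 - t)" using pw t by linarith
    qed simp
    also have "\<dots> = p * a powr (p - 2) * (a - b)"
      using t(3) ap by (simp add: algebra_simps)
    also have "\<dots> \<le> p * a powr (p - 2) * norm (y - y')"
      using assms norm_triangle_ineq2[of y y'] by (intro mult_left_mono) (auto simp: a_def b_def)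
    finally have 1: "\<bar>a powr (p - 2) - b powr (p - 2)\<bar> * b \<le> p * a powr (p - 2) * norm (y - y')" .
    have "duality_map p y - duality_map p y'
        = a powr (p - 2) *\<^sub>R (y - y') + (a powr (p - 2) - b powr (p - 2)) *\<^sub>R y'"
      by (simp add: duality_map_def a_def b_def algebra_simps)
    then have "norm (duality_map p y - duality_map p y')
        \<le> a powr (p - 2) * norm (y - y') + \<bar>a powr (p - 2) - b powr (p - 2)\<bar> * b"
      using norm_triangle_ineq[of "a powr (p - 2) *\<^sub>R (y - y')"
          "(a powr (p - 2) - b powr (p - 2)) *\<^sub>R y'"] by (simp add: b_def)
    with 1 show ?thesis by (simp add: algebra_simps a_def)
  qed
  show ?thesis
  proof (cases "norm y' \<le> norm y")
    case True
    then show ?thesis using main[of y' y] by (simp add: max_def)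
  next
    case False
    then show ?thesis using main[of y y'] by (simp add: max_def norm_minus_commute)
  qed
qed

text \<open>Radial and angular parts separate: with a = |y|, b = |y'|, A = a^(p-2), B = b^(p-2) and
  w = a b - y . y', the right side is (A a - B b)(a - b) + (A + B) w, while |y - y'|^2 = (a - b)^2 +
  2 w. The radial part limits the constant to min(1, p - 1), the factor 2 before w to 1/2.\<close>

lemma duality_map_strongly_monotone:
  fixes y y' :: "'a::real_inner"
  assumes "1 < p"
  shows "min (1/2) (p - 1) * max (norm y) (norm y') powr (p - 2) * (norm (y - y'))\<^sup>2
    \<le> (duality_map p y - duality_map p y') \<bullet> (y - y')"
proof -
  have main: "min (1/2) (p - 1) * norm y powr (p - 2) * (norm (y - y'))\<^sup>2
      \<le> (duality_map p y - duality_map p y') \<bullet> (y - y')"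
    if le: "norm y' \<le> norm y" for y y' :: 'a
  proof (cases "y = 0")
    case True
    then show ?thesis using le by simp
  next
    case False
    define a b t w where "a = norm y" and "b = norm y'" and "t = b / a" and "w = a * b - y \<bullet> y'"
    have a: "a > 0" and b: "b \<ge> 0" "b \<le> a" using False le by (auto simp: a_def b_def)
    have t: "0 \<le> t" "t \<le> 1" "b = t * a" using a b by (auto simp: t_def)
    have w: "w \<ge> 0" using norm_cauchy_schwarz[of y y'] by (simp add: w_def a_def b_def)
    define A B where "A = a powr (p - 2)" and "B = b powr (p - 2)"
    have AB: "A \<ge> 0" "B \<ge> 0" by (auto simp: A_def B_def)
    have bp: "B * b = a powr (p - 1) * t powr (p - 1)"
      unfolding B_def powr_diff_one_mult[OF b(1)] unfolding t(3) using t(1) a by (simp add: powr_mult)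
    have ap: "A * a = a powr (p - 1)"
      unfolding A_def using a by (intro powr_diff_one_mult) simp
    define c where "c = min (1/2) (p - 1)"
    have c: "0 < c" "c \<le> 1/2" "c \<le> min 1 (p - 1)" using assms by (auto simp: c_def min_def)
    have yy: "y \<bullet> y = a\<^sup>2" "y' \<bullet> y' = b\<^sup>2" by (simp_all add: a_def b_def power2_norm_eq_inner)
    have ns: "(norm (y - y'))\<^sup>2 = (a - b)\<^sup>2 + 2 * w"
      unfolding power2_norm_eq_inner w_def
      by (simp add: inner_diff yy inner_commute power2_diff)
    have "(duality_map p y - duality_map p y') \<bullet> (y - y') = A * a\<^sup>2 + B * b\<^sup>2 - (A + B) * (y \<bullet> y')"
      by (simp add: duality_map_def inner_diff inner_commute yy A_def B_def algebra_simps
          flip: a_def b_def)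
    also have "\<dots> = (A * a - B * b) * (a - b) + (A + B) * w"
      by (simp add: w_def algebra_simps power2_eq_square)
    finally have eq: "(duality_map p y - duality_map p y') \<bullet> (y - y')
      = (A * a - B * b) * (a - b) + (A + B) * w" .
    have "c * (1 - t) \<le> min 1 (p - 1) * (1 - t)" using c t by (intro mult_right_mono) auto
    then have "c * (1 - t) \<le> 1 - t powr (p - 1)"
      using Bernoulli_powr(2)[of t "p - 1"] t assms by linarith
    then have "(A * a) * (c * (1 - t)) \<le> (A * a) * (1 - t powr (p - 1))"
      using AB a by (intro mult_left_mono) auto
    also have "\<dots> = A * a - B * b" using bp ap by (simp add: algebra_simps)
    finally have "c * A * (a - b) \<le> A * a - B * b" using t(3) by (simp add: algebra_simps)
    then have "c * A * (a - b) * (a - b) \<le> (A * a - B * b) * (a - b)"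
      using b by (intro mult_right_mono) auto
    moreover have "(2 * c * A) * w \<le> (A + B) * w"
      using w AB c mult_right_mono[of c "1/2" A] by (intro mult_right_mono) linarith+
    ultimately show ?thesis
      unfolding eq ns c_def[symmetric] a_def[symmetric] A_def[symmetric]
      by (simp add: algebra_simps power2_eq_square)
  qed
  show ?thesis
  proof (cases "norm y' \<le> norm y")
    case True
    then show ?thesis using main[of y' y] by (simp add: max_def)
  next
    case False
    have "(duality_map p y - duality_map p y') \<bullet> (y - y') = (duality_map p y' - duality_map p y) \<bullet> (y' - y)"
      by (metis inner_minus_left inner_minus_right minus_diff_eq minus_minus)
    then show ?thesis using main[of y y'] False by (simp add: max_def norm_minus_commute)
  qed
qed

text \<open>The tangent inequality based at y + h, not at y, bounds the value at y + h from above;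
  replacing its gradient by the one at y costs the Lipschitz bound times |h|.\<close>

lemma norm_powr_quadratic_bound:
  fixes y h :: "'a::real_inner"
  assumes "1 < p"
  shows "norm (y + h) powr p \<le> norm y powr p + p * (duality_map p y \<bullet> h)
    + p * (p + 1) * max (norm y) (norm (y + h)) powr (p - 2) * (norm h)\<^sup>2"
proof -
  have "norm (y + h) powr p - p * (duality_map p (y + h) \<bullet> h) \<le> norm y powr p"
    using norm_powr_tangent[OF assms, of "y + h" y] by simp
  moreover have "(duality_map p (y + h) - duality_map p y) \<bullet> h
      \<le> norm (duality_map p (y + h) - duality_map p y) * norm h"
    by (rule norm_cauchy_schwarz)
  moreover have "\<dots> \<le> ((p + 1) * max (norm y) (norm (y + h)) powr (p - 2) * norm h) * norm h"
    using duality_map_lipschitz[OF assms, of "y + h" y]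
    by (intro mult_right_mono) (auto simp: max.commute)
  ultimately have "p * ((duality_map p (y + h) - duality_map p y) \<bullet> h)
      \<le> p * (((p + 1) * max (norm y) (norm (y + h)) powr (p - 2) * norm h) * norm h)"
    using assms by (intro mult_left_mono) auto
  then show ?thesis
    using \<open>norm (y + h) powr p - p * (duality_map p (y + h) \<bullet> h) \<le> norm y powr p\<close>
    by (simp add: inner_diff_left algebra_simps power2_eq_square)
qed

lemma norm_powr_convex:
  fixes a b :: "'a::real_inner"
  assumes "1 < p" "0 \<le> s" "s \<le> 1"
  shows "norm (a + s *\<^sub>R (b - a)) powr p \<le> (1 - s) * norm a powr p + s * norm b powr p"
proof -
  define c where "c = a + s *\<^sub>R (b - a)"
  have "(1 - s) * (norm c powr p + p * (duality_map p c \<bullet> (a - c))) \<le> (1 - s) * norm a powr p"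
       "s * (norm c powr p + p * (duality_map p c \<bullet> (b - c))) \<le> s * norm b powr p"
    using assms norm_powr_tangent by (intro mult_left_mono; fastforce)+
  moreover have "(1 - s) * (duality_map p c \<bullet> (a - c)) + s * (duality_map p c \<bullet> (b - c)) = 0"
  proof -
    have "(1 - s) * (duality_map p c \<bullet> (a - c)) + s * (duality_map p c \<bullet> (b - c))
      = duality_map p c \<bullet> ((1 - s) *\<^sub>R (a - c) + s *\<^sub>R (b - c))"
      by (simp add: inner_add_right)
    also have "(1 - s) *\<^sub>R (a - c) + s *\<^sub>R (b - c) = 0"
      by (simp add: c_def algebra_simps)
    finally show ?thesis by simp
  qed
  then have "p * ((1 - s) * (duality_map p c \<bullet> (a - c)) + s * (duality_map p c \<bullet> (b - c))) = 0"
    by simp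
  ultimately show ?thesis unfolding c_def[symmetric] by (simp add: algebra_simps)
qed

text \<open>Strictness comes from a stop at c + e, halfway from the midpoint c to b: tangents at c
  towards a and towards c + e, and at c + e towards b, add up to the midpoint inequality with
  surplus p (J(c + e) - J(c)) . e, J being the duality map, and strong monotonicity makes this
  positive.\<close>

lemma norm_powr_midpoint_strict:
  fixes a b :: "'a::real_inner"
  assumes "1 < p" "a \<noteq> b"
  shows "2 * norm ((1/2) *\<^sub>R (a + b)) powr p < norm a powr p + norm b powr p"
proof -
  define c e where "c = (1/2) *\<^sub>R (a + b)" and "e = (1/4) *\<^sub>R (b - a)"
  have "c - (e + e) = (1/2) *\<^sub>R (a + b) - (1/2) *\<^sub>R (b - a)"
    unfolding c_def e_def by (simp flip: scaleR_add_left)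
  also have "\<dots> = (1/2) *\<^sub>R (a + a)" by (simp flip: scaleR_diff_right)
  finally have a: "a = c - (e + e)" by (simp flip: scaleR_2)
  have "c + (e + e) = (1/2) *\<^sub>R (a + b) + (1/2) *\<^sub>R (b - a)"
    unfolding c_def e_def by (simp flip: scaleR_add_left)
  also have "\<dots> = (1/2) *\<^sub>R (b + b)" by (simp flip: scaleR_add_right)
  finally have b: "b = c + (e + e)" by (simp flip: scaleR_2)
  have e0: "e \<noteq> 0" using assms(2) by (simp add: e_def)
  have "norm c powr p + p * (duality_map p c \<bullet> (a - c)) \<le> norm a powr p"
    by (rule norm_powr_tangent[OF assms(1)])
  moreover have "norm c powr p + p * (duality_map p c \<bullet> ((c + e) - c)) \<le> norm (c + e) powr p"
    by (rule norm_powr_tangent[OF assms(1)])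
  moreover have "norm (c + e) powr p + p * (duality_map p (c + e) \<bullet> (b - (c + e))) \<le> norm b powr p"
    by (rule norm_powr_tangent[OF assms(1)])
  moreover have "0 < (duality_map p (c + e) - duality_map p c) \<bullet> e"
  proof -
    have "0 < max (norm (c + e)) (norm c)"
      using e0 by (metis add_0 less_max_iff_disj zero_less_norm_iff)
    then have "0 < min (1/2) (p - 1) * max (norm (c + e)) (norm c) powr (p - 2) * (norm e)\<^sup>2"
      using assms(1) e0 by auto
    then show ?thesis using duality_map_strongly_monotone[OF assms(1), of "c + e" c] by simp
  qed
  moreover have "b - (c + e) = e" "a - c = - (e + e)"
    using a b by auto
  ultimately have "norm c powr p - p * (duality_map p c \<bullet> (e + e)) \<le> norm a powr p"
      "norm c powr p + p * (duality_map p c \<bullet> e) \<le> norm (c + e) powr p"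
      "norm (c + e) powr p + p * (duality_map p (c + e) \<bullet> e) \<le> norm b powr p"
      "0 < p * ((duality_map p (c + e) - duality_map p c) \<bullet> e)"
    using assms(1) by (simp_all del: minus_add_distrib)
  then show ?thesis
    unfolding c_def[symmetric] by (simp add: inner_diff_left inner_add_right algebra_simps)
qed

subsection \<open>Euclidean barycenters\<close>

definition bary_cost ::
    "real \<Rightarrow> nat set \<Rightarrow> (nat \<Rightarrow> real) \<Rightarrow> (nat \<Rightarrow> 'a::euclidean_space) \<Rightarrow> 'a \<Rightarrow> real" where
  "bary_cost p I w x z = (\<Sum>i\<in>I. w i * norm (x i - z) powr p)"

lemma bary_cost_nonneg: "(\<And>i. i \<in> I \<Longrightarrow> 0 \<le> w i) \<Longrightarrow> 0 \<le> bary_cost p I w x z"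
  unfolding bary_cost_def by (intro sum_nonneg mult_nonneg_nonneg) auto

lemma bary_cost_cong: "(\<And>i. i \<in> I \<Longrightarrow> x i = y i) \<Longrightarrow> bary_cost p I w x z = bary_cost p I w y z"
  unfolding bary_cost_def by (intro sum.cong) auto

lemma euclidean_barycenter_eq:
  "euclidean_barycenter p I w x = (SOME z. \<forall>y. bary_cost p I w x z \<le> bary_cost p I w x y)"
  unfolding euclidean_barycenter_def arg_min_def is_arg_min_linorder bary_cost_def by simp

text \<open>Every point of the ball of radius r is strictly closer to the origin than to a z of norm
  above 2 r.\<close>

lemma bary_cost_minimizer_bound:
  assumes "0 < p" "finite I" "I \<noteq> {}" "\<And>i. i \<in> I \<Longrightarrow> 0 < w i" "\<And>i. i \<in> I \<Longrightarrow> norm (x i) \<le> r"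
    and "2 * r < norm z"
  shows "bary_cost p I w x 0 < bary_cost p I w x z"
  unfolding bary_cost_def
proof (rule sum_strict_mono)
  fix i assume i: "i \<in> I"
  have "norm (x i - 0) < norm (x i - z)"
    using assms(5)[OF i] assms(6) norm_triangle_ineq2[of z "x i"] by (simp add: norm_minus_commute)
  then have "norm (x i - 0) powr p < norm (x i - z) powr p"
    using assms(1) by (intro powr_less_mono2) auto
  then show "w i * norm (x i - 0) powr p < w i * norm (x i - z) powr p"
    using assms(4)[OF i] by simp
qed (use assms in auto)

lemma continuous_on_bary_cost: "0 < p \<Longrightarrow> continuous_on UNIV (bary_cost p I w x)"
  unfolding bary_cost_def by (intro continuous_intros continuous_on_powr') auto

lemma bary_cost_minimizer_exists:
  assumes "0 < p" "finite I" "I \<noteq> {}" "\<And>i. i \<in> I \<Longrightarrow> 0 < w i"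
  shows "\<exists>z. \<forall>y. bary_cost p I w x z \<le> bary_cost p I w x y"
proof -
  define r where "r = (\<Sum>i\<in>I. norm (x i))"
  have r: "norm (x i) \<le> r" if "i \<in> I" for i
    unfolding r_def using that assms(2) by (intro member_le_sum) auto
  have r0: "0 \<le> r" unfolding r_def by (simp add: sum_nonneg)
  obtain z where z: "\<And>y. y \<in> cball 0 (2 * r) \<Longrightarrow> bary_cost p I w x z \<le> bary_cost p I w x y"
  proof (rule bexE[OF continuous_attains_inf])
    show "continuous_on (cball 0 (2 * r)) (bary_cost p I w x)"
      by (rule continuous_on_subset[OF continuous_on_bary_cost[OF assms(1)]]) simp
  qed (use r0 that in \<open>auto simp: Ball_def\<close>)
  have "bary_cost p I w x z \<le> bary_cost p I w x y" for y
  proof (cases "norm y \<le> 2 * r")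
    case True
    then show ?thesis using z[of y] by simp
  next
    case False
    then have "bary_cost p I w x 0 < bary_cost p I w x y"
      using assms r by (intro bary_cost_minimizer_bound[where r = r]) auto
    then show ?thesis using z[of 0] r0 by simp
  qed
  then show ?thesis by blast
qed

lemma bary_cost_minimizer_unique:
  assumes "1 < p" "finite I" "I \<noteq> {}" "\<And>i. i \<in> I \<Longrightarrow> 0 < w i"
    and z: "\<And>y. bary_cost p I w x z \<le> bary_cost p I w x y"
    and z': "\<And>y. bary_cost p I w x z' \<le> bary_cost p I w x y"
  shows "z = z'"
proof (rule ccontr)
  assume ne: "z \<noteq> z'"
  define c where "c = (1/2) *\<^sub>R (z + z')"
  have "(\<Sum>i\<in>I. 2 * (w i * norm (x i - c) powr p))
      < (\<Sum>i\<in>I. w i * norm (x i - z) powr p + w i * norm (x i - z') powr p)"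
  proof (rule sum_strict_mono)
    fix i assume i: "i \<in> I"
    have "(1/2) *\<^sub>R ((x i - z) + (x i - z')) = (1/2) *\<^sub>R (x i + x i) - c"
      by (simp add: c_def algebra_simps)
    also have "(1/2) *\<^sub>R (x i + x i) = x i" by (simp flip: scaleR_2)
    finally have "2 * norm (x i - c) powr p < norm (x i - z) powr p + norm (x i - z') powr p"
      using norm_powr_midpoint_strict[OF assms(1), of "x i - z" "x i - z'"] ne by simp
    from mult_strict_left_mono[OF this assms(4)[OF i]]
    show "2 * (w i * norm (x i - c) powr p)
        < w i * norm (x i - z) powr p + w i * norm (x i - z') powr p"
      by (simp add: algebra_simps)
  qed (use assms in auto)
  then have "2 * bary_cost p I w x c < bary_cost p I w x z + bary_cost p I w x z'"
    unfolding bary_cost_def by (simp add: sum.distrib sum_distrib_left)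
  then show False using z[of c] z'[of c] by linarith
qed

lemma euclidean_barycenter_minimal:
  assumes "0 < p" "finite I" "I \<noteq> {}" "\<And>i. i \<in> I \<Longrightarrow> 0 < w i"
  shows "bary_cost p I w x (euclidean_barycenter p I w x) \<le> bary_cost p I w x y"
proof -
  have "\<exists>z. \<forall>y. bary_cost p I w x z \<le> bary_cost p I w x y"
    using assms by (intro bary_cost_minimizer_exists) auto
  from someI_ex[OF this] show ?thesis unfolding euclidean_barycenter_eq by blast
qed

lemma euclidean_barycenter_unique:
  assumes "1 < p" "finite I" "I \<noteq> {}" "\<And>i. i \<in> I \<Longrightarrow> 0 < w i"
    and "\<And>y. bary_cost p I w x z \<le> bary_cost p I w x y"
  shows "euclidean_barycenter p I w x = z"
proof (rule bary_cost_minimizer_unique[OF assms(1-4)])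
  show "bary_cost p I w x (euclidean_barycenter p I w x) \<le> bary_cost p I w x y" for y
    using assms(1-4) by (intro euclidean_barycenter_minimal) auto
qed (use assms in auto)

lemma norm_bary_cost_minimizer:
  assumes "0 < p" "finite I" "I \<noteq> {}" "\<And>i. i \<in> I \<Longrightarrow> 0 < w i" "\<And>i. i \<in> I \<Longrightarrow> norm (x i) \<le> r"
    and "\<And>y. bary_cost p I w x z \<le> bary_cost p I w x y"
  shows "norm z \<le> 2 * r"
proof (rule ccontr)
  assume "\<not> norm z \<le> 2 * r"
  then have "bary_cost p I w x 0 < bary_cost p I w x z"
    by (intro bary_cost_minimizer_bound[OF assms(1-5)]) auto
  then show False using assms(6)[of 0] by simp
qed

text \<open>The error depends on the weights only through \<open>sum w I\<close>; this keeps all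
  later constants independent of the number of points.\<close>

lemma bary_cost_quadratic_bound:
  assumes "1 < p" "\<And>i. i \<in> I \<Longrightarrow> 0 \<le> w i"
    and "\<And>i. i \<in> I \<Longrightarrow> max (norm (z - x i)) (norm (z + h - x i)) powr (p - 2) \<le> B"
  shows "bary_cost p I w x (z + h) \<le> bary_cost p I w x z
    + p * ((\<Sum>i\<in>I. w i *\<^sub>R duality_map p (z - x i)) \<bullet> h) + sum w I * (p * (p + 1) * B * (norm h)\<^sup>2)"
proof -
  have "bary_cost p I w x (z + h)
      \<le> (\<Sum>i\<in>I. w i * (norm (x i - z) powr p + p * (duality_map p (z - x i) \<bullet> h)
          + p * (p + 1) * B * (norm h)\<^sup>2))"
    unfolding bary_cost_def
  proof (intro sum_mono mult_left_mono)
    fix i assume i: "i \<in> I"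
    have "norm (x i - (z + h)) powr p = norm ((z - x i) + h) powr p"
      by (metis add_diff_eq diff_add_eq norm_minus_commute)
    also have "\<dots> \<le> norm (z - x i) powr p + p * (duality_map p (z - x i) \<bullet> h)
        + p * (p + 1) * max (norm (z - x i)) (norm ((z - x i) + h)) powr (p - 2) * (norm h)\<^sup>2"
      by (rule norm_powr_quadratic_bound[OF assms(1)])
    also have "p * (p + 1) * max (norm (z - x i)) (norm ((z - x i) + h)) powr (p - 2) * (norm h)\<^sup>2
        \<le> p * (p + 1) * B * (norm h)\<^sup>2"
      using assms(1) assms(3)[OF i] by (intro mult_right_mono mult_left_mono) (auto simp: algebra_simps)
    finally show "norm (x i - (z + h)) powr p \<le> norm (x i - z) powr p
        + p * (duality_map p (z - x i) \<bullet> h) + p * (p + 1) * B * (norm h)\<^sup>2"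
      by (simp add: norm_minus_commute)
  qed (use assms in auto)
  also have "\<dots> = bary_cost p I w x z + p * ((\<Sum>i\<in>I. w i *\<^sub>R duality_map p (z - x i)) \<bullet> h)
      + sum w I * (p * (p + 1) * B * (norm h)\<^sup>2)"
    unfolding bary_cost_def
    by (simp add: sum.distrib distrib_left inner_sum_left sum_distrib_left sum_distrib_right
        mult.left_commute)
  finally show ?thesis .
qed

text \<open>For p < 2 the power is decreasing and the maximum is at least |y| > 0, so even y + h = 0
  does no harm.\<close>

lemma norm_powr_bounded_of_nonzero:
  fixes y :: "'a::real_normed_vector"
  assumes "2 \<le> p \<or> y \<noteq> 0"
  obtains B where "\<And>h. norm h \<le> 1 \<Longrightarrow> max (norm y) (norm (y + h)) powr (p - 2) \<le> B"
proof (cases "2 \<le> p")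
  case True
  have "max (norm y) (norm (y + h)) powr (p - 2) \<le> (norm y + 1) powr (p - 2)" if "norm h \<le> 1" for h
    using True that norm_triangle_ineq[of y h] by (intro powr_mono2) (auto simp: le_max_iff_disj)
  then show ?thesis using that by blast
next
  case False
  then have "max (norm y) (norm (y + h)) powr (p - 2) \<le> norm y powr (p - 2)" for h
    using assms by (intro powr_mono2') auto
  then show ?thesis using that by blast
qed

text \<open>The first-order condition, by a descent step: moving from z by -t v, with v the sum in
  question, changes the cost by at most -t p |v|^2 plus a term of order t^2. The assumption on
  \<open>x i \<noteq> z\<close> keeps the quadratic coefficient finite for p < 2.\<close>

lemma bary_cost_stationary:
  assumes p: "1 < p" and fin: "finite I" and w: "\<And>i. i \<in> I \<Longrightarrow> 0 < w i"
    and z: "\<And>y. bary_cost p I w x z \<le> bary_cost p I w x y"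
    and nz: "\<And>i. i \<in> I \<Longrightarrow> 2 \<le> p \<or> x i \<noteq> z"
  shows "(\<Sum>i\<in>I. w i *\<^sub>R duality_map p (z - x i)) = 0"
proof (rule ccontr)
  define v where "v = (\<Sum>i\<in>I. w i *\<^sub>R duality_map p (z - x i))"
  assume "(\<Sum>i\<in>I. w i *\<^sub>R duality_map p (z - x i)) \<noteq> 0"
  then have v: "v \<noteq> 0" by (simp add: v_def)
  have "\<exists>b. \<forall>h. norm h \<le> 1 \<longrightarrow> max (norm (z - x i)) (norm (z - x i + h)) powr (p - 2) \<le> b"
    if "i \<in> I" for i
    using norm_powr_bounded_of_nonzero[of p "z - x i"] nz[OF that]
    by (metis (no_types, lifting) eq_iff_diff_eq_0)
  then obtain b where b: "\<And>i h. i \<in> I \<Longrightarrow> norm h \<le> 1 \<Longrightarrow>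
      max (norm (z - x i)) (norm (z - x i + h)) powr (p - 2) \<le> b i"
    by metis
  define B where "B = (\<Sum>i\<in>I. \<bar>b i\<bar>)"
  have B: "max (norm (z - x i)) (norm (z + h - x i)) powr (p - 2) \<le> B" if "i \<in> I" "norm h \<le> 1" for i h
  proof -
    have "\<bar>b i\<bar> \<le> B" unfolding B_def using that fin by (intro member_le_sum) auto
    then show ?thesis using b[OF that] by (simp add: algebra_simps)
  qed
  define K where "K = sum w I * (p * (p + 1) * B) + 1"
  have "0 \<le> B" unfolding B_def by (simp add: sum_nonneg)
  then have K: "K > 0" unfolding K_def using p w
    by (intro add_nonneg_pos mult_nonneg_nonneg sum_nonneg) (auto simp: less_imp_le)
  \<comment> \<open>The first entry keeps the step inside the unit ball, where B is valid; the
    second keeps the quadratic term at most half of the linear gain.\<close>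
  define t where "t = min (1 / norm v) (p / (2 * K))"
  have t: "0 < t" "t * norm v \<le> 1" "t * K \<le> p / 2"
    using v K p by (auto simp: t_def min_def field_simps split: if_splits)
  have "bary_cost p I w x (z + (- t *\<^sub>R v)) \<le> bary_cost p I w x z
    + p * (v \<bullet> (- t *\<^sub>R v)) + sum w I * (p * (p + 1) * B * (norm (- t *\<^sub>R v))\<^sup>2)"
    unfolding v_def
  proof (rule bary_cost_quadratic_bound)
    show "max (norm (z - x i)) (norm (z + - t *\<^sub>R (\<Sum>i\<in>I. w i *\<^sub>R duality_map p (z - x i)) - x i)) powr (p - 2) \<le> B"
      if "i \<in> I" for i
      using t by (intro B that) (simp flip: v_def)
  qed (use p w in \<open>auto simp: less_imp_le\<close>)
  also have "\<dots> = bary_cost p I w x z - t * (norm v)\<^sup>2 * (p - t * (K - 1))"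
    using t by (simp add: K_def power2_norm_eq_inner power_mult_distrib) (simp add: algebra_simps power2_eq_square)
  also have "\<dots> < bary_cost p I w x z"
  proof -
    have "t * (K - 1) < p" using t p by (simp add: algebra_simps)
    then show ?thesis using t v by simp
  qed
  finally show False using z[of "z + (- t *\<^sub>R v)"] by linarith
qed

text \<open>The test points \<open>u = z' + sY\<close>, \<open>v = z - sY\<close> move the first cost only along a segment, where
  convexity controls it, so that only the curvature \<open>Q\<close> of the other costs enters;
  \<open>s\<close> is chosen to balance \<open>Q s\<^sup>2 |Y|\<^sup>2\<close> against the monotonicity gain \<open>s |Y|\<^sup>2\<close>.\<close>

lemma two_point_estimate:
  fixes p l Q :: real and x\<^sub>1 x\<^sub>1' z z' :: "'a::euclidean_space" and R R' :: "'a \<Rightarrow> real"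
  defines "y \<equiv> z - x\<^sub>1" and "y' \<equiv> z' - x\<^sub>1'"
  defines "c \<equiv> min (1/2) (p - 1)"
  defines "m \<equiv> max (norm y) (norm y') powr (p - 2)"
  assumes p: "1 < p" and l: "0 < l" and Q: "0 \<le> Q"
    and R: "\<And>k. norm k \<le> norm (z' - z) + norm (y - y') \<Longrightarrow>
      R (z + k) \<le> R z - l * p * (duality_map p y \<bullet> k) + Q * (norm k)\<^sup>2"
    and R': "\<And>k. norm k \<le> norm (z' - z) + norm (y - y') \<Longrightarrow>
      R' (z' + k) \<le> R' z' - l * p * (duality_map p y' \<bullet> k) + Q * (norm k)\<^sup>2"
    and swap: "\<And>u v. l * norm (z - x\<^sub>1) powr p + R z + (l * norm (z' - x\<^sub>1') powr p + R' z')
      \<le> l * norm (u - x\<^sub>1') powr p + R u + (l * norm (v - x\<^sub>1) powr p + R' v)"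
  shows "norm (y - y') \<le> (2 * (p + 1) / c + 1) * norm (z - z') * max 1 (8 * Q / (c * (l * p * m)))"
proof (cases "y = y'")
  case True
  have "0 < c" using p by (simp add: c_def)
  then show ?thesis using True p by simp
next
  case False
  \<comment> \<open>\<open>c * T\<close> is the convexity modulus of the first cost and Q the
    curvature of the others; H dominates both, so that s = c T / H is at most 1 and s H = c
    T.\<close>
  define Y r T H where "Y = y - y'" and "r = norm (z - z')" and "T = l * p * m"
    and "H = max (c * T) (8 * Q)"
  define s where "s = c * T / H"
  have Y: "0 < norm Y" using False by (simp add: Y_def)
  have "0 < max (norm y) (norm y')" using False by (metis less_max_iff_disj zero_less_norm_iff)
  then have m: "0 < m" by (simp add: m_def)
  have c: "0 < c" using p by (simp add: c_def)
  have T: "0 < T" using m l p by (simp add: T_def)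
  have H: "0 < H" "c * T \<le> H" "8 * Q \<le> H" using c T by (auto simp: H_def less_max_iff_disj)
  have s: "0 < s" "s \<le> 1" "s * H = c * T" using H c T by (auto simp: s_def)
  define k where "k = z' - z + s *\<^sub>R Y"
  have k: "norm k \<le> r + s * norm Y"
    unfolding k_def r_def using s norm_triangle_ineq[of "z' - z" "s *\<^sub>R Y"] by (simp add: norm_minus_commute)
  then have k1: "norm k \<le> norm (z' - z) + norm (y - y')"
    using mult_right_mono[OF s(2) norm_ge_zero[of Y]] unfolding r_def Y_def[symmetric]
    by (simp add: norm_minus_commute)
  have "R (z + k) \<le> R z - l * p * (duality_map p y \<bullet> k) + Q * (norm k)\<^sup>2"
    by (rule R[OF k1])
  moreover have "R' (z' + - k) \<le> R' z' - l * p * (duality_map p y' \<bullet> (- k)) + Q * (norm (- k))\<^sup>2"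
    using k1 by (intro R') simp
  moreover have "l * norm y powr p + R z + (l * norm y' powr p + R' z')
      \<le> l * norm (y' + s *\<^sub>R (y - y')) powr p + R (z + k)
        + (l * norm (y + s *\<^sub>R (y' - y)) powr p + R' (z' + - k))"
  proof -
    have "z + k - x\<^sub>1' = y' + s *\<^sub>R (y - y')" "z' + - k - x\<^sub>1 = y + s *\<^sub>R (y' - y)"
      by (simp_all add: k_def Y_def y'_def y_def algebra_simps)
    then show ?thesis using swap[of "z + k" "z' + - k"] unfolding y_def[symmetric] y'_def[symmetric]
      by (simp only:)
  qed
  moreover have "l * norm (y' + s *\<^sub>R (y - y')) powr p
      \<le> l * ((1 - s) * norm y' powr p + s * norm y powr p)"
    using l s p by (intro mult_left_mono norm_powr_convex) auto
  moreover have "l * norm (y + s *\<^sub>R (y' - y)) powr p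
      \<le> l * ((1 - s) * norm y powr p + s * norm y' powr p)"
    using l s p by (intro mult_left_mono norm_powr_convex) auto
  \<comment> \<open>The first costs cancel: y' + s Y and y - s Y lie on the segment from y' to y
    with complementary parameters, so by convexity their costs add up to at most those of y and y'.
    Only the first and second order terms of R and R' remain.\<close>
  ultimately have *: "l * p * ((duality_map p y - duality_map p y') \<bullet> k) \<le> 2 * Q * (norm k)\<^sup>2"
    by (simp add: inner_diff_left algebra_simps)
  have "(duality_map p y - duality_map p y') \<bullet> k
      = s * ((duality_map p y - duality_map p y') \<bullet> Y) + (duality_map p y - duality_map p y') \<bullet> (z' - z)"
    by (simp add: k_def inner_add_right)
  moreover have "s * (c * m * (norm Y)\<^sup>2) \<le> s * ((duality_map p y - duality_map p y') \<bullet> Y)"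
    using s duality_map_strongly_monotone[OF p, of y y'] by (intro mult_left_mono) (auto simp: c_def m_def Y_def)
  moreover have "- ((p + 1) * m * norm Y * r) \<le> (duality_map p y - duality_map p y') \<bullet> (z' - z)"
  proof -
    have "\<bar>(duality_map p y - duality_map p y') \<bullet> (z' - z)\<bar>
        \<le> norm (duality_map p y - duality_map p y') * norm (z' - z)"
      by (rule Cauchy_Schwarz_ineq2)
    also have "\<dots> \<le> ((p + 1) * m * norm Y) * norm (z' - z)"
      using duality_map_lipschitz[OF p, of y y'] by (intro mult_right_mono) (auto simp: m_def Y_def)
    finally show ?thesis by (simp add: r_def norm_minus_commute)
  qed
  ultimately have "s * (c * m * (norm Y)\<^sup>2) - (p + 1) * m * norm Y * r
      \<le> (duality_map p y - duality_map p y') \<bullet> k" by linarith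
  then have "l * p * (s * (c * m * (norm Y)\<^sup>2) - (p + 1) * m * norm Y * r)
      \<le> l * p * ((duality_map p y - duality_map p y') \<bullet> k)"
    using l p by (intro mult_left_mono) auto
  also note *
  also have "2 * Q * (norm k)\<^sup>2 \<le> 2 * Q * (2 * r\<^sup>2 + 2 * (s * norm Y)\<^sup>2)"
  proof (intro mult_left_mono)
    have "(norm k)\<^sup>2 \<le> (r + s * norm Y)\<^sup>2" using k by (intro power_mono) auto
    also have "\<dots> \<le> 2 * r\<^sup>2 + 2 * (s * norm Y)\<^sup>2"
      using zero_le_power2[of "r - s * norm Y"] by (simp add: power2_eq_square algebra_simps)
    finally show "(norm k)\<^sup>2 \<le> 2 * r\<^sup>2 + 2 * (s * norm Y)\<^sup>2" .
  qed (use Q in auto)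
  also have "\<dots> = 4 * Q * (r\<^sup>2 + (s * norm Y)\<^sup>2)" by simp
  also have "\<dots> \<le> (H / 2) * (r\<^sup>2 + (s * norm Y)\<^sup>2)"
    using H by (intro mult_right_mono) auto
  finally have "c * T * s * (norm Y)\<^sup>2 \<le> (p + 1) * T * norm Y * r + H / 2 * (r\<^sup>2 + (s * norm Y)\<^sup>2)"
    by (simp add: T_def algebra_simps)
  \<comment> \<open>With T = s H / c and b = s |Y| every term carries the factor H. Dividing it out
    leaves b^2 <= 2 (p + 1) / c * b r + r^2, which bounds b by a multiple of r.\<close>
  moreover define b where "b = s * norm Y"
  moreover have "c * T * s * (norm Y)\<^sup>2 = H * b\<^sup>2"
    unfolding s(3)[symmetric] b_def by (simp add: power2_eq_square)
  moreover have "(p + 1) * T * norm Y * r = (p + 1) / c * H * b * r"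
  proof -
    have "T = s * H / c" using s(3) c by (simp add: field_simps)
    then show ?thesis by (simp add: b_def)
  qed
  ultimately have "H * b\<^sup>2 \<le> (p + 1) / c * H * b * r + H / 2 * (r\<^sup>2 + b\<^sup>2)" by simp
  then have "H * (b\<^sup>2) \<le> H * (2 * ((p + 1) / c) * b * r + r\<^sup>2)" by (simp add: field_simps)
  then have b2: "b\<^sup>2 \<le> 2 * ((p + 1) / c) * b * r + r\<^sup>2" using H by simp
  have b0: "0 \<le> b" "0 \<le> r" using s by (auto simp: b_def r_def)
  have "b \<le> (2 * (p + 1) / c + 1) * r"
  proof (rule ccontr)
    assume n: "\<not> b \<le> (2 * (p + 1) / c + 1) * r"
    have "r \<le> (2 * (p + 1) / c + 1) * r" using c p b0 by (simp add: algebra_simps)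
    then have rb: "r < b" using n by linarith
    have "(2 * (p + 1) / c + 1) * r * b < b * b" using n rb b0 by (intro mult_strict_right_mono) auto
    moreover have "r * r \<le> r * b" using rb b0 by (intro mult_left_mono) auto
    ultimately show False using b2 by (simp add: power2_eq_square algebra_simps)
  qed
  then have "norm Y \<le> (2 * (p + 1) / c + 1) * r / s" using s by (simp add: b_def field_simps)
  also have "1 / s = max 1 (8 * Q / (c * T))"
    using c T H by (auto simp: s_def H_def max_def field_simps)
  then have "(2 * (p + 1) / c + 1) * r / s = (2 * (p + 1) / c + 1) * r * max 1 (8 * Q / (c * T))"
    by (metis times_divide_eq_right mult.right_neutral)
  finally show ?thesis unfolding Y_def r_def T_def .
qed

section \<open>Lipschitz estimates for stable pairs of configurations\<close>

definition swap_stable ::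
    "real \<Rightarrow> nat \<Rightarrow> (nat \<Rightarrow> real) \<Rightarrow> (nat \<Rightarrow> 'a::euclidean_space) \<Rightarrow> 'a \<Rightarrow> (nat \<Rightarrow> 'a) \<Rightarrow> 'a \<Rightarrow> bool" where
  "swap_stable p N w x z x' z' \<longleftrightarrow> (\<forall>u v.
     bary_cost p {1..N} w x z + bary_cost p {1..N} w x' z'
       \<le> bary_cost p {1..N} w (x(1 := x' 1)) u + bary_cost p {1..N} w (x'(1 := x 1)) v)"

text \<open>For minimisers z and z', \<open>swap_stable\<close> is two-point cyclical monotonicity,
  restricted to the first coordinate, for the multi-marginal cost obtained by minimising
  \<open>bary_cost\<close> over the point. The conditions on N and w are included so that the
  constants below can be chosen before N and w.\<close>

definition stable_pair ::
    "real \<Rightarrow> nat \<Rightarrow> (nat \<Rightarrow> real) \<Rightarrow> real \<Rightarrow> (nat \<Rightarrow> 'a::euclidean_space) \<Rightarrow> 'a \<Rightarrow> (nat \<Rightarrow> 'a) \<Rightarrow> 'a \<Rightarrow> bool" where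
  "stable_pair p N w r x z x' z' \<longleftrightarrow> 2 \<le> N \<and> (\<forall>i\<in>{1..N}. 0 < w i) \<and> sum w {1..N} = 1
     \<and> (\<forall>i\<in>{1..N}. norm (x i) \<le> r \<and> norm (x' i) \<le> r)
     \<and> (\<forall>y. bary_cost p {1..N} w x z \<le> bary_cost p {1..N} w x y)
     \<and> (\<forall>y. bary_cost p {1..N} w x' z' \<le> bary_cost p {1..N} w x' y)
     \<and> swap_stable p N w x z x' z'"

lemma sum_split_first:
  fixes f :: "nat \<Rightarrow> 'b::comm_monoid_add"
  assumes "2 \<le> N"
  shows "sum f {1..N} = f 1 + sum f {2..N}"
  using sum.atLeast_Suc_atMost[of 1 N f] assms by (simp add: numeral_2_eq_2)

lemma bary_cost_split_first:
  "2 \<le> N \<Longrightarrow> bary_cost p {1..N} w x z = w 1 * norm (x 1 - z) powr p + bary_cost p {2..N} w x z"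
  unfolding bary_cost_def by (rule sum_split_first)

text \<open>Reduction to \<open>two_point_estimate\<close> with R the cost of the points 2, ..., N.
  Stationarity says that the gradient of R at z is minus that of the first cost, which is the linear
  term required there; the quadratic coefficient is Q = (1 - w 1) p (p + 1) B. The leading 1 comes
  from x_1 - x_1' = (z - z') - (y - y') with y = z - x_1 and y' = z' - x_1'.\<close>

lemma swap_stable_lipschitz:
  fixes x x' :: "nat \<Rightarrow> 'a::euclidean_space" and p B :: real
  defines "c \<equiv> min (1/2) (p - 1)"
  assumes p: "1 < p" and N: "2 \<le> N" and w: "\<And>i. i \<in> {1..N} \<Longrightarrow> 0 < w i" and w1: "sum w {1..N} = 1"
    and z: "\<And>y. bary_cost p {1..N} w x z \<le> bary_cost p {1..N} w x y"
    and z': "\<And>y. bary_cost p {1..N} w x' z' \<le> bary_cost p {1..N} w x' y"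
    and nz: "\<And>i. i \<in> {1..N} \<Longrightarrow> 2 \<le> p \<or> x i \<noteq> z \<and> x' i \<noteq> z'"
    and swap: "swap_stable p N w x z x' z'"
    and B0: "0 \<le> B"
    and B: "\<And>k i. i \<in> {1..N} \<Longrightarrow> norm k \<le> norm (z' - z) + norm (z - x 1 - (z' - x' 1)) \<Longrightarrow>
      max (norm (z - x i)) (norm (z + k - x i)) powr (p - 2) \<le> B"
    and B': "\<And>k i. i \<in> {1..N} \<Longrightarrow> norm k \<le> norm (z' - z) + norm (z - x 1 - (z' - x' 1)) \<Longrightarrow>
      max (norm (z' - x' i)) (norm (z' + k - x' i)) powr (p - 2) \<le> B"
  shows "norm (x 1 - x' 1) \<le> (1 + (2 * (p + 1) / c + 1) *
    (1 + 8 * (p + 1) / c * (B * ((1 - w 1) / (w 1 * max (norm (z - x 1)) (norm (z' - x' 1)) powr (p - 2))))))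
    * norm (z - z')"
proof -
  define Q where "Q = (1 - w 1) * (p * (p + 1) * B)"
  define m where "m = max (norm (z - x 1)) (norm (z' - x' 1)) powr (p - 2)"
  have N1: "1 \<in> {1..N}" "{2..N} \<subseteq> {1..N}" using N by auto
  have sw: "sum w {2..N} = 1 - w 1" using sum_split_first[OF N, of w] w1 by simp
  have "0 \<le> sum w {2..N}" using w N1 by (intro sum_nonneg) (auto intro: less_imp_le)
  then have Q: "0 \<le> Q" unfolding Q_def using sw p B0 by (intro mult_nonneg_nonneg) auto
  have stat: "(\<Sum>i=2..N. w i *\<^sub>R duality_map p (\<zeta> - \<xi> i)) = - w 1 *\<^sub>R duality_map p (\<zeta> - \<xi> 1)"
    if "\<And>y. bary_cost p {1..N} w \<xi> \<zeta> \<le> bary_cost p {1..N} w \<xi> y"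
      "\<And>i. i \<in> {1..N} \<Longrightarrow> 2 \<le> p \<or> \<xi> i \<noteq> \<zeta>" for \<xi> \<zeta>
    using bary_cost_stationary[OF p _ w that, simplified] sum_split_first[OF N, of "\<lambda>i. w i *\<^sub>R duality_map p (\<zeta> - \<xi> i)"]
    by (simp add: add_eq_0_iff add.commute)
  have R: "bary_cost p {2..N} w \<xi> (\<zeta> + k) \<le> bary_cost p {2..N} w \<xi> \<zeta>
      - w 1 * p * (duality_map p (\<zeta> - \<xi> 1) \<bullet> k) + Q * (norm k)\<^sup>2"
    if "\<And>y. bary_cost p {1..N} w \<xi> \<zeta> \<le> bary_cost p {1..N} w \<xi> y"
      "\<And>i. i \<in> {1..N} \<Longrightarrow> 2 \<le> p \<or> \<xi> i \<noteq> \<zeta>"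
      "\<And>i. i \<in> {1..N} \<Longrightarrow> max (norm (\<zeta> - \<xi> i)) (norm (\<zeta> + k - \<xi> i)) powr (p - 2) \<le> B" for \<xi> \<zeta> k
  proof -
    have "bary_cost p {2..N} w \<xi> (\<zeta> + k) \<le> bary_cost p {2..N} w \<xi> \<zeta>
      + p * ((\<Sum>i=2..N. w i *\<^sub>R duality_map p (\<zeta> - \<xi> i)) \<bullet> k)
      + sum w {2..N} * (p * (p + 1) * B * (norm k)\<^sup>2)"
    proof (rule bary_cost_quadratic_bound[OF p])
      show "0 \<le> w i" if "i \<in> {2..N}" for i using w[of i] that by auto
    qed (use that(3) N1 in auto)
    moreover have "(\<Sum>i=2..N. w i *\<^sub>R duality_map p (\<zeta> - \<xi> i)) = - w 1 *\<^sub>R duality_map p (\<zeta> - \<xi> 1)"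
      using that by (intro stat) auto
    ultimately show ?thesis by (simp add: sw Q_def algebra_simps)
  qed
  have "norm (z - x 1 - (z' - x' 1))
      \<le> (2 * (p + 1) / min (1/2) (p - 1) + 1) * norm (z - z') * max 1 (8 * Q / (min (1/2) (p - 1) * (w 1 * p * max (norm (z - x 1)) (norm (z' - x' 1)) powr (p - 2))))"
  proof (rule two_point_estimate[OF p w[OF N1(1)] Q])
    show "bary_cost p {2..N} w x (z + k) \<le> bary_cost p {2..N} w x z
      - w 1 * p * (duality_map p (z - x 1) \<bullet> k) + Q * (norm k)\<^sup>2"
      if "norm k \<le> norm (z' - z) + norm (z - x 1 - (z' - x' 1))" for k
      using z nz B that by (intro R) auto
    show "bary_cost p {2..N} w x' (z' + k) \<le> bary_cost p {2..N} w x' z'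
      - w 1 * p * (duality_map p (z' - x' 1) \<bullet> k) + Q * (norm k)\<^sup>2"
      if "norm k \<le> norm (z' - z) + norm (z - x 1 - (z' - x' 1))" for k
      using z' nz B' that by (intro R) auto
    show "w 1 * norm (z - x 1) powr p + bary_cost p {2..N} w x z + (w 1 * norm (z' - x' 1) powr p + bary_cost p {2..N} w x' z')
      \<le> w 1 * norm (u - x' 1) powr p + bary_cost p {2..N} w x u + (w 1 * norm (v - x 1) powr p + bary_cost p {2..N} w x' v)"
      for u v
      using swap bary_cost_cong[of "{2..N}" "x(1 := x' 1)" x] bary_cost_cong[of "{2..N}" "x'(1 := x 1)" x']
      unfolding swap_stable_def bary_cost_split_first[OF N] by (simp add: norm_minus_commute)
  qed
  also have "8 * Q / (min (1/2) (p - 1) * (w 1 * p * max (norm (z - x 1)) (norm (z' - x' 1)) powr (p - 2)))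
      = 8 * (p + 1) / c * (B * ((1 - w 1) / (w 1 * m)))"
  proof -
    have "8 * Q / (c * (w 1 * p * m)) = (p * (8 * (p + 1) * (B * (1 - w 1)))) / (p * (c * (w 1 * m)))"
      by (simp only: Q_def mult_ac)
    also have "\<dots> = (8 * (p + 1) * (B * (1 - w 1))) / (c * (w 1 * m))"
      using p by (subst mult_divide_mult_cancel_left) auto
    finally show ?thesis unfolding c_def[symmetric] m_def[symmetric]
      by (simp only: times_divide_eq_right times_divide_eq_left divide_divide_eq_left mult_ac)
  qed
  also have "max 1 (8 * (p + 1) / c * (B * ((1 - w 1) / (w 1 * m)))) \<le> 1 + 8 * (p + 1) / c * (B * ((1 - w 1) / (w 1 * m)))"
  proof -
    have "0 \<le> 8 * (p + 1) / c * (B * ((1 - w 1) / (w 1 * m)))"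
      using p B0 sw \<open>0 \<le> sum w {2..N}\<close> w[OF N1(1)]
      by (intro mult_nonneg_nonneg divide_nonneg_nonneg) (auto simp: c_def m_def)
    then show ?thesis by simp
  qed
  finally have "norm (z - x 1 - (z' - x' 1)) \<le> (2 * (p + 1) / c + 1) * norm (z - z')
      * (1 + 8 * (p + 1) / c * (B * ((1 - w 1) / (w 1 * m))))"
    using p by (simp add: c_def mult_left_mono)
  moreover have "norm (x 1 - x' 1) \<le> norm (z - z') + norm (z - x 1 - (z' - x' 1))"
    using norm_triangle_ineq4[of "z - z'" "z - x 1 - (z' - x' 1)"] by simp
  moreover have "n \<le> (1 + a * f) * r" if "n \<le> r + y" "y \<le> a * r * f" for n y a f r :: real
    using that by (simp add: algebra_simps)
  ultimately show ?thesis unfolding m_def by blast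
qed

text \<open>V, up to the factor p the gradient of the cost of the points 2, ..., N, vanishes at
  their barycenter \<open>z\<^sub>0\<close> and has norm w 1 |z - x_1|^(p-1) at z, by stationarity.
  For each i one of z - x_i, \<open>z\<^sub>0\<close> - x_i has norm at least d / 2, where d = |z -
  \<open>z\<^sub>0\<close>|; strong monotonicity then gives (1 - w 1)(d / 2)^(p-1) <= w 1 |z -
  x_1|^(p-1).\<close>

lemma bary_cost_gradient_lower_bound:
  assumes p: "2 \<le> p" and N: "2 \<le> N" and w: "\<And>i. i \<in> {1..N} \<Longrightarrow> 0 < w i" and w1: "sum w {1..N} = 1"
    and z: "\<And>y. bary_cost p {1..N} w x z \<le> bary_cost p {1..N} w x y"
    and D: "0 < D" "D \<le> norm (z - euclidean_barycenter p {2..N} w x)"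
  shows "((1 - w 1) / w 1) powr (1 / (p - 1)) * (D / 2) \<le> norm (z - x 1)"
proof -
  define z\<^sub>0 d where "z\<^sub>0 = euclidean_barycenter p {2..N} w x" and "d = norm (z - z\<^sub>0)"
  define V where "V \<zeta> = (\<Sum>i=2..N. w i *\<^sub>R duality_map p (\<zeta> - x i))" for \<zeta>
  have d: "0 < d" unfolding d_def z\<^sub>0_def using D by linarith
  have sw: "sum w {2..N} = 1 - w 1" using sum_split_first[OF N, of w] w1 by simp
  have p1: "1 < p" using p by simp
  have w0: "0 < w 1" using w N by simp
  have w2: "0 < w i" if "i \<in> {2..N}" for i using w that by simp
  have "0 \<le> sum w {2..N}" using w2 by (intro sum_nonneg) (auto intro: less_imp_le)
  then have k0: "0 \<le> 1 - w 1" using sw by simp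
  have "V z\<^sub>0 = 0" unfolding V_def
  proof (rule bary_cost_stationary[OF p1])
    show "bary_cost p {2..N} w x z\<^sub>0 \<le> bary_cost p {2..N} w x y" for y
      unfolding z\<^sub>0_def using p1 w2 N by (intro euclidean_barycenter_minimal) auto
  qed (use p w2 in auto)
  moreover have "V z = - w 1 *\<^sub>R duality_map p (z - x 1)"
  proof -
    have "(\<Sum>i=1..N. w i *\<^sub>R duality_map p (z - x i)) = 0"
      by (rule bary_cost_stationary[OF p1 _ w z]) (use p in auto)
    then show ?thesis unfolding V_def sum_split_first[OF N] by (simp add: add_eq_0_iff add.commute)
  qed
  ultimately have V: "(V z - V z\<^sub>0) \<bullet> (z - z\<^sub>0) \<le> w 1 * norm (z - x 1) powr (p - 1) * d"
  proof -
    assume a: "V z\<^sub>0 = 0" "V z = - w 1 *\<^sub>R duality_map p (z - x 1)"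
    have "(V z - V z\<^sub>0) \<bullet> (z - z\<^sub>0) \<le> norm (V z - V z\<^sub>0) * norm (z - z\<^sub>0)" by (rule norm_cauchy_schwarz)
    also have "norm (V z - V z\<^sub>0) = w 1 * (norm (z - x 1) powr (p - 2) * norm (z - x 1))"
      using a w0 by (simp add: duality_map_def)
    also have "\<dots> = w 1 * norm (z - x 1) powr (p - 1)"
      by (simp add: powr_diff_one_mult)
    finally show ?thesis by (simp add: d_def)
  qed
  have "(1 - w 1) * ((d / 2) powr (p - 1) * d) = (\<Sum>i=2..N. w i * ((d / 2) powr (p - 1) * d))"
    unfolding sw[symmetric] by (simp add: sum_distrib_right)
  also have "\<dots> \<le> (\<Sum>i=2..N. w i * ((duality_map p (z - x i) - duality_map p (z\<^sub>0 - x i)) \<bullet> (z - z\<^sub>0)))"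
  proof (intro sum_mono mult_left_mono)
    fix i assume i: "i \<in> {2..N}"
    have "d \<le> norm (z - x i) + norm (z\<^sub>0 - x i)"
      using norm_triangle_ineq4[of "z - x i" "z\<^sub>0 - x i"] by (simp add: d_def)
    then have "(d / 2) powr (p - 2) \<le> max (norm (z - x i)) (norm (z\<^sub>0 - x i)) powr (p - 2)"
      using p d by (intro powr_mono2) auto
    then have "(1/2) * (d / 2) powr (p - 2) * d\<^sup>2
        \<le> (1/2) * max (norm (z - x i)) (norm (z\<^sub>0 - x i)) powr (p - 2) * d\<^sup>2"
      by (intro mult_right_mono mult_left_mono) auto
    also have "\<dots> \<le> (duality_map p (z - x i) - duality_map p (z\<^sub>0 - x i)) \<bullet> (z - z\<^sub>0)"
      using duality_map_strongly_monotone[OF p1, of "z - x i" "z\<^sub>0 - x i"] p by (simp add: d_def min_def)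
    also have "(1/2) * (d / 2) powr (p - 2) * d\<^sup>2 = ((d / 2) powr (p - 2) * (d / 2)) * d"
      by (simp add: power2_eq_square)
    also have "(d / 2) powr (p - 2) * (d / 2) = (d / 2) powr (p - 1)"
      using d by (intro powr_diff_one_mult) simp
    finally show "(d / 2) powr (p - 1) * d \<le> (duality_map p (z - x i) - duality_map p (z\<^sub>0 - x i)) \<bullet> (z - z\<^sub>0)" .
  qed (use w2 in \<open>auto intro: less_imp_le\<close>)
  also have "\<dots> = (V z - V z\<^sub>0) \<bullet> (z - z\<^sub>0)"
    by (simp add: V_def inner_sum_left sum_subtractf inner_diff_left right_diff_distrib)
  finally have "((1 - w 1) * (d / 2) powr (p - 1)) * d \<le> (w 1 * norm (z - x 1) powr (p - 1)) * d"
    using V by simp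
  then have "(1 - w 1) * (d / 2) powr (p - 1) \<le> w 1 * norm (z - x 1) powr (p - 1)"
    using d by simp
  then have "(1 - w 1) / w 1 * (d / 2) powr (p - 1) \<le> norm (z - x 1) powr (p - 1)"
    using w0 by (simp add: field_simps)
  then have "((1 - w 1) / w 1 * (d / 2) powr (p - 1)) powr (1 / (p - 1)) \<le> (norm (z - x 1) powr (p - 1)) powr (1 / (p - 1))"
    using p k0 w0 by (intro powr_mono2) auto
  moreover have "((1 - w 1) / w 1 * (d / 2) powr (p - 1)) powr (1 / (p - 1)) = ((1 - w 1) / w 1) powr (1 / (p - 1)) * (d / 2)"
    using p k0 w0 d by (subst powr_mult) (auto simp: powr_powr)
  moreover have "(norm (z - x 1) powr (p - 1)) powr (1 / (p - 1)) = norm (z - x 1)"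
    using p by (simp add: powr_powr)
  moreover have "((1 - w 1) / w 1) powr (1 / (p - 1)) * (D / 2) \<le> ((1 - w 1) / w 1) powr (1 / (p - 1)) * (d / 2)"
    using D by (intro mult_left_mono) (auto simp: d_def z\<^sub>0_def)
  ultimately show ?thesis by simp
qed


text \<open>Since S <= X, constants are at most X / S times themselves, so the whole Lipschitz
  constant can be written over the single denominator S.\<close>

lemma le_divide_of_bounds:
  fixes A G S T U X :: real
  assumes "0 \<le> A" "0 \<le> G" "0 < S" "S \<le> X" "T \<le> U / S"
  shows "1 + A * (1 + G * T) \<le> ((1 + A) * X + A * G * U) / S"
proof -
  have "A * G * T \<le> A * G * (U / S)" using assms by (intro mult_left_mono) auto
  moreover have "(1 + A) * 1 \<le> (1 + A) * (X / S)" using assms by (intro mult_left_mono) auto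
  ultimately show ?thesis by (simp add: add_divide_distrib algebra_simps)
qed

text \<open>With q = (1 - w 1) / w 1 and m >= q^(1/(p-1)) D / 2, the ratio q / m^(p-2) of the moduli
  is at most q^(1 - (p-2)/(p-1)) (2 / D)^(p-2); the exponent of q equals 1 / (p - 1), and q <= 1 / w
  1.\<close>

lemma swap_stable_lipschitz_ge_2:
  assumes p: "2 \<le> p" and M: "0 < M"
  shows "\<exists>C>0. \<forall>N w (x :: nat \<Rightarrow> 'a::euclidean_space) x' z z' D.
    stable_pair p N w (M / 2) x z x' z' \<and> 0 < D \<and> D \<le> norm (z - euclidean_barycenter p {2..N} w x)
    \<longrightarrow> norm (x 1 - x' 1) \<le> C / (w 1 powr (1 / (p - 1)) * D powr (p - 2)) * norm (z - z')"
proof -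
  \<comment> \<open>Barycenters have norm at most M and points at most M / 2, so the displacements k
    to be tested have norm at most 2 M + 3 M and all distances are at most 7 M. Likewise D <= 2 M,
    whence X.\<close>
  define c A G B X where "c = min (1/2) (p - 1)" and "A = 2 * (p + 1) / c + 1" and "G = 8 * (p + 1) / c"
    and "B = (7 * M) powr (p - 2)" and "X = (2 * M) powr (p - 2)"
  define U where "U = B * 2 powr (p - 2)"
  have c: "0 < c" using p by (simp add: c_def)
  have pos: "0 < A" "0 < G" "0 < B" "0 < X" "0 < U"
    using p c M by (auto simp: A_def G_def B_def X_def U_def add_pos_pos)
  show ?thesis
  proof (intro exI[of _ "(1 + A) * X + A * G * U"] conjI allI impI)
    show "0 < (1 + A) * X + A * G * U" using pos by (simp add: add_pos_pos)
  next
    fix N w and x x' :: "nat \<Rightarrow> 'a" and z z' D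
    assume "stable_pair p N w (M / 2) x z x' z' \<and> 0 < D \<and> D \<le> norm (z - euclidean_barycenter p {2..N} w x)"
    note asm = this[unfolded stable_pair_def]
    define S where "S = w 1 powr (1 / (p - 1)) * D powr (p - 2)"
    define m where "m = max (norm (z - x 1)) (norm (z' - x' 1))"
    define E where "E = (1 - w 1) / (w 1 * m powr (p - 2))"
    have N: "2 \<le> N" and D: "0 < D" and w: "\<And>i. i \<in> {1..N} \<Longrightarrow> 0 < w i"
      and x: "\<And>i. i \<in> {1..N} \<Longrightarrow> norm (x i) \<le> M / 2" "\<And>i. i \<in> {1..N} \<Longrightarrow> norm (x' i) \<le> M / 2"
      and Dz: "D \<le> norm (z - euclidean_barycenter p {2..N} w x)"
      and z: "\<And>y. bary_cost p {1..N} w x z \<le> bary_cost p {1..N} w x y"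
      and z': "\<And>y. bary_cost p {1..N} w x' z' \<le> bary_cost p {1..N} w x' y"
      using asm by auto
    have N1: "1 \<in> {1..N}" "2 \<in> {2..N}" "{1..N} \<noteq> {}" using N by auto
    have sw: "sum w {2..N} = 1 - w 1" using sum_split_first[OF N, of w] asm by simp
    have "0 < sum w {2..N}" using w N1 by (intro sum_pos) auto
    then have w1: "0 < w 1" "0 < 1 - w 1" using w[OF N1(1)] sw by auto
    have nz: "norm z \<le> M" "norm z' \<le> M"
      using norm_bary_cost_minimizer[of p "{1..N}" w x "M / 2" z]
        norm_bary_cost_minimizer[of p "{1..N}" w x' "M / 2" z'] p N1 w x z z' by auto
    have "norm (euclidean_barycenter p {2..N} w x) \<le> 2 * (M / 2)"
    proof (rule norm_bary_cost_minimizer)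
      show "bary_cost p {2..N} w x (euclidean_barycenter p {2..N} w x) \<le> bary_cost p {2..N} w x y" for y
        using p N1 w by (intro euclidean_barycenter_minimal) auto
    qed (use p N1 w x in auto)
    then have DM: "D \<le> 2 * M"
      using Dz nz norm_triangle_ineq4[of z "euclidean_barycenter p {2..N} w x"] by simp
    have "((1 - w 1) / w 1) powr (1 / (p - 1)) * (D / 2) \<le> norm (z - x 1)"
      using asm w z D Dz by (intro bary_cost_gradient_lower_bound[OF p N]) auto
    then have ml: "((1 - w 1) / w 1) powr (1 / (p - 1)) * (D / 2) \<le> m" by (simp add: m_def)
    have "0 < ((1 - w 1) / w 1) powr (1 / (p - 1)) * (D / 2)" using w1 D by simp
    then have m: "0 < m" using ml by linarith
    have "B * E \<le> U / S"
    proof -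
      define q where "q = (1 - w 1) / w 1"
      have q: "0 < q" using w1 by (simp add: q_def)
      have "(q powr (1 / (p - 1)) * (D / 2)) powr (p - 2) \<le> m powr (p - 2)"
        using ml p w1 D by (intro powr_mono2) (auto simp: q_def)
      then have "q / m powr (p - 2) \<le> q / (q powr (1 / (p - 1)) * (D / 2)) powr (p - 2)"
        using q D by (intro divide_left_mono mult_pos_pos) (auto simp: m)
      also have "(q powr (1 / (p - 1)) * (D / 2)) powr (p - 2) = q powr ((p - 2) / (p - 1)) * (D powr (p - 2) / 2 powr (p - 2))"
        using D by (simp add: powr_mult powr_divide powr_powr)
      also have "q / \<dots> = q powr (1 - (p - 2) / (p - 1)) * (2 powr (p - 2) / D powr (p - 2))"
        unfolding powr_diff[of q 1] using q by (simp add: ac_simps)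
      also have "1 - (p - 2) / (p - 1) = 1 / (p - 1)" using p by (simp add: field_simps)
      finally have "q / m powr (p - 2) \<le> q powr (1 / (p - 1)) * (2 powr (p - 2) / D powr (p - 2))" .
      moreover have "q powr (1 / (p - 1)) \<le> (1 / w 1) powr (1 / (p - 1))"
        using q w1 p by (intro powr_mono2) (auto simp: q_def divide_right_mono)
      then have "q powr (1 / (p - 1)) * (2 powr (p - 2) / D powr (p - 2))
          \<le> 1 / w 1 powr (1 / (p - 1)) * (2 powr (p - 2) / D powr (p - 2))"
        using w1 by (intro mult_right_mono) (auto simp: powr_divide)
      ultimately have "q / m powr (p - 2) \<le> 1 / w 1 powr (1 / (p - 1)) * (2 powr (p - 2) / D powr (p - 2))"
        by linarith
      then have "B * (q / m powr (p - 2)) \<le> B * (1 / w 1 powr (1 / (p - 1)) * (2 powr (p - 2) / D powr (p - 2)))"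
        using pos by (intro mult_left_mono) auto
      then show ?thesis by (simp add: E_def U_def S_def q_def)
    qed
    moreover have S: "0 < S" "S \<le> X"
    proof -
      show "0 < S" using w1 D by (simp add: S_def)
      have "S \<le> 1 * (2 * M) powr (p - 2)"
        unfolding S_def using w1 D DM p by (intro mult_mono powr_le1 powr_mono2) auto
      then show "S \<le> X" by (simp add: X_def)
    qed
    ultimately have bd: "1 + A * (1 + G * (B * E)) \<le> ((1 + A) * X + A * G * U) / S"
      using pos by (intro le_divide_of_bounds) auto
    have Bb: "max (norm (\<zeta> - \<xi>)) (norm (\<zeta> + k - \<xi>)) powr (p - 2) \<le> B"
      if "norm \<zeta> \<le> M" "norm \<xi> \<le> M / 2" "norm k \<le> norm (z' - z) + norm (z - x 1 - (z' - x' 1))" for \<zeta> \<xi> k :: 'a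
    proof -
      have "norm k \<le> 5 * M"
        using that(3) nz x[OF N1(1)] norm_triangle_ineq4[of z' z] norm_triangle_ineq4[of "z - x 1" "z' - x' 1"]
          norm_triangle_ineq4[of z "x 1"] norm_triangle_ineq4[of z' "x' 1"] by linarith
      then have "norm (\<zeta> - \<xi>) \<le> 7 * M" "norm (\<zeta> + k - \<xi>) \<le> 7 * M"
        using that M norm_triangle_ineq4[of \<zeta> \<xi>] norm_triangle_ineq4[of "\<zeta> + k" \<xi>] norm_triangle_ineq[of \<zeta> k]
        by linarith+
      then show ?thesis unfolding B_def using p by (intro powr_mono2) (auto simp: le_max_iff_disj)
    qed
    have "norm (x 1 - x' 1) \<le> (1 + A * (1 + G * (B * E))) * norm (z - z')"
      unfolding A_def G_def E_def m_def c_def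
    proof (rule swap_stable_lipschitz)
      show "1 < p" "0 \<le> B" using p pos by auto
    qed (use asm z z' N w p Bb nz x in auto)
    also have "\<dots> \<le> ((1 + A) * X + A * G * U) / S * norm (z - z')"
      using bd by (rule mult_right_mono) simp
    finally show "norm (x 1 - x' 1) \<le> ((1 + A) * X + A * G * U) / (w 1 powr (1 / (p - 1)) * D powr (p - 2)) * norm (z - z')"
      unfolding S_def .
  qed
qed

text \<open>The roles are reversed: the convexity of the first cost is bounded below because m <= 2
  M, and D^(p-2) bounds the curvature of the other costs, their points being at distance at least D
  from the barycenter.\<close>

lemma swap_stable_lipschitz_less_2:
  assumes p: "1 < p" "p < 2" and M: "0 < M"
  shows "\<exists>C>0. \<forall>N w (x :: nat \<Rightarrow> 'a::euclidean_space) x' z z' D.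
    stable_pair p N w (M / 2) x z x' z' \<and> 0 < D \<and> (\<forall>i\<in>{1..N}. D \<le> norm (x i - z) \<and> D \<le> norm (x' i - z'))
    \<longrightarrow> norm (x 1 - x' 1) \<le> C / (w 1 powr (1 / (p - 1)) * D powr (2 - p)) * norm (z - z')"
proof -
  define c A G X where "c = min (1/2) (p - 1)" and "A = 2 * (p + 1) / c + 1" and "G = 8 * (p + 1) / c"
    and "X = (2 * M) powr (2 - p)"
  have c: "0 < c" using p by (simp add: c_def)
  have pos: "0 < A" "0 < G" "0 < X"
    using p c M by (auto simp: A_def G_def X_def add_pos_pos)
  show ?thesis
  proof (intro exI[of _ "(1 + A) * X + A * G * X"] conjI allI impI)
    show "0 < (1 + A) * X + A * G * X" using pos by (simp add: add_pos_pos)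
  next
    fix N w and x x' :: "nat \<Rightarrow> 'a" and z z' D
    assume "stable_pair p N w (M / 2) x z x' z' \<and> 0 < D \<and> (\<forall>i\<in>{1..N}. D \<le> norm (x i - z) \<and> D \<le> norm (x' i - z'))"
    note asm = this[unfolded stable_pair_def]
    define S where "S = w 1 powr (1 / (p - 1)) * D powr (2 - p)"
    define m where "m = max (norm (z - x 1)) (norm (z' - x' 1))"
    define B where "B = D powr (p - 2)"
    define E where "E = (1 - w 1) / (w 1 * m powr (p - 2))"
    have N: "2 \<le> N" and D: "0 < D" and w: "\<And>i. i \<in> {1..N} \<Longrightarrow> 0 < w i"
      and x: "\<And>i. i \<in> {1..N} \<Longrightarrow> norm (x i) \<le> M / 2" "\<And>i. i \<in> {1..N} \<Longrightarrow> norm (x' i) \<le> M / 2"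
      and Dz: "\<And>i. i \<in> {1..N} \<Longrightarrow> D \<le> norm (z - x i)" "\<And>i. i \<in> {1..N} \<Longrightarrow> D \<le> norm (z' - x' i)"
      and z: "\<And>y. bary_cost p {1..N} w x z \<le> bary_cost p {1..N} w x y"
      and z': "\<And>y. bary_cost p {1..N} w x' z' \<le> bary_cost p {1..N} w x' y"
      using asm by (auto simp: norm_minus_commute)
    have N1: "1 \<in> {1..N}" "2 \<in> {2..N}" "{1..N} \<noteq> {}" using N by auto
    have sw: "sum w {2..N} = 1 - w 1" using sum_split_first[OF N, of w] asm by simp
    have "0 < sum w {2..N}" using w N1 by (intro sum_pos) auto
    then have w1: "0 < w 1" "0 < 1 - w 1" using w[OF N1(1)] sw by auto
    have nz: "norm z \<le> M" "norm z' \<le> M"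
      using norm_bary_cost_minimizer[of p "{1..N}" w x "M / 2" z]
        norm_bary_cost_minimizer[of p "{1..N}" w x' "M / 2" z'] p N1 w x z z' by auto
    have zx: "norm (z - x 1) \<le> 2 * M" "norm (z' - x' 1) \<le> 2 * M"
      using nz x[OF N1(1)] norm_triangle_ineq4[of z "x 1"] norm_triangle_ineq4[of z' "x' 1"] M by linarith+
    have m: "0 < m" "m \<le> 2 * M" "D \<le> m"
      using Dz[OF N1(1)] D zx by (auto simp: m_def less_max_iff_disj le_max_iff_disj)
    \<comment> \<open>The argument yields the first power of \<open>w 1\<close>; as 1 / (p - 1) > 1
      and \<open>w 1\<close> < 1, it is weakened to the exponent shared with the case p >=
      2.\<close>
    have ws: "w 1 powr (1 / (p - 1)) \<le> w 1"
      using powr_mono'[of 1 "1 / (p - 1)" "w 1"] w1 p by (simp add: field_simps)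
    have "B * E \<le> X / S"
    proof -
      have "B * E = (1 - w 1) * m powr (2 - p) / (w 1 * D powr (2 - p))"
        unfolding B_def E_def using powr_minus[of D "2 - p"] powr_minus[of m "2 - p"]
        by (simp add: divide_inverse ac_simps)
      also have "\<dots> \<le> 1 * (2 * M) powr (2 - p) / (w 1 * D powr (2 - p))"
        using w1 m p by (intro divide_right_mono mult_mono powr_mono2) auto
      also have "\<dots> \<le> 1 * (2 * M) powr (2 - p) / S"
        unfolding S_def using w1 D ws by (intro divide_left_mono mult_right_mono mult_pos_pos) auto
      finally show ?thesis by (simp add: X_def)
    qed
    moreover have S: "0 < S" "S \<le> X"
    proof -
      show "0 < S" using w1 D by (simp add: S_def)
      have "S \<le> 1 * (2 * M) powr (2 - p)"
        unfolding S_def using w1 D m p by (intro mult_mono powr_le1 powr_mono2) auto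
      then show "S \<le> X" by (simp add: X_def)
    qed
    ultimately have bd: "1 + A * (1 + G * (B * E)) \<le> ((1 + A) * X + A * G * X) / S"
      using pos by (intro le_divide_of_bounds) auto
    have Bb: "max (norm (\<zeta> - \<xi>)) (norm (\<zeta> + k - \<xi>)) powr (p - 2) \<le> B"
      if "D \<le> norm (\<zeta> - \<xi>)" for \<zeta> \<xi> k :: 'a
      unfolding B_def using p D that by (intro powr_mono2') auto
    have "norm (x 1 - x' 1) \<le> (1 + A * (1 + G * (B * E))) * norm (z - z')"
      unfolding A_def G_def E_def m_def c_def
    proof (rule swap_stable_lipschitz)
      show "0 \<le> B" by (simp add: B_def)
      show "2 \<le> p \<or> x i \<noteq> z \<and> x' i \<noteq> z'" if "i \<in> {1..N}" for i
        using Dz[OF that] D by auto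
    qed (use asm z z' N w p Bb Dz in auto)
    also have "\<dots> \<le> ((1 + A) * X + A * G * X) / S * norm (z - z')"
      using bd by (rule mult_right_mono) simp
    finally show "norm (x 1 - x' 1) \<le> ((1 + A) * X + A * G * X) / (w 1 powr (1 / (p - 1)) * D powr (2 - p)) * norm (z - z')"
      unfolding S_def .
  qed
qed

subsection \<open>Wasserstein costs and couplings\<close>

lemma measurable_fst_borel [measurable]:
  "fst \<in> (borel :: ('a::second_countable_topology \<times> 'b::second_countable_topology) measure) \<rightarrow>\<^sub>M borel"
  by (rule borel_measurable_continuous_onI) (intro continuous_intros)

lemma measurable_snd_borel [measurable]:
  "snd \<in> (borel :: ('a::second_countable_topology \<times> 'b::second_countable_topology) measure) \<rightarrow>\<^sub>M borel"
  by (rule borel_measurable_continuous_onI) (intro continuous_intros)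

lemma borel_measurable_bary_cost [measurable (raw)]:
  fixes X :: "'b \<Rightarrow> nat \<Rightarrow> 'a::euclidean_space"
  assumes [measurable]: "\<And>i. i \<in> I \<Longrightarrow> (\<lambda>\<omega>. X \<omega> i) \<in> borel_measurable M" "Y \<in> borel_measurable M"
  shows "(\<lambda>\<omega>. bary_cost p I w (X \<omega>) (Y \<omega>)) \<in> borel_measurable M"
  unfolding bary_cost_def by measurable

lemma powr_add_le:
  fixes a b p :: real
  assumes "0 < p" "0 \<le> a" "0 \<le> b"
  shows "(a + b) powr p \<le> 2 powr p * (a powr p + b powr p)"
proof -
  have "(a + b) powr p \<le> (2 * max a b) powr p"
    using assms by (intro powr_mono2) auto
  also have "\<dots> = 2 powr p * max a b powr p" using assms by (simp add: powr_mult)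
  also have "\<dots> \<le> 2 powr p * (a powr p + b powr p)"
    by (intro mult_left_mono) (auto simp: max_def)
  finally show ?thesis .
qed

text \<open>By the Lindelof property the complement of the support is a countable union of open null
  sets.\<close>

lemma AE_spt:
  assumes "borel_prob \<mu>"
  shows "AE x in \<mu>. x \<in> spt \<mu>"
proof -
  have S: "sets \<mu> = sets borel" using assms by (simp add: borel_prob_def)
  define F where "F = {U. open U \<and> emeasure \<mu> U = 0}"
  obtain F' where F': "F' \<subseteq> F" "countable F'" "\<Union>F' = \<Union>F"
    using Lindelof[of F] by (auto simp: F_def)
  have "U \<in> null_sets \<mu>" if "U \<in> F" for U
    using that S by (auto simp: F_def null_sets_def)
  then have "\<Union>F' \<in> null_sets \<mu>"
    using F' null_sets_UN'[of F' "\<lambda>U. U" \<mu>] by auto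
  moreover have "{x \<in> space \<mu>. x \<notin> spt \<mu>} \<subseteq> \<Union>F'"
    unfolding F' spt_def F_def by (auto simp: not_less)
  ultimately show ?thesis by (rule AE_I')
qed

lemma closed_spt: "closed (spt \<mu>)"
proof -
  have "open (- spt \<mu>)"
    unfolding open_contains_ball
  proof
    fix x assume "x \<in> - spt \<mu>"
    then obtain U where "open U" "x \<in> U" "emeasure \<mu> U = 0" by (auto simp: spt_def not_less)
    then have "U \<subseteq> - spt \<mu>" by (auto simp: spt_def not_less)
    then show "\<exists>e>0. ball x e \<subseteq> - spt \<mu>"
      using \<open>open U\<close> \<open>x \<in> U\<close> by (meson dual_order.trans openE)
  qed
  then show ?thesis by (simp add: closed_def)
qed

lemma distr_Pair_in_couplings:
  assumes "prob_space M" and [measurable]: "X \<in> borel_measurable M" "Y \<in> borel_measurable M"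
  shows "distr M borel (\<lambda>\<omega>. (X \<omega>, Y \<omega>)) \<in> couplings (distr M borel X) (distr M borel Y)"
  unfolding couplings_def borel_prob_def
  using prob_space.prob_space_distr[OF assms(1), of "\<lambda>\<omega>. (X \<omega>, Y \<omega>)" borel]
  by (auto simp: distr_distr comp_def)

lemma wasserstein_powr_le:
  assumes "prob_space M" and [measurable]: "X \<in> borel_measurable M" "Y \<in> borel_measurable M"
    and "0 < p"
  shows "wasserstein p (distr M borel X) (distr M borel Y) powr p \<le> (\<integral>\<omega>. norm (X \<omega> - Y \<omega>) powr p \<partial>M)"
proof -
  have le: "wasserstein p (distr M borel X) (distr M borel Y)
      \<le> (\<integral>z. norm (fst z - snd z) powr p \<partial>(distr M borel (\<lambda>\<omega>. (X \<omega>, Y \<omega>)))) powr (1 / p)"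
    unfolding wasserstein_def
    by (intro cINF_lower distr_Pair_in_couplings assms) (auto intro!: bdd_belowI[of _ 0])
  have "0 \<le> wasserstein p (distr M borel X) (distr M borel Y)"
    unfolding wasserstein_def using distr_Pair_in_couplings[OF assms(1-3)]
    by (intro cINF_greatest) auto
  then have "wasserstein p (distr M borel X) (distr M borel Y) powr p
      \<le> ((\<integral>z. norm (fst z - snd z) powr p \<partial>(distr M borel (\<lambda>\<omega>. (X \<omega>, Y \<omega>)))) powr (1 / p)) powr p"
    using le assms by (intro powr_mono2) auto
  also have "\<dots> = (\<integral>z. norm (fst z - snd z) powr p \<partial>(distr M borel (\<lambda>\<omega>. (X \<omega>, Y \<omega>))))"
    using assms by (simp add: powr_powr)
  also have "\<dots> = (\<integral>\<omega>. norm (X \<omega> - Y \<omega>) powr p \<partial>M)"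
    by (subst integral_distr) auto
  finally show ?thesis .
qed

text \<open>Minimality in the form used throughout: any random points with the prescribed marginals,
  together with any random Y, cost at least the minimal value. If the right side is finite,
  boundedness of the first point forces the law of Y into \<open>Prob_p p\<close>, and the joint
  laws of the i-th point and Y are couplings.\<close>

lemma barycenter_competitor:
  fixes \<mu> :: "nat \<Rightarrow> 'a::euclidean_space measure"
  assumes bary: "is_wasserstein_barycenter p N w \<mu> \<nu>" and p: "0 < p" and N: "1 \<le> N"
    and w: "\<And>i. i \<in> {1..N} \<Longrightarrow> 0 < w i"
    and M: "prob_space M"
    and X[measurable]: "\<And>i. i \<in> {1..N} \<Longrightarrow> (\<lambda>\<omega>. X \<omega> i) \<in> borel_measurable M"
    and law: "\<And>i. i \<in> {1..N} \<Longrightarrow> distr M borel (\<lambda>\<omega>. X \<omega> i) = \<mu> i"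
    and bd: "AE x in \<mu> 1. norm x \<le> r"
    and Y[measurable]: "Y \<in> borel_measurable M"
  shows "ennreal (\<Sum>i=1..N. w i * wasserstein p (\<mu> i) \<nu> powr p)
    \<le> (\<integral>\<^sup>+\<omega>. ennreal (bary_cost p {1..N} w (X \<omega>) (Y \<omega>)) \<partial>M)"
proof (cases "(\<integral>\<^sup>+\<omega>. ennreal (bary_cost p {1..N} w (X \<omega>) (Y \<omega>)) \<partial>M) = \<infinity>")
  case True
  then show ?thesis by simp
next
  case False
  interpret prob_space M by (rule M)
  have N1: "1 \<in> {1..N}" using N by simp
  have int: "integrable M (\<lambda>\<omega>. norm (X \<omega> i - Y \<omega>) powr p)" if i: "i \<in> {1..N}" for i
  proof (rule integrableI_nonneg)
    have "ennreal (w i) * (\<integral>\<^sup>+\<omega>. ennreal (norm (X \<omega> i - Y \<omega>) powr p) \<partial>M)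
        = (\<integral>\<^sup>+\<omega>. ennreal (w i * norm (X \<omega> i - Y \<omega>) powr p) \<partial>M)"
      using X[OF i] w[OF i] by (subst nn_integral_cmult[symmetric]) (auto simp: ennreal_mult)
    also have "\<dots> \<le> (\<integral>\<^sup>+\<omega>. ennreal (bary_cost p {1..N} w (X \<omega>) (Y \<omega>)) \<partial>M)"
      unfolding bary_cost_def using w i
      by (intro nn_integral_mono ennreal_leI member_le_sum mult_nonneg_nonneg) (auto intro: less_imp_le)
    also have "\<dots> < \<infinity>" using False by (simp add: less_top)
    finally have "ennreal (w i) * (\<integral>\<^sup>+\<omega>. ennreal (norm (X \<omega> i - Y \<omega>) powr p) \<partial>M) < \<infinity>" .
    then show "(\<integral>\<^sup>+\<omega>. ennreal (norm (X \<omega> i - Y \<omega>) powr p) \<partial>M) < \<infinity>"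
      using w[OF i] by (auto simp: ennreal_mult_less_top)
  qed (use X i in auto)
  define \<rho> where "\<rho> = distr M borel Y"
  have "\<rho> \<in> Prob_p p"
    unfolding Prob_p_def borel_prob_def
  proof (intro CollectI conjI)
    show "prob_space \<rho>" unfolding \<rho>_def by (rule prob_space_distr) simp
    show "sets \<rho> = sets borel" by (simp add: \<rho>_def)
    have "AE \<omega> in M. norm (X \<omega> 1) \<le> r"
      using AE_distrD[OF X[OF N1]] bd unfolding law[OF N1, symmetric] by blast
    then have *: "AE \<omega> in M. norm (norm (Y \<omega>) powr p)
        \<le> norm (2 powr p * (\<bar>r\<bar> powr p + norm (X \<omega> 1 - Y \<omega>) powr p))"
    proof eventually_elim
      case (elim \<omega>)
      have "norm (Y \<omega>) powr p \<le> (\<bar>r\<bar> + norm (X \<omega> 1 - Y \<omega>)) powr p"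
        using p elim norm_triangle_ineq2[of "Y \<omega>" "X \<omega> 1"] by (intro powr_mono2) (auto simp: norm_minus_commute)
      also have "\<dots> \<le> 2 powr p * (\<bar>r\<bar> powr p + norm (X \<omega> 1 - Y \<omega>) powr p)"
        using p by (intro powr_add_le) auto
      finally show ?case by (simp add: abs_mult)
    qed
    have "integrable M (\<lambda>\<omega>. norm (Y \<omega>) powr p)"
    proof (rule Bochner_Integration.integrable_bound[OF _ _ *])
      show "integrable M (\<lambda>\<omega>. 2 powr p * (\<bar>r\<bar> powr p + norm (X \<omega> 1 - Y \<omega>) powr p))"
        by (intro integrable_mult_right Bochner_Integration.integrable_add int[OF N1]) simp
    qed simp
    then show "integrable \<rho> (\<lambda>x. norm x powr p)" unfolding \<rho>_def by (simp add: integrable_distr_eq)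
  qed
  then have "(\<Sum>i=1..N. w i * wasserstein p (\<mu> i) \<nu> powr p) \<le> (\<Sum>i=1..N. w i * wasserstein p (\<mu> i) \<rho> powr p)"
    using bary unfolding is_wasserstein_barycenter_def is_arg_min_linorder by blast
  also have "\<dots> \<le> (\<Sum>i=1..N. w i * (\<integral>\<omega>. norm (X \<omega> i - Y \<omega>) powr p \<partial>M))"
  proof (intro sum_mono mult_left_mono)
    fix i assume i: "i \<in> {1..N}"
    show "wasserstein p (\<mu> i) \<rho> powr p \<le> (\<integral>\<omega>. norm (X \<omega> i - Y \<omega>) powr p \<partial>M)"
      unfolding law[OF i, symmetric] \<rho>_def by (rule wasserstein_powr_le[OF M X[OF i] Y p])
  qed (use w in \<open>auto intro: less_imp_le\<close>)
  also have "\<dots> = (\<integral>\<omega>. bary_cost p {1..N} w (X \<omega>) (Y \<omega>) \<partial>M)"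
  proof -
    have "(\<integral>\<omega>. bary_cost p {1..N} w (X \<omega>) (Y \<omega>) \<partial>M) = (\<Sum>i=1..N. \<integral>\<omega>. w i * norm (X \<omega> i - Y \<omega>) powr p \<partial>M)"
      unfolding bary_cost_def by (intro Bochner_Integration.integral_sum integrable_mult_right int)
    then show ?thesis by simp
  qed
  finally have "ennreal (\<Sum>i=1..N. w i * wasserstein p (\<mu> i) \<nu> powr p) \<le> ennreal (\<integral>\<omega>. bary_cost p {1..N} w (X \<omega>) (Y \<omega>) \<partial>M)"
    by (rule ennreal_leI)
  also have "\<dots> = (\<integral>\<^sup>+\<omega>. ennreal (bary_cost p {1..N} w (X \<omega>) (Y \<omega>)) \<partial>M)"
  proof (rule nn_integral_eq_integral[symmetric])
    show "integrable M (\<lambda>\<omega>. bary_cost p {1..N} w (X \<omega>) (Y \<omega>))"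
      unfolding bary_cost_def by (intro Bochner_Integration.integrable_sum integrable_mult_right int)
    show "AE \<omega> in M. 0 \<le> bary_cost p {1..N} w (X \<omega>) (Y \<omega>)"
      using w by (intro AE_I2 bary_cost_nonneg) (auto intro: less_imp_le)
  qed
  finally show ?thesis .
qed

lemma couplings_nonempty:
  assumes "borel_prob \<mu>" "borel_prob \<nu>"
  shows "couplings \<mu> \<nu> \<noteq> {}"
proof -
  interpret M: prob_space \<mu> using assms by (simp add: borel_prob_def)
  interpret N: prob_space \<nu> using assms by (simp add: borel_prob_def)
  interpret P: pair_prob_space \<mu> \<nu> ..
  have S: "sets \<mu> = sets borel" "sets \<nu> = sets borel" using assms by (auto simp: borel_prob_def)
  have [measurable]: "fst \<in> (\<mu> \<Otimes>\<^sub>M \<nu>) \<rightarrow>\<^sub>M borel" "snd \<in> (\<mu> \<Otimes>\<^sub>M \<nu>) \<rightarrow>\<^sub>M borel"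
    using measurable_fst[of \<mu> \<nu>] measurable_snd[of \<mu> \<nu>] S by (simp_all cong: measurable_cong_sets)
  have "distr (\<mu> \<Otimes>\<^sub>M \<nu>) borel fst = distr (\<mu> \<Otimes>\<^sub>M \<nu>) \<mu> fst" "distr (\<mu> \<Otimes>\<^sub>M \<nu>) borel snd = distr (\<mu> \<Otimes>\<^sub>M \<nu>) \<nu> snd"
    using S by (auto intro: distr_cong)
  moreover have snd: "distr (\<mu> \<Otimes>\<^sub>M \<nu>) \<nu> snd = \<nu>"
  proof (rule measure_eqI)
    fix A assume A: "A \<in> sets (distr (\<mu> \<Otimes>\<^sub>M \<nu>) \<nu> snd)"
    then have "emeasure (distr (\<mu> \<Otimes>\<^sub>M \<nu>) \<nu> snd) A = emeasure (\<mu> \<Otimes>\<^sub>M \<nu>) (space \<mu> \<times> A)"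
      using sets.sets_into_space[of A \<nu>]
      by (auto simp: emeasure_distr space_pair_measure intro!: arg_cong2[where f = emeasure])
    then show "emeasure (distr (\<mu> \<Otimes>\<^sub>M \<nu>) \<nu> snd) A = emeasure \<nu> A"
      using A by (simp add: N.emeasure_pair_measure_Times M.emeasure_space_1)
  qed simp
  ultimately have "distr (\<mu> \<Otimes>\<^sub>M \<nu>) borel fst = \<mu>" "distr (\<mu> \<Otimes>\<^sub>M \<nu>) borel snd = \<nu>"
    using N.distr_pair_fst[of \<mu>] snd by auto
  moreover have "distr (\<mu> \<Otimes>\<^sub>M \<nu>) borel (\<lambda>\<omega>. (fst \<omega>, snd \<omega>))
      \<in> couplings (distr (\<mu> \<Otimes>\<^sub>M \<nu>) borel fst) (distr (\<mu> \<Otimes>\<^sub>M \<nu>) borel snd)"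
    by (rule distr_Pair_in_couplings) (auto intro: P.prob_space_axioms)
  ultimately show ?thesis by auto
qed

text \<open>Beyond the definition of the infimum, the content is integrability of the cost: a
  Bochner integral of a non-integrable cost would be 0 and would not bound the nonnegative integral.
  It follows from the bounded support on one side and the p-th moment on the other.\<close>

lemma near_optimal_coupling:
  assumes "borel_prob \<mu>" "AE x in \<mu>. norm x \<le> r" "\<nu> \<in> Prob_p p" "0 < p" "0 < e"
  obtains \<eta> where "\<eta> \<in> couplings \<mu> \<nu>"
    "(\<integral>\<^sup>+z. ennreal (norm (fst z - snd z) powr p) \<partial>\<eta>) \<le> ennreal (wasserstein p \<mu> \<nu> powr p + e)"
proof -
  have ne: "couplings \<mu> \<nu> \<noteq> {}"
    using assms couplings_nonempty by (auto simp: Prob_p_def)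
  define W where "W = wasserstein p \<mu> \<nu>"
  define J where "J \<eta> = (\<integral>z. norm (fst z - snd z) powr p \<partial>\<eta>)" for \<eta> :: "('a \<times> 'a) measure"
  have "0 \<le> W" unfolding W_def wasserstein_def using ne by (intro cINF_greatest) auto
  have "\<exists>\<eta>\<in>couplings \<mu> \<nu>. J \<eta> \<le> W powr p + e"
  proof (rule ccontr)
    assume "\<not> ?thesis"
    then have *: "(W powr p + e) powr (1 / p) \<le> J \<eta> powr (1 / p)" if "\<eta> \<in> couplings \<mu> \<nu>" for \<eta>
      using that assms by (intro powr_mono2) (auto simp: not_le intro: less_imp_le)
    have "W = (INF \<eta>\<in>couplings \<mu> \<nu>. J \<eta> powr (1 / p))" by (simp add: W_def wasserstein_def J_def)
    then have "(W powr p + e) powr (1 / p) \<le> W"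
      using cINF_greatest[OF ne *] by simp
    then have "((W powr p + e) powr (1 / p)) powr p \<le> W powr p"
      using assms by (intro powr_mono2) auto
    then show False using assms by (simp add: powr_powr add_nonneg_pos)
  qed
  then obtain \<eta> where \<eta>: "\<eta> \<in> couplings \<mu> \<nu>" "J \<eta> \<le> W powr p + e" by blast
  have sets: "sets \<eta> = sets borel" and d: "distr \<eta> borel fst = \<mu>" "distr \<eta> borel snd = \<nu>"
    using \<eta> by (auto simp: couplings_def borel_prob_def)
  interpret prob_space \<eta> using \<eta> by (auto simp: couplings_def borel_prob_def)
  have [measurable]: "fst \<in> \<eta> \<rightarrow>\<^sub>M borel" "snd \<in> \<eta> \<rightarrow>\<^sub>M borel"
    unfolding measurable_cong_sets[OF sets refl] by (rule measurable_fst_borel measurable_snd_borel)+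
  have "integrable (distr \<eta> borel snd) (\<lambda>x. norm x powr p)"
    using assms unfolding d by (simp add: Prob_p_def)
  then have i2: "integrable \<eta> (\<lambda>z. norm (snd z) powr p)" by (simp add: integrable_distr_eq)
  have "AE x in distr \<eta> borel fst. norm x \<le> r" unfolding d by (rule assms)
  then have "AE z in \<eta>. norm (fst z) \<le> r" by (rule AE_distrD[rotated]) measurable
  then have *: "AE z in \<eta>. norm (norm (fst z - snd z) powr p) \<le> norm (2 powr p * (\<bar>r\<bar> powr p + norm (snd z) powr p))"
  proof eventually_elim
    case (elim z)
    have "norm (fst z - snd z) powr p \<le> (\<bar>r\<bar> + norm (snd z)) powr p"
      using assms elim norm_triangle_ineq4[of "fst z" "snd z"] by (intro powr_mono2) auto
    also have "\<dots> \<le> 2 powr p * (\<bar>r\<bar> powr p + norm (snd z) powr p)"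
      using assms by (intro powr_add_le) auto
    finally show ?case by (simp add: abs_mult)
  qed
  have "integrable \<eta> (\<lambda>z. norm (fst z - snd z) powr p)"
  proof (rule Bochner_Integration.integrable_bound[OF _ _ *])
    show "integrable \<eta> (\<lambda>z. 2 powr p * (\<bar>r\<bar> powr p + norm (snd z) powr p))"
      by (intro integrable_mult_right Bochner_Integration.integrable_add i2) simp
  qed simp
  then have "(\<integral>\<^sup>+z. ennreal (norm (fst z - snd z) powr p) \<partial>\<eta>) = ennreal (J \<eta>)"
    unfolding J_def by (intro nn_integral_eq_integral) auto
  then show ?thesis using that[OF \<eta>(1)] \<eta>(2) by (simp add: W_def ennreal_leI)
qed

section \<open>Approximate gluing of couplings\<close>

lemma countable_small_partition:
  assumes "0 < s"
  obtains Q :: "nat \<Rightarrow> 'a::euclidean_space set"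
  where "\<And>n. Q n \<in> sets borel" "disjoint_family Q" "(\<Union>n. Q n) = UNIV"
    "\<And>n x y. x \<in> Q n \<Longrightarrow> y \<in> Q n \<Longrightarrow> dist x y < s"
proof -
  obtain D :: "'a set" where D: "countable D" "\<And>X. open X \<Longrightarrow> X \<noteq> {} \<Longrightarrow> \<exists>d\<in>D. d \<in> X"
    using countable_dense_exists by blast
  have ne: "D \<noteq> {}" using D(2)[of UNIV] by auto
  define Q where "Q = disjointed (\<lambda>n. ball (from_nat_into D n) (s / 2))"
  show ?thesis
  proof (rule that)
    show "Q n \<in> sets borel" for n
      using sets.range_disjointed_sets[of "\<lambda>n. ball (from_nat_into D n) (s / 2)" borel]
      unfolding Q_def by (simp add: image_subset_iff)
    show "disjoint_family Q" by (simp add: Q_def disjoint_family_disjointed)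
    show "(\<Union>n. Q n) = UNIV"
    proof -
      have "x \<in> (\<Union>n. ball (from_nat_into D n) (s / 2))" for x
      proof -
        obtain d where "d \<in> D" "d \<in> ball x (s / 2)" using D(2)[of "ball x (s / 2)"] assms by auto
        then show ?thesis using from_nat_into_to_nat_on[OF D(1)] by (auto simp: dist_commute) (metis dist_commute)
      qed
      then show ?thesis unfolding Q_def UN_disjointed_eq by auto
    qed
    show "dist x y < s" if "x \<in> Q n" "y \<in> Q n" for n x y
    proof -
      have "Q n \<subseteq> ball (from_nat_into D n) (s / 2)" unfolding Q_def by (rule disjointed_subset)
      then have "dist (from_nat_into D n) x < s / 2" "dist (from_nat_into D n) y < s / 2" using that by auto
      then show ?thesis using dist_triangle3[of x y "from_nat_into D n"] by linarith
    qed
  qed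
qed

text \<open>Couplings with a common second marginal are glued without disintegration: on each cell of a
  fine partition the coordinates are drawn independently, so that the second components agree only up
  to the mesh size.\<close>

lemma approximate_gluing:
  fixes \<eta> :: "nat \<Rightarrow> ('a::euclidean_space \<times> 'a) measure"
  assumes I: "finite I" "I \<noteq> {}" and \<eta>: "\<And>i. i \<in> I \<Longrightarrow> \<eta> i \<in> couplings (\<mu> i) \<nu>" and s: "0 < s"
  obtains \<gamma> where "prob_space \<gamma>" "sets \<gamma> = sets (PiM I (\<lambda>_. borel))"
    "\<And>i. i \<in> I \<Longrightarrow> distr \<gamma> borel (\<lambda>\<omega>. \<omega> i) = \<eta> i"
    "AE \<omega> in \<gamma>. \<forall>i\<in>I. \<forall>j\<in>I. dist (snd (\<omega> i)) (snd (\<omega> j)) < s"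
proof -
  obtain Q :: "nat \<Rightarrow> 'a set" where Q: "\<And>n. Q n \<in> sets borel" "disjoint_family Q" "(\<Union>n. Q n) = UNIV"
    "\<And>n x y. x \<in> Q n \<Longrightarrow> y \<in> Q n \<Longrightarrow> dist x y < s"
    using countable_small_partition[OF s] by metis
  \<comment> \<open>A Dirac mass fills the indices outside I, because the product locale asks for a
    probability measure at every index.\<close>
  define \<eta>' where "\<eta>' i = (if i \<in> I then \<eta> i else return borel undefined)" for i
  have prob: "prob_space (\<eta>' i)" for i
    using \<eta>[of i] by (auto simp: \<eta>'_def couplings_def borel_prob_def intro: prob_space_return)
  have S: "sets (\<eta>' i) = sets borel" for i
    using \<eta>[of i] by (auto simp: \<eta>'_def couplings_def borel_prob_def)
  then have Sp: "space (\<eta>' i) = UNIV" for i using sets_eq_imp_space_eq[of "\<eta>' i" borel] by simp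
  interpret product_prob_space \<eta>' I
    using prob by (simp add: product_prob_space_def product_prob_space_axioms_def product_sigma_finite_def prob_space_imp_sigma_finite)
  have sP: "sets (PiM I \<eta>') = sets (PiM I (\<lambda>_. borel))" by (intro sets_PiM_cong) (auto simp: S)
  have [measurable]: "(\<lambda>\<omega>. \<omega> i) \<in> PiM I \<eta>' \<rightarrow>\<^sub>M borel" if "i \<in> I" for i
    using measurable_component_singleton[OF that, of \<eta>'] measurable_cong_sets[OF refl S] by blast
  have nuQ: "emeasure (\<eta>' i) (UNIV \<times> Q n) = emeasure \<nu> (Q n)" if "i \<in> I" for i n
  proof -
    have "distr (\<eta> i) borel snd = \<nu>" "sets (\<eta> i) = sets borel"
      using \<eta>[OF that] by (auto simp: couplings_def borel_prob_def)
    then have "emeasure \<nu> (Q n) = emeasure (\<eta> i) (snd -` Q n \<inter> space (\<eta> i))"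
      using Q(1) measurable_snd_borel by (metis emeasure_distr measurable_cong_sets)
    also have "snd -` Q n \<inter> space (\<eta> i) = UNIV \<times> Q n"
      using sets_eq_imp_space_eq[OF \<open>sets (\<eta> i) = sets borel\<close>] by auto
    finally show ?thesis using that by (simp add: \<eta>'_def)
  qed
  obtain i\<^sub>0 where i0: "i\<^sub>0 \<in> I" using I by auto
  have nu_fin: "emeasure \<nu> (Q n) < \<infinity>" for n
    using nuQ[OF i0, of n] prob_space.emeasure_le_1[OF prob[of i\<^sub>0], of "UNIV \<times> Q n"]
    by (metis ennreal_one_less_top infinity_ennreal_def le_less_trans)
  define N where "N = card I - 1"
  define v where "v n = enn2real (emeasure \<nu> (Q n))" for n
  have v: "emeasure \<nu> (Q n) = ennreal (v n)" "0 \<le> v n" for n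
    using nu_fin[of n] by (auto simp: v_def)
  define B where "B n = {\<omega> \<in> space (PiM I \<eta>'). \<forall>i\<in>I. snd (\<omega> i) \<in> Q n}" for n
  have [measurable]: "B n \<in> sets (PiM I \<eta>')" for n
    unfolding B_def using I Q(1) by measurable
  \<comment> \<open>On the event that all second components lie in Q n, each marginal picks up the
    factor \<open>v n ^ N\<close> from the other \<open>card I - 1\<close> coordinates; the density
    divides it out, so the marginals are exactly the given couplings. Cells with
    \<open>v n = 0\<close> carry no mass, whatever value the quotient has there.\<close>
  define h where "h \<omega> = (\<Sum>n. ennreal (1 / v n ^ N) * indicator (B n) \<omega>)" for \<omega>
  have [measurable]: "h \<in> borel_measurable (PiM I \<eta>')" unfolding h_def by measurable
  define \<gamma> where "\<gamma> = density (PiM I \<eta>') h"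
  have law: "emeasure \<gamma> {\<omega> \<in> space (PiM I \<eta>'). \<omega> j \<in> A} = emeasure (\<eta>' j) A"
    if j: "j \<in> I" and A: "A \<in> sets borel" for j A
  proof -
    have Aj[measurable]: "{\<omega> \<in> space (PiM I \<eta>'). \<omega> j \<in> A} \<in> sets (PiM I \<eta>')"
      using j A by measurable
    define C where "C n i = (UNIV \<times> Q n) \<inter> (if i = j then A else UNIV)" for n i
    have C: "C n i \<in> sets (\<eta>' i)" for n i
      unfolding S C_def using Q(1) A by (auto simp: borel_prod[symmetric])
    have "B n \<inter> {\<omega> \<in> space (PiM I \<eta>'). \<omega> j \<in> A} = PiE I (C n)" for n
    proof -
      have CI: "x \<in> C n i \<longleftrightarrow> snd x \<in> Q n \<and> (i = j \<longrightarrow> x \<in> A)" for x i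
        by (auto simp: C_def mem_Times_iff)
      show ?thesis unfolding B_def space_PiM Sp PiE_iff set_eq_iff Int_iff mem_Collect_eq CI
        using j by (auto simp: extensional_def)
    qed
    moreover have "emeasure (PiM I \<eta>') (PiE I (C n)) = emeasure (\<eta>' j) ((UNIV \<times> Q n) \<inter> A) * ennreal (v n ^ N)" for n
    proof -
      have "emeasure (PiM I \<eta>') (PiE I (C n)) = (\<Prod>i\<in>I. emeasure (\<eta>' i) (C n i))"
        using I C by (intro emeasure_PiM) auto
      also have "\<dots> = emeasure (\<eta>' j) (C n j) * (\<Prod>i\<in>I - {j}. emeasure (\<eta>' i) (C n i))"
        using I j by (intro prod.remove) auto
      also have "(\<Prod>i\<in>I - {j}. emeasure (\<eta>' i) (C n i)) = (\<Prod>i\<in>I - {j}. ennreal (v n))"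
        by (intro prod.cong) (auto simp: C_def nuQ v)
      also have "\<dots> = ennreal (v n ^ N)" using I j v by (simp add: N_def ennreal_power)
      also have "C n j = (UNIV \<times> Q n) \<inter> A" by (simp add: C_def)
      finally show ?thesis .
    qed
    moreover have "ennreal (1 / v n ^ N) * (emeasure (\<eta>' j) ((UNIV \<times> Q n) \<inter> A) * ennreal (v n ^ N))
        = emeasure (\<eta>' j) ((UNIV \<times> Q n) \<inter> A)" for n
    proof (cases "v n = 0")
      case True
      have "emeasure (\<eta>' j) ((UNIV \<times> Q n) \<inter> A) \<le> emeasure (\<eta>' j) (UNIV \<times> Q n)"
        unfolding S using Q(1) by (intro emeasure_mono) (auto simp: S borel_prod[symmetric])
      then show ?thesis using True nuQ[OF j, of n] v(1)[of n] by simp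
    next
      case False
      then have "ennreal (1 / v n ^ N) * ennreal (v n ^ N) = 1"
        using v(2)[of n] by (subst ennreal_mult[symmetric]) auto
      then show ?thesis by (simp only: mult.left_commute[of "ennreal (1 / v n ^ N)"] mult_1_right)
    qed
    moreover have "emeasure \<gamma> {\<omega> \<in> space (PiM I \<eta>'). \<omega> j \<in> A}
        = (\<integral>\<^sup>+\<omega>. (\<Sum>n. ennreal (1 / v n ^ N) * indicator (B n \<inter> {\<omega> \<in> space (PiM I \<eta>'). \<omega> j \<in> A}) \<omega>) \<partial>PiM I \<eta>')"
      unfolding \<gamma>_def by (subst emeasure_density) (auto simp: h_def indicator_inter_arith mult.assoc
          ennreal_suminf_multc[symmetric] intro!: nn_integral_cong)
    moreover have "\<dots> = (\<Sum>n. ennreal (1 / v n ^ N) * emeasure (PiM I \<eta>') (B n \<inter> {\<omega> \<in> space (PiM I \<eta>'). \<omega> j \<in> A}))"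
      by (subst nn_integral_suminf) (auto simp: nn_integral_cmult_indicator)
    ultimately have "emeasure \<gamma> {\<omega> \<in> space (PiM I \<eta>'). \<omega> j \<in> A} = (\<Sum>n. emeasure (\<eta>' j) ((UNIV \<times> Q n) \<inter> A))"
      by simp
    also have "\<dots> = emeasure (\<eta>' j) (\<Union>n. (UNIV \<times> Q n) \<inter> A)"
    proof (rule suminf_emeasure)
      show "range (\<lambda>n. (UNIV \<times> Q n) \<inter> A) \<subseteq> sets (\<eta>' j)"
        unfolding S using Q(1) A by (auto simp: borel_prod[symmetric])
      show "disjoint_family (\<lambda>n. (UNIV \<times> Q n) \<inter> A)" using Q(2) unfolding disjoint_family_on_def by blast
    qed
    also have "(\<Union>n. (UNIV \<times> Q n) \<inter> A) = A" using Q(3) by auto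
    finally show ?thesis .
  qed
  show ?thesis
  proof (rule that)
    have "emeasure \<gamma> (space \<gamma>) = 1"
      using law[OF i0, of UNIV] prob_space.emeasure_space_1[OF prob[of i\<^sub>0]] by (simp add: \<gamma>_def Sp)
    then show "prob_space \<gamma>" by (rule prob_spaceI)
    show "sets \<gamma> = sets (PiM I (\<lambda>_. borel))" by (simp add: \<gamma>_def sP)
    show "distr \<gamma> borel (\<lambda>\<omega>. \<omega> i) = \<eta> i" if i: "i \<in> I" for i
    proof (rule measure_eqI)
      show "sets (distr \<gamma> borel (\<lambda>\<omega>. \<omega> i)) = sets (\<eta> i)" using S[of i] i by (simp add: \<eta>'_def)
      fix A assume "A \<in> sets (distr \<gamma> borel (\<lambda>\<omega>. \<omega> i))"
      then have A: "A \<in> sets borel" by simp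
      have "(\<lambda>\<omega>. \<omega> i) \<in> \<gamma> \<rightarrow>\<^sub>M borel" using i unfolding \<gamma>_def by simp
      then have "emeasure (distr \<gamma> borel (\<lambda>\<omega>. \<omega> i)) A = emeasure \<gamma> {\<omega> \<in> space (PiM I \<eta>'). \<omega> i \<in> A}"
        using A by (subst emeasure_distr) (auto simp: \<gamma>_def intro!: arg_cong2[where f = emeasure])
      then show "emeasure (distr \<gamma> borel (\<lambda>\<omega>. \<omega> i)) A = emeasure (\<eta> i) A"
        using law[OF i A] i by (simp add: \<eta>'_def)
    qed
    have "\<forall>i\<in>I. \<forall>j\<in>I. dist (snd (\<omega> i)) (snd (\<omega> j)) < s" if "0 < h \<omega>" for \<omega>
    proof -
      have "\<exists>n. \<omega> \<in> B n"
      proof (rule ccontr)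
        assume "\<not> ?thesis"
        then have "h \<omega> = 0" by (simp add: h_def)
        then show False using that by simp
      qed
      then show ?thesis using Q(4) by (auto simp: B_def)
    qed
    then show "AE \<omega> in \<gamma>. \<forall>i\<in>I. \<forall>j\<in>I. dist (snd (\<omega> i)) (snd (\<omega> j)) < s"
      unfolding \<gamma>_def by (subst AE_density) auto
  qed
qed

section \<open>Plans that are optimal up to an error\<close>

definition bary_value ::
    "real \<Rightarrow> nat \<Rightarrow> (nat \<Rightarrow> real) \<Rightarrow> (nat \<Rightarrow> 'a::euclidean_space measure) \<Rightarrow> 'a measure \<Rightarrow> real" where
  "bary_value p N w \<mu> \<nu> = (\<Sum>i=1..N. w i * wasserstein p (\<mu> i) \<nu> powr p)"

type_synonym 'a state = "(nat \<Rightarrow> 'a) \<times> 'a"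

text \<open>Under an approximate plan the points are \<open>fst (\<omega> i)\<close> and the barycenter is \<open>snd (\<omega> 1)\<close>;
  the other components \<open>snd (\<omega> i)\<close> play no role.\<close>

definition plan_state :: "nat \<Rightarrow> (nat \<Rightarrow> 'a \<times> 'a) \<Rightarrow> 'a state" where
  "plan_state N \<omega> = (restrict (\<lambda>i. fst (\<omega> i)) {1..N}, snd (\<omega> 1))"

definition state_cost ::
    "real \<Rightarrow> nat \<Rightarrow> (nat \<Rightarrow> real) \<Rightarrow> 'a::euclidean_space state \<Rightarrow> real" where
  "state_cost p N w s = bary_cost p {1..N} w (fst s) (snd s)"

text \<open>All marginals are exact and the error e sits in the cost alone. Competitors built from
  such a plan therefore remain admissible and can improve its cost by at most e.\<close>

definition approx_plan ::
    "real \<Rightarrow> nat \<Rightarrow> (nat \<Rightarrow> real) \<Rightarrow> (nat \<Rightarrow> 'a::euclidean_space measure) \<Rightarrow> 'a measure \<Rightarrow> real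
      \<Rightarrow> (nat \<Rightarrow> 'a \<times> 'a) measure \<Rightarrow> bool" where
  "approx_plan p N w \<mu> \<nu> e \<gamma> \<longleftrightarrow> prob_space \<gamma> \<and> sets \<gamma> = sets (PiM {1..N} (\<lambda>_. borel)) \<and>
     (\<forall>i\<in>{1..N}. distr \<gamma> borel (\<lambda>\<omega>. fst (\<omega> i)) = \<mu> i) \<and> distr \<gamma> borel (\<lambda>\<omega>. snd (\<omega> 1)) = \<nu> \<and>
     (\<integral>\<^sup>+\<omega>. ennreal (state_cost p N w (plan_state N \<omega>)) \<partial>\<gamma>) \<le> ennreal (bary_value p N w \<mu> \<nu> + e)"

text \<open>Convexity at a / (1 - t) and b / t with weights 1 - t and t. Unlike in
  \<open>powr_add_le\<close>, the coefficient of the main term tends to 1 as t tends to 0.\<close>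

lemma powr_add_le_convex:
  fixes a b p t :: real
  assumes p: "1 < p" and t: "0 < t" "t < 1" and ab: "0 \<le> a" "0 \<le> b"
  shows "(a + b) powr p \<le> (1 - t) powr (1 - p) * a powr p + t powr (1 - p) * b powr p"
proof -
  have *: "c * norm (x / c) powr p = c powr (1 - p) * x powr p" if "0 < c" "0 \<le> x" for c x :: real
    using that by (simp add: powr_divide powr_diff)
  have "a / (1 - t) + t *\<^sub>R (b / t - a / (1 - t)) = a + b"
  proof -
    have "a / (1 - t) + t *\<^sub>R (b / t - a / (1 - t)) = (1 - t) * (a / (1 - t)) + t * (b / t)"
      by (simp only: real_scaleR_def left_diff_distrib right_diff_distrib mult_1_left)
    then show ?thesis using t by simp
  qed
  then have "(a + b) powr p = norm (a / (1 - t) + t *\<^sub>R (b / t - a / (1 - t))) powr p"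
    using ab by simp
  also have "\<dots> \<le> (1 - t) * norm (a / (1 - t)) powr p + t * norm (b / t) powr p"
    using p t by (intro norm_powr_convex) auto
  finally show ?thesis using *[of "1 - t" a] *[of t b] t ab by simp
qed

lemma bary_cost_near_le:
  assumes p: "1 < p" and t: "0 < t" "t < 1" and w: "\<And>i. i \<in> I \<Longrightarrow> 0 \<le> w i"
    and "\<And>i. i \<in> I \<Longrightarrow> dist (z i) z\<^sub>0 \<le> s"
  shows "bary_cost p I w x z\<^sub>0
    \<le> (1 - t) powr (1 - p) * (\<Sum>i\<in>I. w i * norm (x i - z i) powr p) + t powr (1 - p) * s powr p * sum w I"
proof -
  have "bary_cost p I w x z\<^sub>0 \<le> (\<Sum>i\<in>I. w i * ((1 - t) powr (1 - p) * norm (x i - z i) powr p + t powr (1 - p) * s powr p))"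
    unfolding bary_cost_def
  proof (intro sum_mono mult_left_mono w)
    fix i assume i: "i \<in> I"
    have s: "0 \<le> s" using assms(5)[OF i] by (meson dist_not_less_zero not_le order_trans le_cases zero_le_dist)
    have "norm (x i - z\<^sub>0) \<le> norm (x i - z i) + s"
      using assms(5)[OF i] norm_triangle_ineq[of "x i - z i" "z i - z\<^sub>0"] by (simp add: dist_norm)
    then have "norm (x i - z\<^sub>0) powr p \<le> (norm (x i - z i) + s) powr p" using p by (intro powr_mono2) auto
    also have "\<dots> \<le> (1 - t) powr (1 - p) * norm (x i - z i) powr p + t powr (1 - p) * s powr p"
      using p t s by (intro powr_add_le_convex) auto
    finally show "norm (x i - z\<^sub>0) powr p \<le> (1 - t) powr (1 - p) * norm (x i - z i) powr p + t powr (1 - p) * s powr p" .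
  qed
  also have "\<dots> = (1 - t) powr (1 - p) * (\<Sum>i\<in>I. w i * norm (x i - z i) powr p) + t powr (1 - p) * s powr p * sum w I"
    by (simp add: distrib_left sum.distrib sum_distrib_left sum_distrib_right mult_ac)
  finally show ?thesis .
qed

text \<open>The error e is spent as follows: e / 4 on the couplings, e / 4 on the factor (1 -
  t)^(1-p), and e / 2 on the second components of the glued law differing by less than s. The
  parameter t is fixed before s, since t^(1-p) blows up as t tends to 0.\<close>

lemma approx_plan_exists:
  fixes \<mu> :: "nat \<Rightarrow> 'a::euclidean_space measure"
  assumes p: "1 < p" and N: "1 \<le> N" and w: "\<And>i. i \<in> {1..N} \<Longrightarrow> 0 < w i" and w1: "sum w {1..N} = 1"
    and \<mu>: "\<And>i. i \<in> {1..N} \<Longrightarrow> borel_prob (\<mu> i)" "\<And>i. i \<in> {1..N} \<Longrightarrow> AE x in \<mu> i. norm x \<le> r"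
    and \<nu>: "\<nu> \<in> Prob_p p" and e: "0 < e"
  shows "\<exists>\<gamma>. approx_plan p N w \<mu> \<nu> e \<gamma>"
proof -
  define V where "V = bary_value p N w \<mu> \<nu>"
  have V0: "0 \<le> V" unfolding V_def bary_value_def using w
    by (intro sum_nonneg mult_nonneg_nonneg) (auto intro: less_imp_le)
  have "((\<lambda>t. (1 - t) powr (1 - p) * (V + e / 4)) \<longlongrightarrow> (1 - 0) powr (1 - p) * (V + e / 4)) (at_right 0)"
    by (intro tendsto_intros) auto
  moreover have "(1 - 0) powr (1 - p) * (V + e / 4) < V + e / 2" using e by simp
  ultimately have "eventually (\<lambda>t. (1 - t) powr (1 - p) * (V + e / 4) < V + e / 2) (at_right 0)"
    by (rule order_tendstoD)
  moreover have "eventually (\<lambda>t::real. t < 1) (at_right 0)"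
    using eventually_at_right_less[of "0::real"] by (auto simp: eventually_at_right_field intro: exI[of _ 1])
  moreover have "eventually (\<lambda>t::real. 0 < t) (at_right 0)" by (rule eventually_at_right_less)
  ultimately have "eventually (\<lambda>t. (1 - t) powr (1 - p) * (V + e / 4) < V + e / 2 \<and> t < 1 \<and> 0 < t) (at_right 0)"
    by eventually_elim auto
  then obtain t where t: "(1 - t) powr (1 - p) * (V + e / 4) < V + e / 2" "t < 1" "0 < t"
    using eventually_happens[of _ "at_right (0::real)"] by auto
  \<comment> \<open>The solution of t^(1-p) s^p = e / 2, the price of replacing every second
    component by the one with index 1.\<close>
  define s where "s = (e / 2 * t powr (p - 1)) powr (1 / p)"
  have s: "0 < s" using e t by (simp add: s_def)
  have "s powr p = e / 2 * t powr (p - 1)" using e t p by (simp add: s_def powr_powr)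
  then have ts: "t powr (1 - p) * s powr p = e / 2" using t by (simp add: powr_diff)
  have p0: "0 < p" and e4: "0 < e / 4" using p e by auto
  have "\<forall>i\<in>{1..N}. \<exists>\<eta>. \<eta> \<in> couplings (\<mu> i) \<nu> \<and>
    (\<integral>\<^sup>+z. ennreal (norm (fst z - snd z) powr p) \<partial>\<eta>) \<le> ennreal (wasserstein p (\<mu> i) \<nu> powr p + e / 4)"
    using near_optimal_coupling[OF \<mu>(1) \<mu>(2) \<nu> p0 e4] by blast
  from bchoice[OF this] obtain \<eta> where \<eta>: "\<And>i. i \<in> {1..N} \<Longrightarrow> \<eta> i \<in> couplings (\<mu> i) \<nu>"
    "\<And>i. i \<in> {1..N} \<Longrightarrow> (\<integral>\<^sup>+z. ennreal (norm (fst z - snd z) powr p) \<partial>\<eta> i) \<le> ennreal (wasserstein p (\<mu> i) \<nu> powr p + e / 4)"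
    by blast
  have N1: "1 \<in> {1..N}" using N by simp
  obtain \<gamma> where \<gamma>: "prob_space \<gamma>" "sets \<gamma> = sets (PiM {1..N} (\<lambda>_. borel))"
    "\<And>i. i \<in> {1..N} \<Longrightarrow> distr \<gamma> borel (\<lambda>\<omega>. \<omega> i) = \<eta> i"
    "AE \<omega> in \<gamma>. \<forall>i\<in>{1..N}. \<forall>j\<in>{1..N}. dist (snd (\<omega> i)) (snd (\<omega> j)) < s"
  proof (rule approximate_gluing[of "{1..N}" \<eta> \<mu> \<nu> s])
    show "\<eta> i \<in> couplings (\<mu> i) \<nu>" if "i \<in> {1..N}" for i by (rule \<eta>(1)[OF that])
  qed (use s N1 in auto)
  interpret prob_space \<gamma> by (rule \<gamma>)
  have meas[measurable]: "(\<lambda>\<omega>. \<omega> i) \<in> \<gamma> \<rightarrow>\<^sub>M borel" if "i \<in> {1..N}" for i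
    using measurable_component_singleton[OF that, of "\<lambda>_. borel"] measurable_cong_sets[OF \<gamma>(2) refl] by blast
  have d: "distr \<gamma> borel (\<lambda>\<omega>. fst (\<omega> i)) = \<mu> i" "distr \<gamma> borel (\<lambda>\<omega>. snd (\<omega> i)) = \<nu>" if i: "i \<in> {1..N}" for i
  proof -
    have "distr (\<eta> i) borel fst = \<mu> i" "distr (\<eta> i) borel snd = \<nu>"
      using \<eta>(1)[OF i] by (auto simp: couplings_def)
    then show "distr \<gamma> borel (\<lambda>\<omega>. fst (\<omega> i)) = \<mu> i" "distr \<gamma> borel (\<lambda>\<omega>. snd (\<omega> i)) = \<nu>"
      using meas[OF i] unfolding \<gamma>(3)[OF i, symmetric] by (simp_all add: distr_distr comp_def)
  qed
  have "(\<integral>\<^sup>+\<omega>. ennreal (state_cost p N w (plan_state N \<omega>)) \<partial>\<gamma>)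
    \<le> (\<integral>\<^sup>+\<omega>. ennreal ((1 - t) powr (1 - p) * (\<Sum>i\<in>{1..N}. w i * norm (fst (\<omega> i) - snd (\<omega> i)) powr p) + e / 2) \<partial>\<gamma>)"
  proof (rule nn_integral_mono_AE)
    show "AE \<omega> in \<gamma>. ennreal (state_cost p N w (plan_state N \<omega>))
      \<le> ennreal ((1 - t) powr (1 - p) * (\<Sum>i\<in>{1..N}. w i * norm (fst (\<omega> i) - snd (\<omega> i)) powr p) + e / 2)"
      using \<gamma>(4)
    proof eventually_elim
      case (elim \<omega>)
      have "bary_cost p {1..N} w (\<lambda>i. fst (\<omega> i)) (snd (\<omega> 1)) \<le> (1 - t) powr (1 - p) *
          (\<Sum>i\<in>{1..N}. w i * norm (fst (\<omega> i) - snd (\<omega> i)) powr p) + t powr (1 - p) * s powr p * sum w {1..N}"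
        by (rule bary_cost_near_le[OF p]) (use t w elim N1 in \<open>auto intro: less_imp_le\<close>)
      moreover have "state_cost p N w (plan_state N \<omega>) = bary_cost p {1..N} w (\<lambda>i. fst (\<omega> i)) (snd (\<omega> 1))"
        unfolding state_cost_def plan_state_def fst_conv snd_conv by (rule bary_cost_cong) simp
      ultimately show ?case using w1 ts by (intro ennreal_leI) simp
    qed
  qed
  also have "\<dots> = (\<integral>\<^sup>+\<omega>. ennreal ((1 - t) powr (1 - p)) * (\<Sum>i\<in>{1..N}. ennreal (w i) * ennreal (norm (fst (\<omega> i) - snd (\<omega> i)) powr p)) + ennreal (e / 2) \<partial>\<gamma>)"
  proof (intro nn_integral_cong)
    fix \<omega> :: "nat \<Rightarrow> 'a \<times> 'a"
    have nn: "0 \<le> w i * norm (fst (\<omega> i) - snd (\<omega> i)) powr p" if "i \<in> {1..N}" for i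
      using w[OF that] by simp
    have "(\<Sum>i\<in>{1..N}. ennreal (w i) * ennreal (norm (fst (\<omega> i) - snd (\<omega> i)) powr p))
        = (\<Sum>i\<in>{1..N}. ennreal (w i * norm (fst (\<omega> i) - snd (\<omega> i)) powr p))"
      using w by (intro sum.cong refl) (simp add: ennreal_mult less_imp_le)
    also have "\<dots> = ennreal (\<Sum>i\<in>{1..N}. w i * norm (fst (\<omega> i) - snd (\<omega> i)) powr p)"
      by (rule sum_ennreal[OF nn])
    finally have "(\<Sum>i\<in>{1..N}. ennreal (w i) * ennreal (norm (fst (\<omega> i) - snd (\<omega> i)) powr p))
        = ennreal (\<Sum>i\<in>{1..N}. w i * norm (fst (\<omega> i) - snd (\<omega> i)) powr p)" .
    moreover have "0 \<le> (\<Sum>i\<in>{1..N}. w i * norm (fst (\<omega> i) - snd (\<omega> i)) powr p)"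
      by (rule sum_nonneg[OF nn])
    ultimately show "ennreal ((1 - t) powr (1 - p) * (\<Sum>i\<in>{1..N}. w i * norm (fst (\<omega> i) - snd (\<omega> i)) powr p) + e / 2)
      = ennreal ((1 - t) powr (1 - p)) * (\<Sum>i\<in>{1..N}. ennreal (w i) * ennreal (norm (fst (\<omega> i) - snd (\<omega> i)) powr p)) + ennreal (e / 2)"
      using e by (simp add: ennreal_mult ennreal_plus del: sum_ennreal)
  qed
  also have "\<dots> = ennreal ((1 - t) powr (1 - p)) * (\<Sum>i\<in>{1..N}. ennreal (w i) * (\<integral>\<^sup>+\<omega>. ennreal (norm (fst (\<omega> i) - snd (\<omega> i)) powr p) \<partial>\<gamma>)) + ennreal (e / 2)"
  proof -
    have mm: "(\<lambda>\<omega>. ennreal (norm (fst (\<omega> i) - snd (\<omega> i)) powr p)) \<in> borel_measurable \<gamma>"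
      if i: "i \<in> {1..N}" for i
      using meas[OF i] by measurable
    have mS: "(\<lambda>\<omega>. \<Sum>i\<in>{1..N}. ennreal (w i) * ennreal (norm (fst (\<omega> i) - snd (\<omega> i)) powr p)) \<in> borel_measurable \<gamma>"
      using mm by (intro borel_measurable_sum borel_measurable_times) auto
    have "(\<integral>\<^sup>+\<omega>. (\<Sum>i\<in>{1..N}. ennreal (w i) * ennreal (norm (fst (\<omega> i) - snd (\<omega> i)) powr p)) \<partial>\<gamma>)
        = (\<Sum>i\<in>{1..N}. \<integral>\<^sup>+\<omega>. ennreal (w i) * ennreal (norm (fst (\<omega> i) - snd (\<omega> i)) powr p) \<partial>\<gamma>)"
      using mm by (intro nn_integral_sum borel_measurable_times) auto
    also have "\<dots> = (\<Sum>i\<in>{1..N}. ennreal (w i) * (\<integral>\<^sup>+\<omega>. ennreal (norm (fst (\<omega> i) - snd (\<omega> i)) powr p) \<partial>\<gamma>))"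
      by (intro sum.cong refl nn_integral_cmult mm)
    finally show ?thesis
      using mS by (simp add: nn_integral_add nn_integral_cmult emeasure_space_1)
  qed
  also have "\<dots> \<le> ennreal ((1 - t) powr (1 - p)) * (\<Sum>i\<in>{1..N}. ennreal (w i) * ennreal (wasserstein p (\<mu> i) \<nu> powr p + e / 4)) + ennreal (e / 2)"
  proof (intro add_right_mono mult_left_mono sum_mono)
    fix i assume i: "i \<in> {1..N}"
    have "(\<integral>\<^sup>+\<omega>. ennreal (norm (fst (\<omega> i) - snd (\<omega> i)) powr p) \<partial>\<gamma>) = (\<integral>\<^sup>+z. ennreal (norm (fst z - snd z) powr p) \<partial>\<eta> i)"
      using meas[OF i] unfolding \<gamma>(3)[OF i, symmetric] by (subst nn_integral_distr) auto
    then show "(\<integral>\<^sup>+\<omega>. ennreal (norm (fst (\<omega> i) - snd (\<omega> i)) powr p) \<partial>\<gamma>) \<le> ennreal (wasserstein p (\<mu> i) \<nu> powr p + e / 4)"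
      using \<eta>(2)[OF i] by simp
  qed auto
  also have "\<dots> = ennreal ((1 - t) powr (1 - p) * (V + e / 4) + e / 2)"
  proof -
    have w0: "0 \<le> w i" if "i \<in> {1..N}" for i using w[OF that] by simp
    have "(\<Sum>i\<in>{1..N}. ennreal (w i) * ennreal (wasserstein p (\<mu> i) \<nu> powr p + e / 4))
        = ennreal (\<Sum>i\<in>{1..N}. w i * (wasserstein p (\<mu> i) \<nu> powr p + e / 4))"
      using w0 e by (subst sum_ennreal[symmetric]) (auto intro!: sum.cong simp: ennreal_mult)
    also have "(\<Sum>i\<in>{1..N}. w i * (wasserstein p (\<mu> i) \<nu> powr p + e / 4)) = V + e / 4"
      unfolding V_def bary_value_def distrib_left sum.distrib sum_distrib_right[symmetric] w1 by simp
    finally show ?thesis using e V0 by (simp add: ennreal_mult ennreal_plus)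
  qed
  also have "\<dots> \<le> ennreal (V + e)" using t by (intro ennreal_leI) simp
  finally show ?thesis unfolding approx_plan_def using \<gamma> d N1 V_def by blast
qed

subsection \<open>Asymptotically null events\<close>

lemma nn_integral_pair_swap:
  assumes "sigma_finite_measure M" and [measurable]: "f \<in> borel_measurable (M \<Otimes>\<^sub>M M)"
  shows "(\<integral>\<^sup>+\<omega>. f (snd \<omega>, fst \<omega>) \<partial>(M \<Otimes>\<^sub>M M)) = (\<integral>\<^sup>+\<omega>. f \<omega> \<partial>(M \<Otimes>\<^sub>M M))"
proof -
  interpret sigma_finite_measure M by fact
  interpret pair_sigma_finite M M ..
  have "(\<integral>\<^sup>+\<omega>. f \<omega> \<partial>(M \<Otimes>\<^sub>M M)) = (\<integral>\<^sup>+\<omega>. f \<omega> \<partial>(distr (M \<Otimes>\<^sub>M M) (M \<Otimes>\<^sub>M M) (\<lambda>(x, y). (y, x))))"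
    by (subst distr_pair_swap) simp
  also have "\<dots> = (\<integral>\<^sup>+\<omega>. f (snd \<omega>, fst \<omega>) \<partial>(M \<Otimes>\<^sub>M M))"
    by (subst nn_integral_distr) (auto simp: case_prod_beta)
  finally show ?thesis by simp
qed

lemma nn_integral_pair_fst:
  assumes "prob_space M" and [measurable]: "f \<in> borel_measurable M"
  shows "(\<integral>\<^sup>+\<omega>. f (fst \<omega>) \<partial>(M \<Otimes>\<^sub>M M)) = (\<integral>\<^sup>+\<omega>. f \<omega> \<partial>M)"
proof -
  interpret prob_space M by fact
  have "(\<integral>\<^sup>+\<omega>. f \<omega> \<partial>M) = (\<integral>\<^sup>+\<omega>. f \<omega> \<partial>(distr (M \<Otimes>\<^sub>M M) M fst))"
    by (simp add: distr_pair_fst)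
  also have "\<dots> = (\<integral>\<^sup>+\<omega>. f (fst \<omega>) \<partial>(M \<Otimes>\<^sub>M M))"
    by (subst nn_integral_distr) auto
  finally show ?thesis by simp
qed

locale barycenter_setting =
  fixes p :: real and N :: nat and w :: "nat \<Rightarrow> real" and \<mu> :: "nat \<Rightarrow> 'a::euclidean_space measure"
    and \<nu> :: "'a measure" and r :: real
  assumes p: "1 < p" and N: "2 \<le> N" and w: "\<And>i. i \<in> {1..N} \<Longrightarrow> 0 < w i" and w1: "sum w {1..N} = 1"
    and \<mu>: "\<And>i. i \<in> {1..N} \<Longrightarrow> borel_prob (\<mu> i)" "\<And>i. i \<in> {1..N} \<Longrightarrow> spt (\<mu> i) \<subseteq> cball 0 r"
    and bary: "is_wasserstein_barycenter p N w \<mu> \<nu>"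
begin

abbreviation "spt_tuples \<equiv> PiE {1..N} (\<lambda>i. spt (\<mu> i))"

definition lipschitz_on_stable_pairs :: "real \<Rightarrow> bool" where
  "lipschitz_on_stable_pairs L \<longleftrightarrow> (\<forall>x\<in>spt_tuples. \<forall>x'\<in>spt_tuples. \<forall>z z'.
     stable_pair p N w r x z x' z' \<longrightarrow> norm (x 1 - x' 1) \<le> L * norm (z - z'))"

lemma one_in_index: "1 \<in> {1..N}" using N by simp

lemma AE_spt_index: "i \<in> {1..N} \<Longrightarrow> AE x in \<mu> i. x \<in> spt (\<mu> i)"
  using \<mu> AE_spt by blast

lemma AE_norm_le: "i \<in> {1..N} \<Longrightarrow> AE x in \<mu> i. norm x \<le> r"
  using AE_spt_index[of i] \<mu>(2)[of i] by (auto elim!: eventually_mono)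

lemma norm_spt_le: "x \<in> spt_tuples \<Longrightarrow> i \<in> {1..N} \<Longrightarrow> norm (x i) \<le> r"
  using \<mu>(2) by (fastforce simp: PiE_iff)

lemma bary_value_nonneg: "0 \<le> bary_value p N w \<mu> \<nu>"
  unfolding bary_value_def using w by (intro sum_nonneg mult_nonneg_nonneg) (auto intro: less_imp_le)

lemma competitor:
  assumes "prob_space M" "\<And>i. i \<in> {1..N} \<Longrightarrow> (\<lambda>\<omega>. X \<omega> i) \<in> borel_measurable M"
    "\<And>i. i \<in> {1..N} \<Longrightarrow> distr M borel (\<lambda>\<omega>. X \<omega> i) = \<mu> i" "Y \<in> borel_measurable M"
  shows "ennreal (bary_value p N w \<mu> \<nu>) \<le> (\<integral>\<^sup>+\<omega>. ennreal (bary_cost p {1..N} w (X \<omega>) (Y \<omega>)) \<partial>M)"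
  unfolding bary_value_def
  using bary p N w assms AE_norm_le[OF one_in_index] by (intro barycenter_competitor) auto

lemma approx_planD:
  assumes "approx_plan p N w \<mu> \<nu> e \<gamma>"
  shows "prob_space \<gamma>" "\<And>i. i \<in> {1..N} \<Longrightarrow> (\<lambda>\<omega>. fst (plan_state N \<omega>) i) \<in> borel_measurable \<gamma>"
    "(\<lambda>\<omega>. snd (plan_state N \<omega>)) \<in> borel_measurable \<gamma>"
    "\<And>i. i \<in> {1..N} \<Longrightarrow> distr \<gamma> borel (\<lambda>\<omega>. fst (plan_state N \<omega>) i) = \<mu> i"
    "distr \<gamma> borel (\<lambda>\<omega>. snd (plan_state N \<omega>)) = \<nu>"
    "(\<integral>\<^sup>+\<omega>. ennreal (state_cost p N w (plan_state N \<omega>)) \<partial>\<gamma>) \<le> ennreal (bary_value p N w \<mu> \<nu> + e)"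
proof -
  have S: "sets \<gamma> = sets (PiM {1..N} (\<lambda>_. borel))" using assms by (simp add: approx_plan_def)
  have meas: "(\<lambda>\<omega>. \<omega> i) \<in> \<gamma> \<rightarrow>\<^sub>M borel" if "i \<in> {1..N}" for i
    using measurable_component_singleton[OF that, of "\<lambda>_. borel"] measurable_cong_sets[OF S refl] by blast
  show "(\<lambda>\<omega>. fst (plan_state N \<omega>) i) \<in> borel_measurable \<gamma>" if "i \<in> {1..N}" for i
    using measurable_compose[OF meas[OF that] measurable_fst_borel] that by (simp add: plan_state_def)
  show "(\<lambda>\<omega>. snd (plan_state N \<omega>)) \<in> borel_measurable \<gamma>"
    using measurable_compose[OF meas[OF one_in_index] measurable_snd_borel] by (simp add: plan_state_def)
qed (use assms one_in_index in \<open>auto simp: approx_plan_def plan_state_def\<close>)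

text \<open>An outer measure bound: containment in a measurable E allows S to be an arbitrary set of
  pairs of states.\<close>

definition pair_event_le :: "(nat \<Rightarrow> 'a \<times> 'a) measure \<Rightarrow> real
    \<Rightarrow> ('a state \<times> 'a state) set \<Rightarrow> bool" where
  "pair_event_le \<gamma> \<beta> S \<longleftrightarrow> (\<exists>E\<in>sets (\<gamma> \<Otimes>\<^sub>M \<gamma>). emeasure (\<gamma> \<Otimes>\<^sub>M \<gamma>) E \<le> ennreal \<beta> \<and>
     {\<omega> \<in> space (\<gamma> \<Otimes>\<^sub>M \<gamma>). (plan_state N (fst \<omega>), plan_state N (snd \<omega>)) \<in> S} \<subseteq> E)"

text \<open>The plan is quantified after e: one error level must serve all plans. Several events can
  thus be controlled together, and the plan picked last. This plays the part of a null event for two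
  independent copies of an optimal plan.\<close>

definition asymptotically_null :: "('a state \<times> 'a state) set \<Rightarrow> bool" where
  "asymptotically_null S \<longleftrightarrow>
     (\<forall>\<beta>>0. \<exists>e>0. \<forall>\<gamma>. approx_plan p N w \<mu> \<nu> e \<gamma> \<longrightarrow> pair_event_le \<gamma> \<beta> S)"

lemma asymptotically_nullI:
  assumes "0 < K" and "\<And>e \<gamma>. 0 < e \<Longrightarrow> approx_plan p N w \<mu> \<nu> e \<gamma> \<Longrightarrow> pair_event_le \<gamma> (K * e) S"
  shows "asymptotically_null S"
  unfolding asymptotically_null_def
proof (intro allI impI)
  fix \<beta> :: real assume "0 < \<beta>"
  then have K: "0 < \<beta> / K" "K * (\<beta> / K) = \<beta>" using assms(1) by auto
  show "\<exists>e>0. \<forall>\<gamma>. approx_plan p N w \<mu> \<nu> e \<gamma> \<longrightarrow> pair_event_le \<gamma> \<beta> S"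
    using assms(2)[OF K(1)] K(1) unfolding K(2) by blast
qed

lemma approx_plan_mono:
  assumes "approx_plan p N w \<mu> \<nu> e \<gamma>" "e \<le> e'"
  shows "approx_plan p N w \<mu> \<nu> e' \<gamma>"
proof -
  have "ennreal (bary_value p N w \<mu> \<nu> + e) \<le> ennreal (bary_value p N w \<mu> \<nu> + e')"
    using assms by (intro ennreal_leI) simp
  from order_trans[OF approx_planD(6)[OF assms(1)] this] show ?thesis
    using assms(1) unfolding approx_plan_def by - (elim conjE, intro conjI; assumption)
qed

lemma pair_event_le_mono:
  assumes "pair_event_le \<gamma> \<beta> T" "S \<subseteq> T"
  shows "pair_event_le \<gamma> \<beta> S"
proof -
  obtain E where E: "E \<in> sets (\<gamma> \<Otimes>\<^sub>M \<gamma>)" "emeasure (\<gamma> \<Otimes>\<^sub>M \<gamma>) E \<le> ennreal \<beta>"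
      "{\<omega> \<in> space (\<gamma> \<Otimes>\<^sub>M \<gamma>). (plan_state N (fst \<omega>), plan_state N (snd \<omega>)) \<in> T} \<subseteq> E"
    using assms unfolding pair_event_le_def by (elim bexE conjE)
  have "{\<omega> \<in> space (\<gamma> \<Otimes>\<^sub>M \<gamma>). (plan_state N (fst \<omega>), plan_state N (snd \<omega>)) \<in> S} \<subseteq> E"
    by (rule order_trans[OF _ E(3)]) (use assms(2) in auto)
  then show ?thesis unfolding pair_event_le_def using E by (intro bexI[of _ E] conjI)
qed

lemma pair_event_le_Un:
  assumes "pair_event_le \<gamma> \<beta> S" "pair_event_le \<gamma> \<beta>' T" "0 \<le> \<beta>" "0 \<le> \<beta>'"
  shows "pair_event_le \<gamma> (\<beta> + \<beta>') (S \<union> T)"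
proof -
  obtain E F where E: "E \<in> sets (\<gamma> \<Otimes>\<^sub>M \<gamma>)" "emeasure (\<gamma> \<Otimes>\<^sub>M \<gamma>) E \<le> ennreal \<beta>"
      "{\<omega> \<in> space (\<gamma> \<Otimes>\<^sub>M \<gamma>). (plan_state N (fst \<omega>), plan_state N (snd \<omega>)) \<in> S} \<subseteq> E"
    and F: "F \<in> sets (\<gamma> \<Otimes>\<^sub>M \<gamma>)" "emeasure (\<gamma> \<Otimes>\<^sub>M \<gamma>) F \<le> ennreal \<beta>'"
      "{\<omega> \<in> space (\<gamma> \<Otimes>\<^sub>M \<gamma>). (plan_state N (fst \<omega>), plan_state N (snd \<omega>)) \<in> T} \<subseteq> F"
    using assms(1,2) unfolding pair_event_le_def by (elim bexE conjE)
  have "emeasure (\<gamma> \<Otimes>\<^sub>M \<gamma>) (E \<union> F) \<le> emeasure (\<gamma> \<Otimes>\<^sub>M \<gamma>) E + emeasure (\<gamma> \<Otimes>\<^sub>M \<gamma>) F"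
    by (rule emeasure_subadditive[OF E(1) F(1)])
  also have "\<dots> \<le> ennreal \<beta> + ennreal \<beta>'" by (rule add_mono[OF E(2) F(2)])
  also have "\<dots> = ennreal (\<beta> + \<beta>')" using assms by simp
  finally show ?thesis
    unfolding pair_event_le_def using E(1,3) F(1,3) by (intro bexI[of _ "E \<union> F"] conjI) auto
qed

lemma asymptotically_null_empty: "asymptotically_null {}"
proof (rule asymptotically_nullI[of 1])
  show "pair_event_le \<gamma> (1 * e) {}" for e \<gamma>
    unfolding pair_event_le_def by (rule bexI[of _ "{}"]) simp_all
qed simp

lemma asymptotically_null_Un:
  assumes "asymptotically_null S" "asymptotically_null T"
  shows "asymptotically_null (S \<union> T)"
  unfolding asymptotically_null_def
proof (intro allI impI)
  fix \<beta> :: real assume b: "0 < \<beta>"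
  then have b2: "0 < \<beta> / 2" by simp
  obtain e where e: "0 < e" "\<And>\<gamma>. approx_plan p N w \<mu> \<nu> e \<gamma> \<Longrightarrow> pair_event_le \<gamma> (\<beta> / 2) S"
    using assms(1) b2 unfolding asymptotically_null_def by blast
  obtain e' where e': "0 < e'" "\<And>\<gamma>. approx_plan p N w \<mu> \<nu> e' \<gamma> \<Longrightarrow> pair_event_le \<gamma> (\<beta> / 2) T"
    using assms(2) b2 unfolding asymptotically_null_def by blast
  show "\<exists>e>0. \<forall>\<gamma>. approx_plan p N w \<mu> \<nu> e \<gamma> \<longrightarrow> pair_event_le \<gamma> \<beta> (S \<union> T)"
  proof (intro exI[of _ "min e e'"] conjI allI impI)
    show "0 < min e e'" using e e' by simp
    fix \<gamma> assume g: "approx_plan p N w \<mu> \<nu> (min e e') \<gamma>"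
    have "pair_event_le \<gamma> (\<beta> / 2 + \<beta> / 2) (S \<union> T)"
      using b2 by (intro pair_event_le_Un e(2) e'(2) approx_plan_mono[OF g]) auto
    then show "pair_event_le \<gamma> \<beta> (S \<union> T)" by simp
  qed
qed

lemma asymptotically_null_mono:
  assumes "asymptotically_null T" "S \<subseteq> T"
  shows "asymptotically_null S"
  using assms pair_event_le_mono unfolding asymptotically_null_def by meson

text \<open>Each application of \<open>asymptotically_null_Un\<close> may lower e, so a finite
  subcover is what makes the passage from local to global possible.\<close>

lemma asymptotically_null_compact:
  assumes "compact K" "\<And>s. s \<in> K \<Longrightarrow> \<exists>U. open U \<and> s \<in> U \<and> asymptotically_null U"
  shows "asymptotically_null K"
proof -
  define \<U> where "\<U> = {U. open U \<and> asymptotically_null U}"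
  have "K \<subseteq> \<Union>\<U>" "\<And>U. U \<in> \<U> \<Longrightarrow> open U" unfolding \<U>_def using assms(2) by blast+
  then obtain \<F> where F: "\<F> \<subseteq> \<U>" "finite \<F>" "K \<subseteq> \<Union>\<F>"
    using assms(1) by (metis compactE)
  have "asymptotically_null (\<Union>\<F>)"
    using F(2,1)
  proof (induction \<F>)
    case (insert U \<F>)
    then have "asymptotically_null (U \<union> \<Union>\<F>)" by (intro asymptotically_null_Un) (auto simp: \<U>_def)
    then show ?case by simp
  qed (simp add: asymptotically_null_empty)
  then show ?thesis using F(3) asymptotically_null_mono by blast
qed

lemma asymptotically_null_swap:
  assumes "asymptotically_null S"
  shows "asymptotically_null ((\<lambda>s. (snd s, fst s)) -` S)"
  unfolding asymptotically_null_def
proof (intro allI impI)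
  fix \<beta> :: real assume "0 < \<beta>"
  then obtain e where e: "0 < e" "\<And>\<gamma>. approx_plan p N w \<mu> \<nu> e \<gamma> \<Longrightarrow> pair_event_le \<gamma> \<beta> S"
    using assms(1) unfolding asymptotically_null_def by blast
  have "pair_event_le \<gamma> \<beta> ((\<lambda>s. (snd s, fst s)) -` S)" if g: "approx_plan p N w \<mu> \<nu> e \<gamma>" for \<gamma>
  proof -
    obtain E where E: "E \<in> sets (\<gamma> \<Otimes>\<^sub>M \<gamma>)" "emeasure (\<gamma> \<Otimes>\<^sub>M \<gamma>) E \<le> ennreal \<beta>"
        "{\<omega> \<in> space (\<gamma> \<Otimes>\<^sub>M \<gamma>). (plan_state N (fst \<omega>), plan_state N (snd \<omega>)) \<in> S} \<subseteq> E"
      using e(2)[OF g] unfolding pair_event_le_def by blast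
    interpret prob_space \<gamma> by (rule approx_planD(1)[OF g])
    interpret pair_sigma_finite \<gamma> \<gamma> ..
    define E' where "E' = (\<lambda>s. (snd s, fst s)) -` E \<inter> space (\<gamma> \<Otimes>\<^sub>M \<gamma>)"
    have m: "(\<lambda>s. (snd s, fst s)) \<in> (\<gamma> \<Otimes>\<^sub>M \<gamma>) \<rightarrow>\<^sub>M (\<gamma> \<Otimes>\<^sub>M \<gamma>)" by measurable
    have "E' \<in> sets (\<gamma> \<Otimes>\<^sub>M \<gamma>)" unfolding E'_def using m E(1) by (rule measurable_sets)
    moreover have "emeasure (\<gamma> \<Otimes>\<^sub>M \<gamma>) E' = emeasure (\<gamma> \<Otimes>\<^sub>M \<gamma>) E"
    proof -
      have "(\<lambda>s. (snd s, fst s)) = (\<lambda>(x :: nat \<Rightarrow> 'a \<times> 'a, y :: nat \<Rightarrow> 'a \<times> 'a). (y, x))" by auto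
      then have "\<gamma> \<Otimes>\<^sub>M \<gamma> = distr (\<gamma> \<Otimes>\<^sub>M \<gamma>) (\<gamma> \<Otimes>\<^sub>M \<gamma>) (\<lambda>s. (snd s, fst s))"
        using distr_pair_swap by (simp only:)
      then have "emeasure (\<gamma> \<Otimes>\<^sub>M \<gamma>) E = emeasure (distr (\<gamma> \<Otimes>\<^sub>M \<gamma>) (\<gamma> \<Otimes>\<^sub>M \<gamma>) (\<lambda>s. (snd s, fst s))) E"
        by (rule arg_cong)
      then show ?thesis unfolding E'_def by (simp only: emeasure_distr[OF m E(1)])
    qed
    moreover have "{\<omega> \<in> space (\<gamma> \<Otimes>\<^sub>M \<gamma>). (plan_state N (fst \<omega>), plan_state N (snd \<omega>)) \<in> (\<lambda>s. (snd s, fst s)) -` S} \<subseteq> E'"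
      using E(3) by (auto simp: E'_def space_pair_measure)
    ultimately show ?thesis using E(2) unfolding pair_event_le_def by (intro bexI[of _ E'] conjI) simp_all
  qed
  then show "\<exists>e>0. \<forall>\<gamma>. approx_plan p N w \<mu> \<nu> e \<gamma> \<longrightarrow> pair_event_le \<gamma> \<beta> ((\<lambda>s. (snd s, fst s)) -` S)"
    using e(1) by blast
qed


text \<open>The competitor moves Z to the fixed point y on the event A and leaves everything else
  unchanged. It saves at least \<eta> on A, yet at most e in total, so A has probability at most e /
  \<eta>.\<close>

lemma null_of_improvement:
  assumes \<eta>: "0 < \<eta>"
  shows "asymptotically_null {s. bary_cost p {1..N} w (fst (fst s)) y + \<eta> < state_cost p N w (fst s)}"
proof (rule asymptotically_nullI[of "1 / \<eta>"])
  fix e \<gamma> assume e: "0 < (e::real)" and g: "approx_plan p N w \<mu> \<nu> e \<gamma>"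
  note D = approx_planD[OF g]
  interpret prob_space \<gamma> by (rule D)
  note [measurable] = D(2,3)
  let ?X = "\<lambda>\<omega>. fst (plan_state N \<omega>)" and ?Z = "\<lambda>\<omega>. snd (plan_state N \<omega>)"
  define c where "c \<omega> = bary_cost p {1..N} w (?X \<omega>) (?Z \<omega>)" for \<omega> :: "nat \<Rightarrow> 'a \<times> 'a"
  define cy where "cy \<omega> = bary_cost p {1..N} w (?X \<omega>) y" for \<omega> :: "nat \<Rightarrow> 'a \<times> 'a"
  have mc[measurable]: "c \<in> borel_measurable \<gamma>" "cy \<in> borel_measurable \<gamma>"
    unfolding c_def cy_def by measurable
  have nn: "0 \<le> c \<omega>" "0 \<le> cy \<omega>" for \<omega>
    unfolding c_def cy_def using w by (intro bary_cost_nonneg; auto intro: less_imp_le)+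
  define A where "A = {\<omega> \<in> space \<gamma>. cy \<omega> + \<eta> < c \<omega>}"
  have A[measurable]: "A \<in> sets \<gamma>" unfolding A_def by measurable
  define Y where "Y \<omega> = (if \<omega> \<in> A then y else ?Z \<omega>)" for \<omega>
  have [measurable]: "Y \<in> borel_measurable \<gamma>" unfolding Y_def by measurable
  have "ennreal (bary_value p N w \<mu> \<nu>) + ennreal \<eta> * emeasure \<gamma> A
      \<le> (\<integral>\<^sup>+\<omega>. ennreal (bary_cost p {1..N} w (?X \<omega>) (Y \<omega>)) \<partial>\<gamma>) + ennreal \<eta> * emeasure \<gamma> A"
    by (intro add_right_mono competitor D) measurable
  also have "\<dots> = (\<integral>\<^sup>+\<omega>. ennreal (bary_cost p {1..N} w (?X \<omega>) (Y \<omega>)) + ennreal \<eta> * indicator A \<omega> \<partial>\<gamma>)"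
    by (subst nn_integral_add) (auto simp: nn_integral_cmult_indicator)
  also have "\<dots> \<le> (\<integral>\<^sup>+\<omega>. ennreal (c \<omega>) \<partial>\<gamma>)"
  proof (intro nn_integral_mono)
    fix \<omega>
    show "ennreal (bary_cost p {1..N} w (?X \<omega>) (Y \<omega>)) + ennreal \<eta> * indicator A \<omega> \<le> ennreal (c \<omega>)"
    proof (cases "\<omega> \<in> A")
      case True
      then have "bary_cost p {1..N} w (?X \<omega>) (Y \<omega>) = cy \<omega>" "cy \<omega> + \<eta> \<le> c \<omega>"
        by (auto simp: Y_def A_def cy_def)
      then show ?thesis using True \<eta> nn[of \<omega>] by (simp add: ennreal_plus[symmetric] ennreal_leI del: ennreal_plus)
    next
      case False
      then show ?thesis by (simp add: Y_def c_def)
    qed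
  qed
  also have "\<dots> \<le> ennreal (bary_value p N w \<mu> \<nu> + e)" using D(6) by (simp add: c_def state_cost_def)
  also have "\<dots> = ennreal (bary_value p N w \<mu> \<nu>) + ennreal e" using bary_value_nonneg e by simp
  finally have "ennreal \<eta> * emeasure \<gamma> A \<le> ennreal e" by (simp add: ennreal_add_left_cancel_le)
  then have le: "emeasure \<gamma> A \<le> ennreal (1 / \<eta> * e)"
    using \<eta> e by (simp add: emeasure_eq_measure ennreal_mult[symmetric] pos_le_divide_eq mult.commute)
  interpret P: pair_prob_space \<gamma> \<gamma> ..
  show "pair_event_le \<gamma> (1 / \<eta> * e) {s. bary_cost p {1..N} w (fst (fst s)) y + \<eta> < state_cost p N w (fst s)}"
    unfolding pair_event_le_def
  proof (intro bexI[of _ "A \<times> space \<gamma>"] conjI)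
    show "emeasure (\<gamma> \<Otimes>\<^sub>M \<gamma>) (A \<times> space \<gamma>) \<le> ennreal (1 / \<eta> * e)"
      using le by (simp add: emeasure_pair_measure_Times emeasure_space_1)
    show "{\<omega> \<in> space (\<gamma> \<Otimes>\<^sub>M \<gamma>). (plan_state N (fst \<omega>), plan_state N (snd \<omega>))
        \<in> {s. bary_cost p {1..N} w (fst (fst s)) y + \<eta> < state_cost p N w (fst s)}} \<subseteq> A \<times> space \<gamma>"
      by (auto simp: A_def cy_def c_def state_cost_def space_pair_measure)
  qed simp
qed (use \<eta> in simp)

text \<open>Assigning u to one copy and v to the other would break the symmetry between the copies;
  the minimum over both restores it, and it only lowers the cost of the exchange.\<close>

definition swap_cost :: "'a \<Rightarrow> 'a \<Rightarrow> 'a state \<Rightarrow> 'a state \<Rightarrow> real" where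
  "swap_cost u v s s' = min (bary_cost p {1..N} w ((fst s)(1 := fst s' 1)) u)
     (bary_cost p {1..N} w ((fst s)(1 := fst s' 1)) v)"

text \<open>The event is symmetric in the two copies, so exchanging the first coordinates on it leaves
  the law of the first coordinate unchanged.\<close>

lemma null_of_swap:
  assumes \<eta>: "0 < \<eta>"
  shows "asymptotically_null {s. swap_cost u v (fst s) (snd s) + swap_cost u v (snd s) (fst s) + \<eta>
    < state_cost p N w (fst s) + state_cost p N w (snd s)}"
proof (rule asymptotically_nullI[of "2 / \<eta>"])
  fix e \<gamma> assume e: "0 < (e::real)" and g: "approx_plan p N w \<mu> \<nu> e \<gamma>"
  note D = approx_planD[OF g]
  interpret prob_space \<gamma> by (rule D)
  interpret P: pair_prob_space \<gamma> \<gamma> ..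
  note [measurable] = D(2,3)
  note X1 [measurable] = D(2)[OF one_in_index]
  let ?G = "\<gamma> \<Otimes>\<^sub>M \<gamma>"
  let ?S = "plan_state N"
  let ?X = "\<lambda>\<omega>. fst (plan_state N \<omega>)" and ?Z = "\<lambda>\<omega>. snd (plan_state N \<omega>)"
  have nonneg: "0 \<le> bary_cost p {1..N} w x z" for x :: "nat \<Rightarrow> 'a" and z
    using w by (intro bary_cost_nonneg) (auto intro: less_imp_le)
  define c where "c \<omega> = state_cost p N w (?S \<omega>)" for \<omega> :: "nat \<Rightarrow> 'a \<times> 'a"
  have mc[measurable]: "c \<in> borel_measurable \<gamma>"
    unfolding c_def state_cost_def by measurable
  define sx where "sx \<omega> = (?X (fst \<omega>))(1 := ?X (snd \<omega>) 1)"
    for \<omega> :: "(nat \<Rightarrow> 'a \<times> 'a) \<times> (nat \<Rightarrow> 'a \<times> 'a)"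
  have [measurable]: "(\<lambda>\<omega>. sx \<omega> i) \<in> borel_measurable ?G" if "i \<in> {1..N}" for i
    using D(2)[OF that] X1 by (cases "i = 1") (simp_all add: sx_def)
  have m1[measurable]: "(\<lambda>\<omega>. bary_cost p {1..N} w (sx \<omega>) y) \<in> borel_measurable ?G" for y
    by measurable
  define sc where "sc \<omega> = swap_cost u v (?S (fst \<omega>)) (?S (snd \<omega>))" for \<omega> :: "(nat \<Rightarrow> 'a \<times> 'a) \<times> (nat \<Rightarrow> 'a \<times> 'a)"
  have sc: "sc \<omega> = min (bary_cost p {1..N} w (sx \<omega>) u) (bary_cost p {1..N} w (sx \<omega>) v)" for \<omega>
    by (simp add: sc_def swap_cost_def sx_def)
  have [measurable]: "sc \<in> borel_measurable ?G" unfolding sc by measurable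
  have [measurable]: "(\<lambda>s. (snd s, fst s)) \<in> ?G \<rightarrow>\<^sub>M ?G" by measurable
  have [measurable]: "(\<lambda>\<omega>. sc (snd \<omega>, fst \<omega>)) \<in> borel_measurable ?G" by measurable
  define C where "C = {\<omega> \<in> space ?G. sc \<omega> + sc (snd \<omega>, fst \<omega>) + \<eta> < c (fst \<omega>) + c (snd \<omega>)}"
  have C[measurable]: "C \<in> sets ?G" unfolding C_def by measurable
  have Csym: "(snd \<omega>, fst \<omega>) \<in> C \<longleftrightarrow> \<omega> \<in> C" for \<omega>
    by (cases \<omega>) (auto simp: C_def space_pair_measure)
  define X' where "X' \<omega> i = (if \<omega> \<in> C then sx \<omega> i else ?X (fst \<omega>) i)" for \<omega> i
  \<comment> \<open>On C the cheaper of the two fixed points is taken: an explicit measurable choice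
    whose cost is \<open>sc\<close>.\<close>
  define Y where "Y \<omega> = (if \<omega> \<in> C then
      (if bary_cost p {1..N} w (sx \<omega>) u \<le> bary_cost p {1..N} w (sx \<omega>) v then u else v) else ?Z (fst \<omega>))" for \<omega>
  define T where "T \<omega> = (if \<omega> \<in> C then sc \<omega> else c (fst \<omega>))" for \<omega>
  have [measurable]: "(\<lambda>\<omega>. X' \<omega> i) \<in> borel_measurable ?G" if "i \<in> {1..N}" for i
    unfolding X'_def using that by measurable
  have [measurable]: "Y \<in> borel_measurable ?G" unfolding Y_def by measurable
  have [measurable]: "T \<in> borel_measurable ?G" unfolding T_def by measurable
  have T: "bary_cost p {1..N} w (X' \<omega>) (Y \<omega>) = T \<omega>" for \<omega>
  proof (cases "\<omega> \<in> C")
    case True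
    then have "X' \<omega> = sx \<omega>" by (simp add: X'_def fun_eq_iff)
    then show ?thesis using True by (auto simp: Y_def T_def sc min_def)
  next
    case False
    then have "X' \<omega> = ?X (fst \<omega>)" by (simp add: X'_def fun_eq_iff)
    then show ?thesis using False by (simp add: Y_def T_def c_def state_cost_def)
  qed
  have law: "distr ?G borel (\<lambda>\<omega>. X' \<omega> i) = \<mu> i" if i: "i \<in> {1..N}" for i
  proof (rule measure_eqI)
    show "sets (distr ?G borel (\<lambda>\<omega>. X' \<omega> i)) = sets (\<mu> i)"
      using \<mu>(1)[OF i] by (simp add: borel_prob_def)
    fix A assume "A \<in> sets (distr ?G borel (\<lambda>\<omega>. X' \<omega> i))"
    then have A[measurable]: "A \<in> sets borel" by simp
    note Xi[measurable] = D(2)[OF i]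
    define f :: "((nat \<Rightarrow> 'a \<times> 'a) \<times> (nat \<Rightarrow> 'a \<times> 'a)) \<Rightarrow> ennreal" where
      "f \<omega> = indicator C \<omega> * indicator A (?X (snd \<omega>) 1)" for \<omega>
    have [measurable]: "f \<in> borel_measurable ?G" unfolding f_def by measurable
    have "emeasure (distr ?G borel (\<lambda>\<omega>. X' \<omega> i)) A = (\<integral>\<^sup>+\<omega>. indicator A (X' \<omega> i) \<partial>?G)"
      using i by (subst nn_integral_indicator[symmetric], simp, subst nn_integral_distr) auto
    also have "\<dots> = (\<integral>\<^sup>+\<omega>. indicator A (?X (fst \<omega>) i) \<partial>?G)"
    proof (cases "i = 1")
      case False
      then have "X' \<omega> i = ?X (fst \<omega>) i" for \<omega> by (simp add: X'_def sx_def)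
      then show ?thesis by simp
    next
      case True
      have "(\<integral>\<^sup>+\<omega>. indicator A (X' \<omega> i) \<partial>?G)
          = (\<integral>\<^sup>+\<omega>. f \<omega> + indicator (space ?G - C) \<omega> * indicator A (?X (fst \<omega>) 1) \<partial>?G)"
        by (intro nn_integral_cong) (auto simp: True X'_def sx_def f_def indicator_def)
      also have "\<dots> = (\<integral>\<^sup>+\<omega>. f \<omega> \<partial>?G)
          + (\<integral>\<^sup>+\<omega>. indicator (space ?G - C) \<omega> * indicator A (?X (fst \<omega>) 1) \<partial>?G)"
        by (rule nn_integral_add) measurable
      also have "(\<integral>\<^sup>+\<omega>. f \<omega> \<partial>?G) = (\<integral>\<^sup>+\<omega>. f (snd \<omega>, fst \<omega>) \<partial>?G)"
        by (rule nn_integral_pair_swap[symmetric]) (unfold_locales, measurable)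
      also have "\<dots> = (\<integral>\<^sup>+\<omega>. indicator C \<omega> * indicator A (?X (fst \<omega>) 1) \<partial>?G)"
        by (simp add: f_def Csym indicator_def)
      also have "\<dots> + (\<integral>\<^sup>+\<omega>. indicator (space ?G - C) \<omega> * indicator A (?X (fst \<omega>) 1) \<partial>?G)
          = (\<integral>\<^sup>+\<omega>. indicator C \<omega> * indicator A (?X (fst \<omega>) 1)
              + indicator (space ?G - C) \<omega> * indicator A (?X (fst \<omega>) 1) \<partial>?G)"
        by (rule nn_integral_add[symmetric]) measurable
      also have "\<dots> = (\<integral>\<^sup>+\<omega>. indicator A (?X (fst \<omega>) i) \<partial>?G)"
        by (intro nn_integral_cong) (auto simp: True indicator_def)
      finally show ?thesis .
    qed
    also have "\<dots> = (\<integral>\<^sup>+\<omega>. indicator A (?X \<omega> i) \<partial>\<gamma>)"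
      by (rule nn_integral_pair_fst[of \<gamma> "\<lambda>\<omega>. indicator A (?X \<omega> i)"]) (rule prob_space_axioms, measurable)
    also have "\<dots> = emeasure (distr \<gamma> borel (\<lambda>\<omega>. ?X \<omega> i)) A"
      by (subst nn_integral_indicator[symmetric], simp, subst nn_integral_distr) auto
    finally show "emeasure (distr ?G borel (\<lambda>\<omega>. X' \<omega> i)) A = emeasure (\<mu> i) A"
      using D(4)[OF i] by simp
  qed
  let ?V = "bary_value p N w \<mu> \<nu>"
  have V: "ennreal ?V \<le> (\<integral>\<^sup>+\<omega>. ennreal (T \<omega>) \<partial>?G)"
    unfolding T[symmetric] by (rule competitor[OF P.prob_space_axioms _ law]) measurable
  have T': "(\<integral>\<^sup>+\<omega>. ennreal (T (snd \<omega>, fst \<omega>)) \<partial>?G) = (\<integral>\<^sup>+\<omega>. ennreal (T \<omega>) \<partial>?G)"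
    by (rule nn_integral_pair_swap[of \<gamma> "\<lambda>\<omega>. ennreal (T \<omega>)"]) (unfold_locales, measurable)
  have c1: "(\<integral>\<^sup>+\<omega>. ennreal (c (fst \<omega>)) \<partial>?G) = (\<integral>\<^sup>+\<omega>. ennreal (c \<omega>) \<partial>\<gamma>)"
    by (rule nn_integral_pair_fst[of \<gamma> "\<lambda>\<omega>. ennreal (c \<omega>)"]) (rule prob_space_axioms, measurable)
  have c2: "(\<integral>\<^sup>+\<omega>. ennreal (c (snd \<omega>)) \<partial>?G) = (\<integral>\<^sup>+\<omega>. ennreal (c \<omega>) \<partial>\<gamma>)"
    using nn_integral_pair_swap[of \<gamma> "\<lambda>\<omega>. ennreal (c (fst \<omega>))"] c1 sigma_finite_measure_axioms by simp
  have c0: "0 \<le> c \<omega>" for \<omega> unfolding c_def state_cost_def by (rule nonneg)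
  have sc0: "0 \<le> sc \<omega>" for \<omega> unfolding sc using nonneg by simp
  have T0: "0 \<le> T \<omega>" for \<omega> using c0 sc0 by (simp add: T_def)
  \<comment> \<open>T and its version with the copies exchanged have the same integral, at least V
    each. Pointwise their sum is at most the cost of both copies, minus \<eta> on C, and the two
    copies together exceed 2 V by at most 2 e: hence the constant 2 / \<eta>.\<close>
  have "ennreal ?V + ennreal ?V + ennreal \<eta> * emeasure ?G C
      \<le> (\<integral>\<^sup>+\<omega>. ennreal (T \<omega>) \<partial>?G) + (\<integral>\<^sup>+\<omega>. ennreal (T (snd \<omega>, fst \<omega>)) \<partial>?G) + ennreal \<eta> * emeasure ?G C"
    unfolding T' by (intro add_mono V order_refl)
  also have "\<dots> = (\<integral>\<^sup>+\<omega>. ennreal (T \<omega>) + ennreal (T (snd \<omega>, fst \<omega>)) + ennreal \<eta> * indicator C \<omega> \<partial>?G)"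
    by (simp add: nn_integral_add nn_integral_cmult_indicator)
  also have "\<dots> \<le> (\<integral>\<^sup>+\<omega>. ennreal (c (fst \<omega>)) + ennreal (c (snd \<omega>)) \<partial>?G)"
  proof (intro nn_integral_mono)
    fix \<omega>
    have "T \<omega> + T (snd \<omega>, fst \<omega>) + \<eta> * indicator C \<omega> \<le> c (fst \<omega>) + c (snd \<omega>)"
    proof (cases "\<omega> \<in> C")
      case True
      then have "sc \<omega> + sc (snd \<omega>, fst \<omega>) + \<eta> \<le> c (fst \<omega>) + c (snd \<omega>)" by (auto simp: C_def)
      then show ?thesis using True Csym by (simp add: T_def)
    next
      case False
      then show ?thesis using Csym by (simp add: T_def)
    qed
    then have "ennreal (T \<omega> + T (snd \<omega>, fst \<omega>) + \<eta> * indicator C \<omega>) \<le> ennreal (c (fst \<omega>) + c (snd \<omega>))"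
      by (rule ennreal_leI)
    then show "ennreal (T \<omega>) + ennreal (T (snd \<omega>, fst \<omega>)) + ennreal \<eta> * indicator C \<omega> \<le> ennreal (c (fst \<omega>)) + ennreal (c (snd \<omega>))"
      using T0 c0 \<eta> by (cases "\<omega> \<in> C") simp_all
  qed
  also have "\<dots> = (\<integral>\<^sup>+\<omega>. ennreal (c \<omega>) \<partial>\<gamma>) + (\<integral>\<^sup>+\<omega>. ennreal (c \<omega>) \<partial>\<gamma>)"
    by (subst nn_integral_add) (simp_all add: c1 c2)
  also have "\<dots> \<le> ennreal (?V + e) + ennreal (?V + e)" unfolding c_def by (intro add_mono D(6))
  also have "\<dots> = ennreal ?V + ennreal ?V + ennreal (2 * e)"
    using bary_value_nonneg e by (simp add: ennreal_plus[symmetric] del: ennreal_plus)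
  finally have "ennreal \<eta> * emeasure ?G C \<le> ennreal (2 * e)"
    by (simp add: ennreal_add_left_cancel_le)
  then have le: "emeasure ?G C \<le> ennreal (2 / \<eta> * e)"
    using \<eta> e by (simp add: P.emeasure_eq_measure ennreal_mult[symmetric] pos_le_divide_eq mult.commute)
  show "pair_event_le \<gamma> (2 / \<eta> * e) {s. swap_cost u v (fst s) (snd s) + swap_cost u v (snd s) (fst s) + \<eta>
    < state_cost p N w (fst s) + state_cost p N w (snd s)}"
    unfolding pair_event_le_def
    by (intro bexI[of _ C] conjI le C) (auto simp: C_def sc_def c_def)
qed (use \<eta> in simp)

end

section \<open>Compactness: violations of the Lipschitz estimate are asymptotically null\<close>

lemma continuous_on_bary_cost_compose:
  fixes F :: "'b::topological_space \<Rightarrow> nat \<Rightarrow> 'a::euclidean_space"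
  assumes "0 < p" "\<And>i. i \<in> I \<Longrightarrow> continuous_on UNIV (\<lambda>s. F s i)" "continuous_on UNIV G"
  shows "continuous_on UNIV (\<lambda>s. bary_cost p I w (F s) (G s))"
  unfolding bary_cost_def using assms by (intro continuous_intros continuous_on_powr') auto

text \<open>Coordinates outside I are pinned to \<open>undefined\<close>, so the set is a product of
  compact sets over all indices and Tychonoff's theorem applies.\<close>

lemma compact_PiE:
  fixes S :: "nat \<Rightarrow> 'a::topological_space set"
  assumes "\<And>i. i \<in> I \<Longrightarrow> compact (S i)"
  shows "compact (PiE I S)"
proof -
  have "PiE I S = PiE UNIV (\<lambda>i. if i \<in> I then S i else {undefined})"
    by (auto simp: PiE_iff extensional_def split: if_splits)
  moreover have "compactin (product_topology (\<lambda>i. euclidean) UNIV) (PiE UNIV (\<lambda>i. if i \<in> I then S i else {undefined}))"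
    using assms by (auto simp: compactin_PiE)
  ultimately show ?thesis by (simp add: euclidean_product_topology)
qed

context barycenter_setting
begin

lemma compact_spt: "i \<in> {1..N} \<Longrightarrow> compact (spt (\<mu> i))"
  using \<mu>(2)[of i] closed_spt[of "\<mu> i"] by (meson bounded_cball bounded_subset compact_eq_bounded_closed)

text \<open>The weak inequality with slack \<delta> and the closed ball for the barycenters make
  this set compact.\<close>

definition lipschitz_violation :: "real \<Rightarrow> real \<Rightarrow> real \<Rightarrow> ('a state \<times> 'a state) set" where
  "lipschitz_violation L R \<delta> = {s \<in> (spt_tuples \<times> cball 0 R) \<times> (spt_tuples \<times> cball 0 R).
     L * norm (snd (fst s) - snd (snd s)) + \<delta> \<le> norm (fst (fst s) 1 - fst (snd s) 1)}"

text \<open>A violating pair is not stable, so it is beaten strictly either by moving one barycenter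
  to some y or by an exchange with some u and v. With \<eta> half of the gain, the same competitor
  still wins by more than \<eta> on an open neighbourhood, which is asymptotically null by one of
  the two preceding lemmas.\<close>

lemma null_of_lipschitz_violation:
  assumes lip: "lipschitz_on_stable_pairs L"
    and \<delta>: "0 < \<delta>"
  shows "asymptotically_null (lipschitz_violation L R \<delta>)"
proof (rule asymptotically_null_compact)
  have coord: "continuous_on UNIV (\<lambda>s::('a state \<times> 'a state). fst (fst s) i)"
      "continuous_on UNIV (\<lambda>s::('a state \<times> 'a state). fst (snd s) i)" for i
    by (rule continuous_on_product_then_coordinatewise; intro continuous_intros)+
  have p0: "0 < p" using p by simp
  have cost: "continuous_on UNIV (\<lambda>s::('a state \<times> 'a state). state_cost p N w (fst s))"
    "continuous_on UNIV (\<lambda>s::('a state \<times> 'a state). state_cost p N w (snd s))"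
    "continuous_on UNIV (\<lambda>s::('a state \<times> 'a state). bary_cost p {1..N} w (fst (fst s)) y)" for y
    unfolding state_cost_def by (intro continuous_on_bary_cost_compose p0 coord continuous_intros)+
  have swp: "continuous_on UNIV (\<lambda>s::('a state \<times> 'a state). swap_cost u v (fst s) (snd s))"
    "continuous_on UNIV (\<lambda>s::('a state \<times> 'a state). swap_cost u v (snd s) (fst s))" for u v
  proof -
    have cc: "continuous_on UNIV (\<lambda>s::('a state \<times> 'a state). ((fst (fst s))(1 := fst (snd s) 1)) i)"
      "continuous_on UNIV (\<lambda>s::('a state \<times> 'a state). ((fst (snd s))(1 := fst (fst s) 1)) i)" for i
      using coord by (cases "i = 1"; simp)+
    show "continuous_on UNIV (\<lambda>s::('a state \<times> 'a state). swap_cost u v (fst s) (snd s))"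
      "continuous_on UNIV (\<lambda>s::('a state \<times> 'a state). swap_cost u v (snd s) (fst s))"
      unfolding swap_cost_def by (intro continuous_on_min continuous_on_bary_cost_compose p0 continuous_on_const cc)+
  qed
  have cl: "closed {s::('a state \<times> 'a state).
      L * norm (snd (fst s) - snd (snd s)) + \<delta> \<le> norm (fst (fst s) 1 - fst (snd s) 1)}"
    by (intro closed_Collect_le continuous_intros coord)
  have "compact ((spt_tuples \<times> cball (0::'a) R) \<times> (spt_tuples \<times> cball (0::'a) R))"
    by (intro compact_Times compact_PiE compact_spt compact_cball)
  from compact_Int_closed[OF this cl] show "compact (lipschitz_violation L R \<delta>)"
    unfolding lipschitz_violation_def Collect_conj_eq Collect_mem_eq .
  fix s assume s: "s \<in> lipschitz_violation L R \<delta>"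
  define x z x' z' where xz: "x = fst (fst s)" "z = snd (fst s)" "x' = fst (snd s)" "z' = snd (snd s)"
  have mem: "x \<in> spt_tuples" "x' \<in> spt_tuples"
    and viol: "L * norm (z - z') + \<delta> \<le> norm (x 1 - x' 1)"
    using s unfolding lipschitz_violation_def xz by auto
  have "\<not> (\<forall>y. bary_cost p {1..N} w x z \<le> bary_cost p {1..N} w x y) \<or>
      \<not> (\<forall>y. bary_cost p {1..N} w x' z' \<le> bary_cost p {1..N} w x' y) \<or> \<not> swap_stable p N w x z x' z'"
  proof (rule ccontr)
    assume "\<not> ?thesis"
    then have "stable_pair p N w r x z x' z'"
      using N w w1 norm_spt_le[OF mem(1)] norm_spt_le[OF mem(2)] unfolding stable_pair_def by blast
    with lip mem have "norm (x 1 - x' 1) \<le> L * norm (z - z')"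
      unfolding lipschitz_on_stable_pairs_def by blast
    then show False using viol \<delta> by linarith
  qed
  then consider
    (a) y where "bary_cost p {1..N} w x y < bary_cost p {1..N} w x z"
    | (b) y where "bary_cost p {1..N} w x' y < bary_cost p {1..N} w x' z'"
    | (c) u v where "bary_cost p {1..N} w (x(1 := x' 1)) u + bary_cost p {1..N} w (x'(1 := x 1)) v
        < bary_cost p {1..N} w x z + bary_cost p {1..N} w x' z'"
    unfolding swap_stable_def by (auto simp: not_le)
  then show "\<exists>U. open U \<and> s \<in> U \<and> asymptotically_null U"
  proof cases
    case a
    define \<eta> where "\<eta> = (bary_cost p {1..N} w x z - bary_cost p {1..N} w x y) / 2"
    define U :: "('a state \<times> 'a state) set" where "U = {s. bary_cost p {1..N} w (fst (fst s)) y + \<eta> < state_cost p N w (fst s)}"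
    have "asymptotically_null U" unfolding U_def using a by (intro null_of_improvement) (simp add: \<eta>_def)
    moreover have "open U" unfolding U_def by (intro open_Collect_less continuous_intros cost)
    moreover have "s \<in> U" using a by (simp add: U_def \<eta>_def state_cost_def field_simps flip: xz)
    ultimately show ?thesis by blast
  next
    case b
    define \<eta> where "\<eta> = (bary_cost p {1..N} w x' z' - bary_cost p {1..N} w x' y) / 2"
    define U :: "('a state \<times> 'a state) set" where "U = {s. bary_cost p {1..N} w (fst (fst s)) y + \<eta> < state_cost p N w (fst s)}"
    have "asymptotically_null U" unfolding U_def using b by (intro null_of_improvement) (simp add: \<eta>_def)
    then have "asymptotically_null ((\<lambda>s. (snd s, fst s)) -` U)" by (rule asymptotically_null_swap)
    moreover have "open U" unfolding U_def by (intro open_Collect_less continuous_intros cost)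
    then have "open ((\<lambda>s. (snd s, fst s)) -` U)" by (rule open_vimage) (intro continuous_intros)
    moreover have "s \<in> (\<lambda>s. (snd s, fst s)) -` U" using b by (simp add: U_def \<eta>_def state_cost_def field_simps flip: xz)
    ultimately show ?thesis by blast
  next
    case c
    define \<eta> where "\<eta> = (bary_cost p {1..N} w x z + bary_cost p {1..N} w x' z'
      - (bary_cost p {1..N} w (x(1 := x' 1)) u + bary_cost p {1..N} w (x'(1 := x 1)) v)) / 2"
    define U :: "('a state \<times> 'a state) set" where "U = {s. swap_cost u v (fst s) (snd s) + swap_cost u v (snd s) (fst s) + \<eta>
      < state_cost p N w (fst s) + state_cost p N w (snd s)}"
    have \<eta>: "0 < \<eta>" using c by (simp add: \<eta>_def)
    then have "asymptotically_null U" unfolding U_def by (rule null_of_swap)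
    moreover have "open U" unfolding U_def by (intro open_Collect_less continuous_intros cost swp)
    moreover have "swap_cost u v (fst s) (snd s) \<le> bary_cost p {1..N} w (x(1 := x' 1)) u"
      "swap_cost u v (snd s) (fst s) \<le> bary_cost p {1..N} w (x'(1 := x 1)) v"
      unfolding swap_cost_def xz by auto
    then have "swap_cost u v (fst s) (snd s) + swap_cost u v (snd s) (fst s) + \<eta>
        < state_cost p N w (fst s) + state_cost p N w (snd s)"
    proof -
      have half: "a + b + (X + Y - (P + Q)) / 2 < X + Y" if "a \<le> P" "b \<le> Q" "P + Q < X + Y" for a b X Y P Q :: real
        using that by (simp add: field_simps)
      assume "swap_cost u v (fst s) (snd s) \<le> bary_cost p {1..N} w (x(1 := x' 1)) u"
        "swap_cost u v (snd s) (fst s) \<le> bary_cost p {1..N} w (x'(1 := x 1)) v"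
      from half[OF this c] show ?thesis unfolding \<eta>_def state_cost_def xz[symmetric] .
    qed
    then have "s \<in> U" by (simp add: U_def)
    ultimately show ?thesis by blast
  qed
qed

end

subsection \<open>Mass of small balls\<close>

lemma emeasure_lborel_ball:
  fixes c :: "'a::euclidean_space"
  assumes "0 \<le> r"
  shows "emeasure lborel (ball c r) = ennreal (r ^ DIM('a) * measure lborel (ball (0::'a) 1))"
  using content_ball_conv_unit_ball[OF assms, of c] emeasure_lborel_ball_finite[of c r]
  by (simp add: emeasure_eq_ennreal_measure)

lemma conjugate_exponent:
  fixes q q' :: real
  assumes "1 < q" "1 / q + 1 / q' = 1"
  shows "1 / q' = (q - 1) / q" "q' = q / (q - 1)" "1 < q'"
proof -
  show *: "1 / q' = (q - 1) / q" using assms by (simp add: field_simps)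
  have "q' = 1 / (1 / q')" by simp
  also have "\<dots> = q / (q - 1)" unfolding * by simp
  finally show **: "q' = q / (q - 1)" .
  show "1 < q'" unfolding ** using assms by (simp add: field_simps)
qed

text \<open>Young's inequality for t f^(-1/q') times f^(1/q'). The splitting is made for integration
  against f dx: the first term becomes a multiple of Lebesgue measure, the second f^q / q.\<close>

lemma Young_density:
  fixes f q q' t :: real
  assumes "1 < q" "1 / q + 1 / q' = 1" "0 < f" "0 \<le> t"
  shows "t \<le> t powr q' / q' * (1 / f) + 1 / q * f powr (q - 1)"
proof -
  note q = conjugate_exponent(1)[OF assms(1,2)] and q1 = conjugate_exponent(3)[OF assms(1,2)]
  have "(t * f powr - (1 / q')) * f powr (1 / q') \<le> (t * f powr - (1 / q')) powr q' / q' + (f powr (1 / q')) powr q / q"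
    using assms q1 by (intro Youngs_inequality) auto
  moreover have "(t * f powr - (1 / q')) * f powr (1 / q') = t"
    using assms by (simp add: powr_minus)
  moreover have "(t * f powr - (1 / q')) powr q' = t powr q' * (1 / f)"
  proof -
    have "(f powr - (1 / q')) powr q' = 1 / f"
      unfolding powr_powr using assms q1 by (simp add: powr_minus_divide)
    then show ?thesis using assms by (simp add: powr_mult)
  qed
  moreover have "(f powr (1 / q')) powr q = f powr (q - 1)"
    using assms q by (simp add: powr_powr)
  ultimately have "t \<le> (t powr q' * (1 / f)) / q' + f powr (q - 1) / q" by (simp only:)
  then show ?thesis by (simp add: mult.commute)
qed

context barycenter_setting
begin

text \<open>If the event A that Z lies in the ball has probability above \<beta>, Fubini and the
  bound \<beta>^2 on the exceptional set E give a state a in A whose slice of E has probability at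
  most \<beta>. For states in A outside that slice, the first points are within 2 L s + L s = 3 L s
  of that of a. On the remaining event \<open>Young_density\<close> is integrated.\<close>

lemma ball_mass_estimate:
  assumes q: "1 < q" "1 / q + 1 / q' = 1"
    and f: "has_lebesgue_density (\<mu> 1) f"
    and g: "approx_plan p N w \<mu> \<nu> e \<gamma>" and \<beta>: "0 < \<beta>"
    and ev: "pair_event_le \<gamma> (\<beta> * \<beta>) (lipschitz_violation L R (L * s))"
    and L: "0 < L" and s: "0 < s" and B: "ball c s \<subseteq> cball 0 R" and t: "0 \<le> t"
  shows "ennreal t * emeasure \<nu> (ball c s) \<le> ennreal (t powr q' / q') * emeasure lborel (ball (0::'a) (3 * L * s))
    + ennreal (1 / q) * (\<integral>\<^sup>+\<omega>. indicator (ball c s) (snd (plan_state N \<omega>)) * ennreal (f (fst (plan_state N \<omega>) 1) powr (q - 1)) \<partial>\<gamma>)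
    + ennreal t * ennreal \<beta>"
proof -
  note D = approx_planD[OF g]
  interpret prob_space \<gamma> by (rule D)
  interpret P: pair_prob_space \<gamma> \<gamma> ..
  note [measurable] = D(2,3)
  note X1 [measurable] = D(2)[OF one_in_index]
  let ?X = "\<lambda>\<omega>. fst (plan_state N \<omega>)" and ?Z = "\<lambda>\<omega>. snd (plan_state N \<omega>)"
  have bm[measurable]: "ball a r \<in> sets borel" for a :: 'a and r by simp
  have fm[measurable]: "f \<in> borel_measurable borel" and f0: "AE x in lborel. 0 \<le> f x"
    and fd: "\<mu> 1 = density lborel (\<lambda>x. ennreal (f x))"
    using f by (auto simp: has_lebesgue_density_def)
  obtain E where E[measurable]: "E \<in> sets (\<gamma> \<Otimes>\<^sub>M \<gamma>)" and Eb: "emeasure (\<gamma> \<Otimes>\<^sub>M \<gamma>) E \<le> ennreal (\<beta> * \<beta>)"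
    and Es: "{\<omega> \<in> space (\<gamma> \<Otimes>\<^sub>M \<gamma>). (plan_state N (fst \<omega>), plan_state N (snd \<omega>)) \<in> lipschitz_violation L R (L * s)} \<subseteq> E"
    using ev unfolding pair_event_le_def by (elim bexE conjE)
  define A where "A = {\<omega> \<in> space \<gamma>. ?Z \<omega> \<in> ball c s}"
  have A[measurable]: "A \<in> sets \<gamma>"
    using measurable_sets[OF D(3), of "ball c s"] by (simp add: A_def vimage_def Int_def conj_commute)
  have Ab[measurable]: "{\<omega> \<in> A. ?X \<omega> 1 \<in> ball a r} \<in> sets \<gamma>" for a r
  proof -
    have "{\<omega> \<in> A. ?X \<omega> 1 \<in> ball a r} = A \<inter> ((\<lambda>\<omega>. ?X \<omega> 1) -` ball a r \<inter> space \<gamma>)"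
      by (auto simp: A_def)
    then show ?thesis using measurable_sets[OF X1, of "ball a r"] A by simp
  qed
  have nuA: "emeasure \<nu> (ball c s) = emeasure \<gamma> A"
    unfolding D(5)[symmetric] A_def by (subst emeasure_distr) (auto intro!: arg_cong2[where f = emeasure])
  have good: "AE \<omega> in \<gamma>. ?X \<omega> \<in> spt_tuples"
  proof -
    have "AE \<omega> in \<gamma>. ?X \<omega> i \<in> spt (\<mu> i)" if i: "i \<in> {1..N}" for i
      using AE_distrD[OF D(2)[OF i]] AE_spt_index[OF i] unfolding D(4)[OF i] by blast
    then have "AE \<omega> in \<gamma>. \<forall>i\<in>{1..N}. ?X \<omega> i \<in> spt (\<mu> i)" by (intro AE_finite_allI) auto
    then show ?thesis by eventually_elim (auto simp: plan_state_def)
  qed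
  have "\<exists>a. emeasure \<gamma> A \<le> ennreal \<beta> + emeasure \<gamma> {\<omega> \<in> A. ?X \<omega> 1 \<in> ball a (3 * L * s)}"
  proof (cases "emeasure \<gamma> A \<le> ennreal \<beta>")
    case True
    then show ?thesis by (simp add: add_increasing2)
  next
    case False
    then have big: "ennreal \<beta> < emeasure \<gamma> A" by simp
    \<comment> \<open>Otherwise almost all slices over A exceed \<beta>, and E would have measure at
      least \<beta> times that of A, which is more than \<beta>^2.\<close>
    have "\<exists>\<omega>\<in>A. ?X \<omega> \<in> spt_tuples \<and> emeasure \<gamma> (Pair \<omega> -` E) \<le> ennreal \<beta>"
    proof (rule ccontr)
      assume n: "\<not> ?thesis"
      have "ennreal \<beta> * ennreal \<beta> < ennreal \<beta> * emeasure \<gamma> A"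
        using big \<beta> by (intro ennreal_mult_strict_left_mono) auto
      also have "\<dots> = (\<integral>\<^sup>+\<omega>. ennreal \<beta> * indicator A \<omega> \<partial>\<gamma>)"
        by (simp add: nn_integral_cmult_indicator)
      also have "\<dots> \<le> (\<integral>\<^sup>+\<omega>. emeasure \<gamma> (Pair \<omega> -` E) \<partial>\<gamma>)"
        by (rule nn_integral_mono_AE, use good in eventually_elim) (use n in \<open>auto simp: indicator_def not_le intro: less_imp_le\<close>)
      also have "\<dots> = emeasure (\<gamma> \<Otimes>\<^sub>M \<gamma>) E" by (rule emeasure_pair_measure_alt[symmetric]) simp
      finally show False using Eb \<beta> by (simp add: ennreal_mult)
    qed
    then obtain a where a: "a \<in> A" "?X a \<in> spt_tuples" "emeasure \<gamma> (Pair a -` E) \<le> ennreal \<beta>" by blast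
    have "?X \<omega> 1 \<in> ball (?X a 1) (3 * L * s)"
      if w': "\<omega> \<in> A" "?X \<omega> \<in> spt_tuples" "(a, \<omega>) \<notin> E" for \<omega>
    proof -
      have "(plan_state N a, plan_state N \<omega>) \<notin> lipschitz_violation L R (L * s)"
        using Es w' a(1) by (auto simp: A_def space_pair_measure)
      moreover have "?Z a \<in> cball 0 R" "?Z \<omega> \<in> cball 0 R" using w'(1) a(1) B by (auto simp: A_def)
      ultimately have "norm (?X a 1 - ?X \<omega> 1) < L * norm (?Z a - ?Z \<omega>) + L * s"
        using w'(2) a(2) by (cases "plan_state N a"; cases "plan_state N \<omega>") (auto simp: lipschitz_violation_def not_le)
      also have "norm (?Z a - ?Z \<omega>) \<le> 2 * s"
        using w'(1) a(1) norm_triangle_ineq[of "?Z a - c" "c - ?Z \<omega>"] by (auto simp: A_def dist_norm norm_minus_commute)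
      then have "L * norm (?Z a - ?Z \<omega>) + L * s \<le> 3 * L * s" using L mult_left_mono[of _ "2 * s" L] by fastforce
      finally show ?thesis by (simp add: dist_norm)
    qed
    then have "AE \<omega> in \<gamma>. \<omega> \<in> A \<longrightarrow> \<omega> \<in> (Pair a -` E) \<union> {\<omega> \<in> A. ?X \<omega> 1 \<in> ball (?X a 1) (3 * L * s)}"
      using good by (auto elim!: eventually_mono)
    then have "emeasure \<gamma> A \<le> emeasure \<gamma> ((Pair a -` E) \<union> {\<omega> \<in> A. ?X \<omega> 1 \<in> ball (?X a 1) (3 * L * s)})"
      using Ab sets_Pair1[OF E] by (intro emeasure_mono_AE) auto
    also have "\<dots> \<le> emeasure \<gamma> (Pair a -` E) + emeasure \<gamma> {\<omega> \<in> A. ?X \<omega> 1 \<in> ball (?X a 1) (3 * L * s)}"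
      by (rule emeasure_subadditive[OF sets_Pair1[OF E] Ab])
    also have "\<dots> \<le> ennreal \<beta> + emeasure \<gamma> {\<omega> \<in> A. ?X \<omega> 1 \<in> ball (?X a 1) (3 * L * s)}"
      using a(3) by (rule add_right_mono)
    finally show ?thesis by blast
  qed
  then obtain a where a: "emeasure \<gamma> A \<le> ennreal \<beta> + emeasure \<gamma> {\<omega> \<in> A. ?X \<omega> 1 \<in> ball a (3 * L * s)}"
    by blast
  have fpos: "AE \<omega> in \<gamma>. 0 < f (?X \<omega> 1)"
  proof -
    have "AE x in \<mu> 1. 0 < f x" unfolding fd by (subst AE_density) auto
    then show ?thesis using AE_distrD[OF X1] unfolding D(4)[OF one_in_index] by blast
  qed
  let ?ball = "ball a (3 * L * s)"
  have "ennreal t * emeasure \<gamma> {\<omega> \<in> A. ?X \<omega> 1 \<in> ?ball}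
      = (\<integral>\<^sup>+\<omega>. ennreal t * (indicator ?ball (?X \<omega> 1) * indicator (ball c s) (?Z \<omega>)) \<partial>\<gamma>)"
    unfolding nn_integral_cmult_indicator[OF Ab, symmetric]
    by (intro nn_integral_cong) (auto simp: A_def indicator_def)
  also have "\<dots> \<le> (\<integral>\<^sup>+\<omega>. ennreal (t powr q' / q') * (indicator ?ball (?X \<omega> 1) * ennreal (1 / f (?X \<omega> 1)))
      + ennreal (1 / q) * (indicator (ball c s) (?Z \<omega>) * ennreal (f (?X \<omega> 1) powr (q - 1))) \<partial>\<gamma>)"
  proof (rule nn_integral_mono_AE, use fpos in eventually_elim)
    case (elim \<omega>)
    have q'0: "0 < q'" using conjugate_exponent(3)[OF q] by simp
    have "ennreal t \<le> ennreal (t powr q' / q' * (1 / f (?X \<omega> 1)) + 1 / q * f (?X \<omega> 1) powr (q - 1))"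
      using Young_density[OF q elim t] by (rule ennreal_leI)
    also have "\<dots> = ennreal (t powr q' / q') * ennreal (1 / f (?X \<omega> 1)) + ennreal (1 / q) * ennreal (f (?X \<omega> 1) powr (q - 1))"
      using elim q q'0 by (simp add: ennreal_mult[symmetric] ennreal_plus[symmetric] del: ennreal_plus)
    finally show ?case by (auto simp: indicator_def)
  qed
  also have "\<dots> = ennreal (t powr q' / q') * (\<integral>\<^sup>+\<omega>. indicator ?ball (?X \<omega> 1) * ennreal (1 / f (?X \<omega> 1)) \<partial>\<gamma>)
      + ennreal (1 / q) * (\<integral>\<^sup>+\<omega>. indicator (ball c s) (?Z \<omega>) * ennreal (f (?X \<omega> 1) powr (q - 1)) \<partial>\<gamma>)"
  proof -
    have m1: "(\<lambda>\<omega>. indicator ?ball (?X \<omega> 1) * ennreal (1 / f (?X \<omega> 1))) \<in> borel_measurable \<gamma>"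
      by (rule measurable_compose[OF X1]) measurable
    have "(\<lambda>\<omega>. indicator (ball c s) (?Z \<omega>) :: ennreal) \<in> borel_measurable \<gamma>"
      by (rule measurable_compose[OF D(3)]) measurable
    moreover have "(\<lambda>\<omega>. ennreal (f (?X \<omega> 1) powr (q - 1))) \<in> borel_measurable \<gamma>"
      by (rule measurable_compose[OF X1]) measurable
    ultimately have m2: "(\<lambda>\<omega>. indicator (ball c s) (?Z \<omega>) * ennreal (f (?X \<omega> 1) powr (q - 1))) \<in> borel_measurable \<gamma>"
      by measurable
    show ?thesis
      unfolding nn_integral_cmult[OF m1, symmetric] nn_integral_cmult[OF m2, symmetric]
      using m1 m2 by (intro nn_integral_add) measurable
  qed
  also have "(\<integral>\<^sup>+\<omega>. indicator ?ball (?X \<omega> 1) * ennreal (1 / f (?X \<omega> 1)) \<partial>\<gamma>)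
      = (\<integral>\<^sup>+x. indicator ?ball x * ennreal (1 / f x) \<partial>\<mu> 1)"
    unfolding D(4)[OF one_in_index, symmetric] by (rule nn_integral_distr[OF X1, symmetric]) measurable
  also have "\<dots> = (\<integral>\<^sup>+x. ennreal (f x) * (indicator ?ball x * ennreal (1 / f x)) \<partial>lborel)"
    unfolding fd by (subst nn_integral_density) auto
  \<comment> \<open>Where f vanishes the quotient is 0 by convention and the product with f is 0
    instead of 1, hence an inequality.\<close>
  also have "\<dots> \<le> (\<integral>\<^sup>+x. indicator ?ball x \<partial>lborel)"
  proof (rule nn_integral_mono_AE, use f0 in eventually_elim)
    case (elim x)
    then show ?case by (cases "f x = 0") (auto simp: indicator_def ennreal_mult[symmetric])
  qed
  also have "\<dots> = emeasure lborel (ball (0::'a) (3 * L * s))"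
    using L s by (simp add: emeasure_lborel_ball)
  finally have young: "ennreal t * emeasure \<gamma> {\<omega> \<in> A. ?X \<omega> 1 \<in> ?ball}
      \<le> ennreal (t powr q' / q') * emeasure lborel (ball (0::'a) (3 * L * s))
      + ennreal (1 / q) * (\<integral>\<^sup>+\<omega>. indicator (ball c s) (?Z \<omega>) * ennreal (f (?X \<omega> 1) powr (q - 1)) \<partial>\<gamma>)"
    by (simp add: add_right_mono mult_left_mono)
  have "ennreal t * emeasure \<nu> (ball c s) \<le> ennreal t * (ennreal \<beta> + emeasure \<gamma> {\<omega> \<in> A. ?X \<omega> 1 \<in> ?ball})"
    unfolding nuA using a by (rule mult_left_mono) simp
  also have "\<dots> = ennreal t * emeasure \<gamma> {\<omega> \<in> A. ?X \<omega> 1 \<in> ?ball} + ennreal t * ennreal \<beta>"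
    by (simp add: distrib_left add.commute)
  also have "\<dots> \<le> (ennreal (t powr q' / q') * emeasure lborel (ball (0::'a) (3 * L * s))
      + ennreal (1 / q) * (\<integral>\<^sup>+\<omega>. indicator (ball c s) (?Z \<omega>) * ennreal (f (?X \<omega> 1) powr (q - 1)) \<partial>\<gamma>)) + ennreal t * ennreal \<beta>"
    using young by (rule add_right_mono)
  finally show ?thesis .
qed


lemma barycenter_Prob_p: "\<nu> \<in> Prob_p p"
  using bary by (simp add: is_wasserstein_barycenter_def is_arg_min_linorder)

lemma plan_exists: "0 < e \<Longrightarrow> \<exists>\<gamma>. approx_plan p N w \<mu> \<nu> e \<gamma>"
  by (rule approx_plan_exists[where r = r]) (use p N w w1 \<mu> AE_norm_le barycenter_Prob_p in auto)

text \<open>The ball estimate is integrated over all centres c, with the Young parameter t = \<phi>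
  c varying with the ball; averaging over translates takes the place of a covering argument. By
  Fubini the term in f becomes the volume of a ball of radius s times the integral of f^(q-1) under
  \<mu> 1, that is, of f^q. The plan no longer appears in the result, so e can be arbitrary.\<close>

lemma averaged_mass_estimate:
  assumes q: "1 < q" "1 / q + 1 / q' = 1"
    and f: "has_lebesgue_density (\<mu> 1) f"
    and null: "\<And>R \<delta>. 0 < \<delta> \<Longrightarrow> asymptotically_null (lipschitz_violation L R \<delta>)"
    and L: "0 < L" and s: "0 < s"
    and \<phi>: "\<phi> \<in> borel_measurable borel" "\<And>x. 0 \<le> \<phi> x" "\<And>x. R < norm x \<Longrightarrow> \<phi> x = 0"
    and fin: "(\<integral>\<^sup>+c. ennreal (\<phi> c) \<partial>lborel) < \<infinity>"
  shows "(\<integral>\<^sup>+c. ennreal (\<phi> c) * emeasure \<nu> (ball c s) \<partial>lborel)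
    \<le> emeasure lborel (ball (0::'a) (3 * L * s)) * (\<integral>\<^sup>+c. ennreal (\<phi> c powr q' / q') \<partial>lborel)
      + ennreal (1 / q) * (emeasure lborel (ball (0::'a) s) * (\<integral>\<^sup>+x. ennreal (f x powr q) \<partial>lborel))"
    (is "?I \<le> ?J")
proof (rule ennreal_le_epsilon)
  fix e :: real assume e: "0 < e"
  obtain K where K: "(\<integral>\<^sup>+c. ennreal (\<phi> c) \<partial>lborel) = ennreal K" "0 \<le> K"
    using fin by (metis ennreal_cases infinity_ennreal_def less_irrefl)
  \<comment> \<open>The accumulated error is \<beta> times the integral K of \<phi>; the 1 in the
    denominator covers K = 0.\<close>
  define \<beta> where "\<beta> = e / (K + 1)"
  have \<beta>: "0 < \<beta>" "K * \<beta> \<le> e" using e K by (auto simp: \<beta>_def field_simps)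
  have "0 < L * s" using L s by simp
  from null[OF this, of "R + s"] obtain e' where e': "0 < e'"
    "\<And>\<gamma>. approx_plan p N w \<mu> \<nu> e' \<gamma> \<Longrightarrow> pair_event_le \<gamma> (\<beta> * \<beta>) (lipschitz_violation L (R + s) (L * s))"
    unfolding asymptotically_null_def using \<beta> by (meson mult_pos_pos)
  obtain \<gamma> where g: "approx_plan p N w \<mu> \<nu> e' \<gamma>" using plan_exists[OF e'(1)] by blast
  note D = approx_planD[OF g]
  interpret prob_space \<gamma> by (rule D)
  note [measurable] = D(3) \<phi>(1)
  note X1 [measurable] = D(2)[OF one_in_index]
  let ?X = "\<lambda>\<omega>. fst (plan_state N \<omega>) 1" and ?Z = "\<lambda>\<omega>. snd (plan_state N \<omega>)"
  have [measurable]: "f \<in> borel_measurable borel" and f0: "AE x in lborel. 0 \<le> f x"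
    and fd: "\<mu> 1 = density lborel (\<lambda>x. ennreal (f x))"
    using f by (auto simp: has_lebesgue_density_def)
  define h where "h \<omega> = ennreal (f (?X \<omega>) powr (q - 1))" for \<omega> :: "nat \<Rightarrow> 'a \<times> 'a"
  have h[measurable]: "h \<in> borel_measurable \<gamma>" unfolding h_def by measurable
  \<comment> \<open>Written through an open set of pairs, the indicator is jointly measurable in c
    and \<omega>, as Fubini requires.\<close>
  define k where "k c \<omega> = (indicator {x. dist (fst x) (snd x) < s} (c, ?Z \<omega>) :: ennreal) * h \<omega>"
    for c :: 'a and \<omega> :: "nat \<Rightarrow> 'a \<times> 'a"
  have k: "indicator (ball c s) (?Z \<omega>) * h \<omega> = k c \<omega>" for c \<omega>
    by (simp add: k_def indicator_def)
  have k': "k c \<omega> = h \<omega> * indicator (ball (?Z \<omega>) s) c" for c \<omega>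
    by (simp add: k_def indicator_def dist_commute mult.commute)
  have op: "open {x :: 'a \<times> 'a. dist (fst x) (snd x) < s}"
    by (intro open_Collect_less continuous_intros)
  have [measurable]: "{x :: 'a \<times> 'a. dist (fst x) (snd x) < s} \<in> sets (borel \<Otimes>\<^sub>M borel)"
    unfolding borel_prod using op by (rule borel_open)
  interpret P: pair_sigma_finite lborel \<gamma> ..
  have km: "(\<lambda>(c, \<omega>). k c \<omega>) \<in> borel_measurable (lborel \<Otimes>\<^sub>M \<gamma>)"
    unfolding k_def by measurable
  have kint: "(\<lambda>c. \<integral>\<^sup>+\<omega>. k c \<omega> \<partial>\<gamma>) \<in> borel_measurable lborel"
    using borel_measurable_nn_integral[OF km] .
  have q'1: "1 < q'" by (rule conjugate_exponent(3)[OF q])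
  have "?I \<le> (\<integral>\<^sup>+c. emeasure lborel (ball (0::'a) (3 * L * s)) * ennreal (\<phi> c powr q' / q')
      + ennreal (1 / q) * (\<integral>\<^sup>+\<omega>. k c \<omega> \<partial>\<gamma>) + ennreal \<beta> * ennreal (\<phi> c) \<partial>lborel)"
  proof (rule nn_integral_mono)
    fix c :: 'a
    show "ennreal (\<phi> c) * emeasure \<nu> (ball c s) \<le> emeasure lborel (ball (0::'a) (3 * L * s)) * ennreal (\<phi> c powr q' / q')
      + ennreal (1 / q) * (\<integral>\<^sup>+\<omega>. k c \<omega> \<partial>\<gamma>) + ennreal \<beta> * ennreal (\<phi> c)"
    proof (cases "norm c \<le> R")
      case True
      then have "ball c s \<subseteq> cball 0 (R + s)"
        using norm_triangle_ineq2[of _ c] by (auto simp: dist_norm norm_minus_commute) (smt (verit) norm_minus_commute norm_triangle_ineq2)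
      from ball_mass_estimate[OF q f g \<beta>(1) e'(2)[OF g] L s this \<phi>(2)[of c]]
      show ?thesis by (simp only: h_def[symmetric] k mult.commute[of "emeasure lborel _"] mult.commute[of "ennreal \<beta>"])
    next
      case False
      then show ?thesis using \<phi>(3)[of c] by simp
    qed
  qed
  also have "\<dots> = emeasure lborel (ball (0::'a) (3 * L * s)) * (\<integral>\<^sup>+c. ennreal (\<phi> c powr q' / q') \<partial>lborel)
      + ennreal (1 / q) * (\<integral>\<^sup>+c. (\<integral>\<^sup>+\<omega>. k c \<omega> \<partial>\<gamma>) \<partial>lborel) + ennreal \<beta> * (\<integral>\<^sup>+c. ennreal (\<phi> c) \<partial>lborel)"
    using kint by (simp add: nn_integral_add nn_integral_cmult)
  also have "(\<integral>\<^sup>+c. (\<integral>\<^sup>+\<omega>. k c \<omega> \<partial>\<gamma>) \<partial>lborel) = (\<integral>\<^sup>+\<omega>. (\<integral>\<^sup>+c. k c \<omega> \<partial>lborel) \<partial>\<gamma>)"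
    using P.Fubini'[OF km] by simp
  also have "\<dots> = (\<integral>\<^sup>+\<omega>. emeasure lborel (ball (0::'a) s) * h \<omega> \<partial>\<gamma>)"
  proof (rule nn_integral_cong)
    fix \<omega>
    have "(\<integral>\<^sup>+c. k c \<omega> \<partial>lborel) = h \<omega> * emeasure lborel (ball (?Z \<omega>) s)"
      unfolding k' by (rule nn_integral_cmult_indicator) simp
    then show "(\<integral>\<^sup>+c. k c \<omega> \<partial>lborel) = emeasure lborel (ball (0::'a) s) * h \<omega>"
      using s by (simp add: emeasure_lborel_ball mult.commute)
  qed
  also have "\<dots> = emeasure lborel (ball (0::'a) s) * (\<integral>\<^sup>+\<omega>. h \<omega> \<partial>\<gamma>)"
    by (rule nn_integral_cmult[OF h])
  also have "(\<integral>\<^sup>+\<omega>. h \<omega> \<partial>\<gamma>) = (\<integral>\<^sup>+x. ennreal (f x powr (q - 1)) \<partial>\<mu> 1)"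
    unfolding h_def D(4)[OF one_in_index, symmetric] by (rule nn_integral_distr[OF X1, symmetric]) measurable
  also have "\<dots> = (\<integral>\<^sup>+x. ennreal (f x) * ennreal (f x powr (q - 1)) \<partial>lborel)"
    unfolding fd by (rule nn_integral_density) measurable
  also have "\<dots> = (\<integral>\<^sup>+x. ennreal (f x powr q) \<partial>lborel)"
  proof (rule nn_integral_cong_AE, use f0 in eventually_elim)
    case (elim x)
    have "f x * f x powr (q - 1) = f x powr q"
      using elim powr_add[of "f x" 1 "q - 1"] by (cases "f x = 0") auto
    then show ?case using elim by (simp add: ennreal_mult[symmetric])
  qed
  also have "ennreal \<beta> * (\<integral>\<^sup>+c. ennreal (\<phi> c) \<partial>lborel) \<le> ennreal e"
    using \<beta> K by (simp add: ennreal_mult[symmetric] mult.commute ennreal_leI)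
  finally show "?I \<le> ?J + ennreal e" by (simp add: add_left_mono)
qed

text \<open>For small s, \<phi> z exceeds \<phi> c by at most e whenever c is within s of z, so
  averaging over such c reduces to \<open>averaged_mass_estimate\<close>. Every term carries the
  volume b of a ball of radius s; the ball of radius 3 L s has volume (3 L)^d b. Dividing by b
  removes s.\<close>

lemma continuous_test_bound:
  assumes q: "1 < q" "1 / q + 1 / q' = 1"
    and f: "has_lebesgue_density (\<mu> 1) f"
    and null: "\<And>R \<delta>. 0 < \<delta> \<Longrightarrow> asymptotically_null (lipschitz_violation L R \<delta>)"
    and L: "0 < L"
    and \<phi>: "continuous_on UNIV \<phi>" "\<And>x. 0 \<le> \<phi> x" "\<And>x. R < norm x \<Longrightarrow> \<phi> x = 0"
  shows "(\<integral>\<^sup>+z. ennreal (\<phi> z) \<partial>\<nu>) \<le> ennreal ((3 * L) ^ DIM('a)) * (\<integral>\<^sup>+c. ennreal (\<phi> c powr q' / q') \<partial>lborel)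
      + ennreal (1 / q) * (\<integral>\<^sup>+x. ennreal (f x powr q) \<partial>lborel)"
    (is "?I \<le> ?J")
proof (rule ennreal_le_epsilon)
  fix e :: real assume e: "0 < e"
  have [measurable]: "\<phi> \<in> borel_measurable borel" using \<phi>(1) by (rule borel_measurable_continuous_onI)
  \<comment> \<open>Radius R + 1 suffices because s <= 1: if |z| <= R, then c stays in this ball,
    and if |z| > R, then \<phi> z = 0.\<close>
  have "uniformly_continuous_on (cball 0 (R + 1)) \<phi>"
    by (intro compact_uniformly_continuous continuous_on_subset[OF \<phi>(1)]) auto
  then obtain d where d: "0 < d" "\<And>x y. x \<in> cball 0 (R + 1) \<Longrightarrow> y \<in> cball 0 (R + 1) \<Longrightarrow> dist y x < d \<Longrightarrow> dist (\<phi> y) (\<phi> x) < e"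
    using e unfolding uniformly_continuous_on_def by metis
  define s where "s = min d 1"
  have s: "0 < s" "s \<le> d" "s \<le> 1" using d by (auto simp: s_def)
  have near: "\<phi> z \<le> \<phi> c + e" if "dist c z < s" for c z
  proof (cases "norm z \<le> R")
    case True
    then have "c \<in> cball 0 (R + 1)" "z \<in> cball 0 (R + 1)"
      using that s norm_triangle_ineq2[of c z] by (auto simp: dist_norm)
    then have "dist (\<phi> z) (\<phi> c) < e" using that s by (intro d(2)) (auto simp: dist_commute)
    then show ?thesis by (auto simp: dist_real_def)
  next
    case False
    then show ?thesis using \<phi>(2)[of c] \<phi>(3)[of z] e by simp
  qed
  obtain B where B: "\<And>x. \<phi> x \<le> B" "0 \<le> B"
  proof -
    have "compact (\<phi> ` cball 0 R)"
      by (intro compact_continuous_image continuous_on_subset[OF \<phi>(1)]) auto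
    then obtain B where "\<forall>x\<in>cball 0 R. norm (\<phi> x) \<le> B"
      using compact_imp_bounded[of "\<phi> ` cball 0 R"] unfolding bounded_iff by blast
    then have "\<phi> x \<le> max B 0" for x
      using \<phi>(3)[of x] by (cases "norm x \<le> R") (auto simp: le_max_iff_disj dest!: bspec[of _ _ x])
    then show ?thesis using that[of "max B 0"] by simp
  qed
  have fin: "(\<integral>\<^sup>+c. ennreal (\<phi> c) \<partial>lborel) < \<infinity>"
  proof -
    have "(\<integral>\<^sup>+c. ennreal (\<phi> c) \<partial>lborel) \<le> (\<integral>\<^sup>+c. ennreal B * indicator (cball (0::'a) R) c \<partial>lborel)"
      using B \<phi>(3) by (intro nn_integral_mono) (auto simp: indicator_def ennreal_leI not_le)
    also have "\<dots> = ennreal B * emeasure lborel (cball (0::'a) R)" by (simp add: nn_integral_cmult_indicator)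
    also have "\<dots> < \<infinity>" using emeasure_lborel_cball_finite[of "0::'a" R] by (simp add: ennreal_mult_less_top)
    finally show ?thesis .
  qed
  have S\<nu>: "sets \<nu> = sets borel" and pr: "prob_space \<nu>"
    using barycenter_Prob_p by (auto simp: Prob_p_def borel_prob_def)
  interpret prob_space \<nu> by (rule pr)
  interpret P: pair_sigma_finite lborel \<nu> ..
  define U where "U = {x :: 'a \<times> 'a. dist (fst x) (snd x) < s}"
  have U: "U \<in> sets (borel \<Otimes>\<^sub>M borel)"
    unfolding borel_prod U_def by (intro borel_open open_Collect_less continuous_intros)
  have sP: "sets (lborel \<Otimes>\<^sub>M \<nu>) = sets (borel \<Otimes>\<^sub>M borel)"
    by (intro sets_pair_measure_cong) (simp_all add: S\<nu>)
  define k where "k c z = (ennreal (\<phi> c) + ennreal e) * indicator U (c, z)" for c z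
  have "(\<lambda>(c, z). k c z) \<in> borel_measurable (borel \<Otimes>\<^sub>M borel)"
    unfolding k_def using U by measurable
  then have km: "(\<lambda>(c, z). k c z) \<in> borel_measurable (lborel \<Otimes>\<^sub>M \<nu>)"
    using measurable_cong_sets[OF sP refl] by blast
  define b where "b = measure lborel (ball (0::'a) s)"
  have bs: "emeasure lborel (ball z s) = ennreal b" for z :: 'a
    using s emeasure_lborel_ball[of s z] emeasure_lborel_ball[of s "0::'a"] unfolding b_def
    by (simp add: measure_def)
  have b: "0 < b" unfolding b_def using s(1) by (rule content_ball_pos)
  have b3: "emeasure lborel (ball (0::'a) (3 * L * s)) = ennreal b * ennreal ((3 * L) ^ DIM('a))"
  proof -
    have "emeasure lborel (ball (0::'a) (3 * L * s)) = ennreal ((3 * L) ^ DIM('a) * (s ^ DIM('a) * measure lborel (ball (0::'a) 1)))"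
      using L s by (simp add: emeasure_lborel_ball power_mult_distrib mult.assoc)
    also have "s ^ DIM('a) * measure lborel (ball (0::'a) 1) = b"
      unfolding b_def using content_ball_conv_unit_ball[of s "0::'a"] s by simp
    finally show ?thesis using L b by (simp add: ennreal_mult mult.commute)
  qed
  have "ennreal b * ?I = (\<integral>\<^sup>+z. ennreal (\<phi> z) * ennreal b \<partial>\<nu>)"
    using S\<nu> by (subst nn_integral_multc) (auto simp: mult.commute measurable_cong_sets[OF S\<nu> refl])
  also have "\<dots> = (\<integral>\<^sup>+z. (\<integral>\<^sup>+c. ennreal (\<phi> z) * indicator (ball z s) c \<partial>lborel) \<partial>\<nu>)"
    by (simp add: nn_integral_cmult_indicator bs)
  also have "\<dots> \<le> (\<integral>\<^sup>+z. (\<integral>\<^sup>+c. k c z \<partial>lborel) \<partial>\<nu>)"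
  proof (intro nn_integral_mono)
    fix z c :: 'a
    have "ennreal (\<phi> z) \<le> ennreal (\<phi> c) + ennreal e" if "dist c z < s"
      using near[OF that] \<phi>(2)[of c] e by (simp add: ennreal_plus[symmetric] ennreal_leI del: ennreal_plus)
    then show "ennreal (\<phi> z) * indicator (ball z s) c \<le> k c z"
      by (auto simp: k_def U_def indicator_def dist_commute)
  qed
  also have "\<dots> = (\<integral>\<^sup>+c. (\<integral>\<^sup>+z. k c z \<partial>\<nu>) \<partial>lborel)"
    using P.Fubini'[OF km] by simp
  also have "\<dots> = (\<integral>\<^sup>+c. ennreal (\<phi> c) * emeasure \<nu> (ball c s) + ennreal e * emeasure \<nu> (ball c s) \<partial>lborel)"
  proof (rule nn_integral_cong)
    fix c :: 'a
    have "(\<integral>\<^sup>+z. k c z \<partial>\<nu>) = (\<integral>\<^sup>+z. (ennreal (\<phi> c) + ennreal e) * indicator (ball c s) z \<partial>\<nu>)"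
      by (simp add: k_def U_def indicator_def)
    also have "\<dots> = (ennreal (\<phi> c) + ennreal e) * emeasure \<nu> (ball c s)"
      by (rule nn_integral_cmult_indicator) (simp add: S\<nu>)
    finally show "(\<integral>\<^sup>+z. k c z \<partial>\<nu>) = ennreal (\<phi> c) * emeasure \<nu> (ball c s) + ennreal e * emeasure \<nu> (ball c s)"
      by (simp add: distrib_right)
  qed
  also have "\<dots> = (\<integral>\<^sup>+c. ennreal (\<phi> c) * emeasure \<nu> (ball c s) \<partial>lborel) + ennreal e * (\<integral>\<^sup>+c. emeasure \<nu> (ball c s) \<partial>lborel)"
  proof -
    have "(\<lambda>(c, z). indicator U (c, z) :: ennreal) \<in> borel_measurable (lborel \<Otimes>\<^sub>M \<nu>)"
      using U unfolding measurable_cong_sets[OF sP refl] by measurable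
    from borel_measurable_nn_integral[OF this]
    have "(\<lambda>c. \<integral>\<^sup>+z. indicator (ball c s) z \<partial>\<nu>) \<in> borel_measurable lborel"
      by (simp add: U_def indicator_def)
    then have m: "(\<lambda>c. emeasure \<nu> (ball c s)) \<in> borel_measurable lborel" by (simp add: S\<nu>)
    show ?thesis using m by (subst nn_integral_add; (subst nn_integral_cmult)?; simp)
  qed
  also have "(\<integral>\<^sup>+c. emeasure \<nu> (ball c s) \<partial>lborel) = ennreal b"
  proof -
    have m: "(\<lambda>(c, z). indicator U (c, z) :: ennreal) \<in> borel_measurable (lborel \<Otimes>\<^sub>M \<nu>)"
      using U unfolding measurable_cong_sets[OF sP refl] by measurable
    have "(\<integral>\<^sup>+c. emeasure \<nu> (ball c s) \<partial>lborel) = (\<integral>\<^sup>+c. (\<integral>\<^sup>+z. indicator U (c, z) \<partial>\<nu>) \<partial>lborel)"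
    proof (rule nn_integral_cong)
      fix c :: 'a
      have "(\<integral>\<^sup>+z. indicator U (c, z) \<partial>\<nu>) = (\<integral>\<^sup>+z. indicator (ball c s) z \<partial>\<nu>)" by (simp add: U_def indicator_def)
      then show "emeasure \<nu> (ball c s) = (\<integral>\<^sup>+z. indicator U (c, z) \<partial>\<nu>)" by (simp add: S\<nu>)
    qed
    also have "\<dots> = (\<integral>\<^sup>+z. (\<integral>\<^sup>+c. indicator U (c, z) \<partial>lborel) \<partial>\<nu>)" using P.Fubini'[OF m] by simp
    also have "\<dots> = (\<integral>\<^sup>+z. (\<integral>\<^sup>+c. indicator (ball z s) c \<partial>lborel) \<partial>\<nu>)"
      by (simp add: U_def indicator_def dist_commute)
    also have "\<dots> = ennreal b" by (simp add: bs emeasure_space_1)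
    finally show ?thesis .
  qed
  also have "(\<integral>\<^sup>+c. ennreal (\<phi> c) * emeasure \<nu> (ball c s) \<partial>lborel) + ennreal e * ennreal b
    \<le> (emeasure lborel (ball (0::'a) (3 * L * s)) * (\<integral>\<^sup>+c. ennreal (\<phi> c powr q' / q') \<partial>lborel)
      + ennreal (1 / q) * (emeasure lborel (ball (0::'a) s) * (\<integral>\<^sup>+x. ennreal (f x powr q) \<partial>lborel))) + ennreal e * ennreal b"
    by (rule add_right_mono, rule averaged_mass_estimate[OF q f null L s(1) _ \<phi>(2,3) fin]) auto
  also have "\<dots> = ennreal b * (?J + ennreal e)"
    unfolding b3 bs by (simp only: distrib_left mult_ac)
  finally show "?I \<le> ?J + ennreal e"
    using b by (subst (asm) ennreal_mult_le_mult_iff) auto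
qed

end

subsection \<open>Duality and the density bound\<close>

context barycenter_setting
begin

text \<open>A measurable function is the limit of continuous ones off a Lebesgue null set, which is
  also null for \<nu> because \<nu> has a density. Clipping to [0, C] and a continuous cutoff
  provide a dominating function, so Fatou's lemma handles the left side and dominated convergence
  the right.\<close>

lemma bounded_test_bound:
  assumes q: "1 < q" "1 / q + 1 / q' = 1"
    and f: "has_lebesgue_density (\<mu> 1) f"
    and null: "\<And>R \<delta>. 0 < \<delta> \<Longrightarrow> asymptotically_null (lipschitz_violation L R \<delta>)"
    and L: "0 < L" and g: "has_lebesgue_density \<nu> g"
    and \<phi>: "\<phi> \<in> borel_measurable borel" "\<And>x. 0 \<le> \<phi> x" "\<And>x. \<phi> x \<le> C" "\<And>x. R < norm x \<Longrightarrow> \<phi> x = 0"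
  shows "(\<integral>\<^sup>+z. ennreal (\<phi> z) \<partial>\<nu>) \<le> ennreal ((3 * L) ^ DIM('a)) * (\<integral>\<^sup>+c. ennreal (\<phi> c powr q' / q') \<partial>lborel)
      + ennreal (1 / q) * (\<integral>\<^sup>+x. ennreal (f x powr q) \<partial>lborel)"
proof -
  have q': "1 < q'" by (rule conjugate_exponent(3)[OF q])
  have C: "0 \<le> C" using \<phi>(2)[of 0] \<phi>(3)[of 0] by linarith
  have "\<phi> \<in> borel_measurable lebesgue" using \<phi>(1) by (intro measurable_completion) simp
  then have "\<phi> measurable_on UNIV" by (simp add: lebesgue_measurable_imp_measurable_on)
  then obtain Z h where Z: "negligible Z" and h: "\<And>n. continuous_on UNIV (h n)"
    "\<And>x. x \<notin> Z \<Longrightarrow> (\<lambda>n. h n x) \<longlonglongrightarrow> \<phi> x"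
    unfolding measurable_on_def by auto
  define cut where "cut x = max 0 (min 1 (R + 1 - norm x))" for x :: 'a
  define \<psi> where "\<psi> n x = max 0 (min C (h n x)) * cut x" for n x
  have cut: "0 \<le> cut x" "cut x \<le> 1" "norm x \<le> R \<Longrightarrow> cut x = 1" "R + 1 < norm x \<Longrightarrow> cut x = 0" for x
    by (auto simp: cut_def)
  have \<psi>: "continuous_on UNIV (\<psi> n)" "0 \<le> \<psi> n x" "\<psi> n x \<le> C" "R + 1 < norm x \<Longrightarrow> \<psi> n x = 0" for n x
  proof -
    show "continuous_on UNIV (\<psi> n)" unfolding \<psi>_def cut_def by (intro continuous_intros h)
    show "0 \<le> \<psi> n x" using cut by (simp add: \<psi>_def)
    have "max 0 (min C (h n x)) * cut x \<le> C * 1" using C cut by (intro mult_mono) auto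
    then show "\<psi> n x \<le> C" by (simp add: \<psi>_def)
  qed (use cut in \<open>simp add: \<psi>_def\<close>)
  have [measurable]: "\<psi> n \<in> borel_measurable borel" for n by (rule borel_measurable_continuous_onI[OF \<psi>(1)])
  have lim: "(\<lambda>n. \<psi> n x) \<longlonglongrightarrow> \<phi> x" if "x \<notin> Z" for x
  proof -
    have "(\<lambda>n. \<psi> n x) \<longlonglongrightarrow> max 0 (min C (\<phi> x)) * cut x"
      unfolding \<psi>_def by (intro tendsto_intros h that)
    also have "max 0 (min C (\<phi> x)) * cut x = \<phi> x"
      using \<phi>(2,3)[of x] \<phi>(4)[of x] cut(3)[of x] by (cases "norm x \<le> R") (auto simp: min_def max_def)
    finally show ?thesis .
  qed
  have AEZ: "AE x in lborel. x \<notin> Z"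
    using AE_not_in[of Z lebesgue] Z unfolding negligible_iff_null_sets AE_completion_iff by blast
  have gm: "g \<in> borel_measurable borel" and gd: "\<nu> = density lborel (\<lambda>x. ennreal (g x))"
    using g by (auto simp: has_lebesgue_density_def)
  have AE\<nu>: "AE x in \<nu>. x \<notin> Z"
    unfolding gd using gm AEZ by (subst AE_density) (auto elim: eventually_mono)
  have S\<nu>: "sets \<nu> = sets borel" unfolding gd by simp
  have "(\<integral>\<^sup>+z. ennreal (\<phi> z) \<partial>\<nu>) = (\<integral>\<^sup>+z. liminf (\<lambda>n. ennreal (\<psi> n z)) \<partial>\<nu>)"
  proof (rule nn_integral_cong_AE, use AE\<nu> in eventually_elim)
    case (elim x)
    have "(\<lambda>n. ennreal (\<psi> n x)) \<longlonglongrightarrow> ennreal (\<phi> x)" using lim[OF elim] by (rule tendsto_ennrealI)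
    then show ?case using lim_imp_Liminf[OF sequentially_bot] by force
  qed
  also have "\<dots> \<le> liminf (\<lambda>n. \<integral>\<^sup>+z. ennreal (\<psi> n z) \<partial>\<nu>)"
    by (rule nn_integral_liminf) (simp add: measurable_cong_sets[OF S\<nu> refl])
  also have "\<dots> \<le> liminf (\<lambda>n. ennreal ((3 * L) ^ DIM('a)) * (\<integral>\<^sup>+c. ennreal (\<psi> n c powr q' / q') \<partial>lborel)
      + ennreal (1 / q) * (\<integral>\<^sup>+x. ennreal (f x powr q) \<partial>lborel))"
    by (intro Liminf_mono always_eventually allI continuous_test_bound[OF q f null L \<psi>(1,2,4)])
  also have "\<dots> = ennreal ((3 * L) ^ DIM('a)) * (\<integral>\<^sup>+c. ennreal (\<phi> c powr q' / q') \<partial>lborel)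
      + ennreal (1 / q) * (\<integral>\<^sup>+x. ennreal (f x powr q) \<partial>lborel)"
  proof (rule lim_imp_Liminf[OF sequentially_bot])
    have "(\<lambda>n. \<integral>\<^sup>+c. ennreal (\<psi> n c powr q' / q') \<partial>lborel) \<longlonglongrightarrow> (\<integral>\<^sup>+c. ennreal (\<phi> c powr q' / q') \<partial>lborel)"
    proof (rule nn_integral_dominated_convergence[where w = "\<lambda>x. ennreal (C powr q' / q') * indicator (cball 0 (R + 1)) x"])
      show "(\<lambda>x. ennreal (\<phi> x powr q' / q')) \<in> borel_measurable lborel" using \<phi>(1) by measurable
      show "AE x in lborel. ennreal (\<psi> n x powr q' / q') \<le> ennreal (C powr q' / q') * indicator (cball 0 (R + 1)) x" for n
      proof (intro AE_I2)
        fix x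
        show "ennreal (\<psi> n x powr q' / q') \<le> ennreal (C powr q' / q') * indicator (cball 0 (R + 1)) x"
        proof (cases "norm x \<le> R + 1")
          case True
          then show ?thesis using \<psi>(2,3)[of n x] q'
            by (simp add: ennreal_leI divide_right_mono powr_mono2)
        next
          case False
          then show ?thesis using \<psi>(4)[of x n] by simp
        qed
      qed
      show "(\<integral>\<^sup>+x. ennreal (C powr q' / q') * indicator (cball (0::'a) (R + 1)) x \<partial>lborel) < \<infinity>"
        using emeasure_lborel_cball_finite[of "0::'a" "R + 1"]
        by (simp add: nn_integral_cmult_indicator ennreal_mult_less_top)
      show "AE x in lborel. (\<lambda>n. ennreal (\<psi> n x powr q' / q')) \<longlonglongrightarrow> ennreal (\<phi> x powr q' / q')"
        using AEZ
      proof eventually_elim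
        case (elim x)
        show ?case
        proof (intro tendsto_ennrealI tendsto_divide tendsto_const)
          show "(\<lambda>n. \<psi> n x powr q') \<longlonglongrightarrow> \<phi> x powr q'"
            using lim[OF elim] q' \<psi>(2) by (intro tendsto_powr') auto
        qed (use q' in auto)
      qed
      have [measurable]: "cball (0::'a) (R + 1) \<in> sets borel" by simp
      show "(\<lambda>x. ennreal (C powr q' / q') * indicator (cball (0::'a) (R + 1)) x) \<in> borel_measurable lborel" by measurable
      show "(\<lambda>x. ennreal (\<psi> n x powr q' / q')) \<in> borel_measurable lborel" for n by measurable
    qed
    then show "(\<lambda>n. ennreal ((3 * L) ^ DIM('a)) * (\<integral>\<^sup>+c. ennreal (\<psi> n c powr q' / q') \<partial>lborel)
        + ennreal (1 / q) * (\<integral>\<^sup>+x. ennreal (f x powr q) \<partial>lborel))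
      \<longlonglongrightarrow> ennreal ((3 * L) ^ DIM('a)) * (\<integral>\<^sup>+c. ennreal (\<phi> c powr q' / q') \<partial>lborel)
        + ennreal (1 / q) * (\<integral>\<^sup>+x. ennreal (f x powr q) \<partial>lborel)"
      by (intro tendsto_add tendsto_const ennreal_tendsto_cmult) auto
  qed
  finally show ?thesis .
qed

text \<open>The test function \<open>t g\<^sup>q\<^sup>-\<^sup>1\<close>, truncated, with \<open>t\<close> chosen so that the two terms in \<open>g\<^sup>q\<close> balance.\<close>

lemma density_power_integral_le:
  assumes q: "1 < q" "1 / q + 1 / q' = 1"
    and f: "has_lebesgue_density (\<mu> 1) f"
    and null: "\<And>R \<delta>. 0 < \<delta> \<Longrightarrow> asymptotically_null (lipschitz_violation L R \<delta>)"
    and L: "0 < L" and g: "has_lebesgue_density \<nu> g"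
  shows "(\<integral>\<^sup>+x. ennreal (\<bar>g x\<bar> powr q) \<partial>lborel)
    \<le> ennreal (((3 * L) ^ DIM('a)) powr (q - 1)) * (\<integral>\<^sup>+x. ennreal (f x powr q) \<partial>lborel)"
proof (cases "(\<integral>\<^sup>+x. ennreal (f x powr q) \<partial>lborel)")
  case top
  then show ?thesis using L by (simp add: ennreal_mult_top)
next
  case (real F)
  have [measurable]: "g \<in> borel_measurable borel" and g0: "AE x in lborel. 0 \<le> g x"
    and gd: "\<nu> = density lborel (\<lambda>x. ennreal (g x))"
    using g by (auto simp: has_lebesgue_density_def)
  note q'1 = conjugate_exponent(3)[OF q] and q'eq = conjugate_exponent(2)[OF q]
  define \<Lambda> where "\<Lambda> = (3 * L) ^ DIM('a)"
  have \<Lambda>: "0 < \<Lambda>" using L by (simp add: \<Lambda>_def)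
  define t where "t = \<Lambda> powr (1 - q)"
  have t: "0 < t" using \<Lambda> by (simp add: t_def)
  have tq: "\<Lambda> * t powr q' = t"
  proof -
    have "(1 - q) * q' = - q" unfolding q'eq using q by (simp add: field_simps)
    then have "t powr q' = \<Lambda> powr (- q)" by (simp add: t_def powr_powr)
    then show ?thesis using \<Lambda> powr_add[of \<Lambda> 1 "- q"] by (simp add: t_def)
  qed
  \<comment> \<open>Truncation in height and in space makes the integral of G^q finite, so that a
    fraction of it can be absorbed into the left side; Fatou's lemma removes the truncation at the
    end.\<close>
  define G where "G n x = min \<bar>g x\<bar> (real n) * indicator (cball 0 (real n)) x" for n x
  have [measurable]: "cball a r \<in> sets borel" for a :: 'a and r by simp
  have [measurable]: "G n \<in> borel_measurable borel" for n unfolding G_def by measurable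
  have G: "0 \<le> G n x" "G n x \<le> real n" "G n x \<le> \<bar>g x\<bar>" "real n < norm x \<Longrightarrow> G n x = 0" for n x
    by (auto simp: G_def indicator_def)
  have bound: "(\<integral>\<^sup>+x. ennreal (G n x powr q) \<partial>lborel) \<le> ennreal (F / t)" for n
  proof -
    define \<phi> where "\<phi> x = t * G n x powr (q - 1)" for x
    have [measurable]: "\<phi> \<in> borel_measurable borel" unfolding \<phi>_def by measurable
    have "(\<integral>\<^sup>+x. ennreal (G n x powr q) \<partial>lborel) \<le> (\<integral>\<^sup>+x. ennreal (real n powr q) * indicator (cball (0::'a) (real n)) x \<partial>lborel)"
    proof (rule nn_integral_mono)
      fix x :: 'a
      show "ennreal (G n x powr q) \<le> ennreal (real n powr q) * indicator (cball 0 (real n)) x"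
        using G(1,2)[of n x] G(4)[of n x] q by (cases "norm x \<le> real n") (auto intro!: ennreal_leI powr_mono2)
    qed
    also have "\<dots> < \<infinity>"
      using emeasure_lborel_cball_finite[of "0::'a" "real n"]
      by (simp add: nn_integral_cmult_indicator ennreal_mult_less_top)
    finally obtain I where I: "(\<integral>\<^sup>+x. ennreal (G n x powr q) \<partial>lborel) = ennreal I" "0 \<le> I"
      by (metis ennreal_cases infinity_ennreal_def less_irrefl)
    have "ennreal t * ennreal I = (\<integral>\<^sup>+x. ennreal t * ennreal (G n x powr q) \<partial>lborel)"
      unfolding I(1)[symmetric] by (rule nn_integral_cmult[symmetric]) measurable
    also have "\<dots> \<le> (\<integral>\<^sup>+x. ennreal (g x) * ennreal (\<phi> x) \<partial>lborel)"
    proof (rule nn_integral_mono_AE, use g0 in eventually_elim)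
      case (elim x)
      have "G n x powr q = G n x * G n x powr (q - 1)"
        using G(1)[of n x] powr_add[of "G n x" 1 "q - 1"] by (cases "G n x = 0") auto
      also have "\<dots> \<le> g x * G n x powr (q - 1)" using G(3)[of n x] elim by (intro mult_right_mono) auto
      finally have "t * G n x powr q \<le> g x * \<phi> x" using t by (simp add: \<phi>_def mult_left_mono mult.left_commute)
      then show ?case using t elim by (simp add: ennreal_mult[symmetric] \<phi>_def ennreal_leI)
    qed
    also have "\<dots> = (\<integral>\<^sup>+x. ennreal (\<phi> x) \<partial>\<nu>)" unfolding gd by (rule nn_integral_density[symmetric]) measurable
    also have "\<dots> \<le> ennreal \<Lambda> * (\<integral>\<^sup>+c. ennreal (\<phi> c powr q' / q') \<partial>lborel) + ennreal (1 / q) * (\<integral>\<^sup>+x. ennreal (f x powr q) \<partial>lborel)"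
      unfolding \<Lambda>_def
    proof (rule bounded_test_bound[OF q f null L g])
      show "0 \<le> \<phi> x" for x using t by (simp add: \<phi>_def)
      show "\<phi> x \<le> t * real n powr (q - 1)" for x
        unfolding \<phi>_def using t G q by (intro mult_left_mono powr_mono2) auto
      show "real n < norm x \<Longrightarrow> \<phi> x = 0" for x using G(4) by (simp add: \<phi>_def)
    qed measurable
    also have "(\<integral>\<^sup>+c. ennreal (\<phi> c powr q' / q') \<partial>lborel) = (\<integral>\<^sup>+c. ennreal (t powr q' / q') * ennreal (G n c powr q) \<partial>lborel)"
    proof (rule nn_integral_cong)
      fix c
      have "(q - 1) * q' = q" unfolding q'eq using q by simp
      then have "\<phi> c powr q' = t powr q' * G n c powr q"
        using t G(1)[of n c] by (simp add: \<phi>_def powr_mult powr_powr)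
      then show "ennreal (\<phi> c powr q' / q') = ennreal (t powr q' / q') * ennreal (G n c powr q)"
        using q'1 by (simp add: ennreal_mult[symmetric])
    qed
    also have "\<dots> = ennreal (t powr q' / q') * ennreal I"
      unfolding I(1)[symmetric] by (rule nn_integral_cmult) measurable
    finally have "ennreal (t * I) \<le> ennreal (\<Lambda> * (t powr q' / q' * I) + 1 / q * F)"
      using real \<Lambda> t I q q'1 by (simp add: ennreal_mult[symmetric] ennreal_plus[symmetric] del: ennreal_plus)
    then have "t * I \<le> \<Lambda> * (t powr q' / q' * I) + 1 / q * F"
      using \<Lambda> t I q q'1 real by (subst (asm) ennreal_le_iff) auto
    also have "\<Lambda> * (t powr q' / q' * I) = (\<Lambda> * t powr q') * (1 / q') * I" by simp
    also have "\<dots> = t * I * (1 / q')" unfolding tq by simp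
    \<comment> \<open>By \<open>tq\<close> the term in G on the right equals t I / q', which leaves
      the fraction 1 / q of t I on the left.\<close>
    finally have "t * I * (1 - 1 / q') \<le> 1 / q * F" by (simp add: algebra_simps)
    also have "1 - 1 / q' = 1 / q" using q by simp
    finally have "t * I \<le> F" using q by (simp add: field_simps)
    then have "I \<le> F / t" using t by (simp add: field_simps)
    then show ?thesis unfolding I(1) by (rule ennreal_leI)
  qed
  have "(\<integral>\<^sup>+x. ennreal (\<bar>g x\<bar> powr q) \<partial>lborel) = (\<integral>\<^sup>+x. liminf (\<lambda>n. ennreal (G n x powr q)) \<partial>lborel)"
  proof (rule nn_integral_cong)
    fix x :: 'a
    have "eventually (\<lambda>n. G n x = \<bar>g x\<bar>) sequentially"
    proof -
      obtain m where m: "max \<bar>g x\<bar> (norm x) \<le> real m" using real_arch_simple by blast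
      have "G n x = \<bar>g x\<bar>" if "m \<le> n" for n
        using m that by (auto simp: G_def indicator_def)
      then show ?thesis by (auto simp: eventually_sequentially)
    qed
    then have "(\<lambda>n. ennreal (G n x powr q)) \<longlonglongrightarrow> ennreal (\<bar>g x\<bar> powr q)"
      by (intro tendsto_eventually) (auto elim: eventually_mono)
    then show "ennreal (\<bar>g x\<bar> powr q) = liminf (\<lambda>n. ennreal (G n x powr q))"
      using lim_imp_Liminf[OF sequentially_bot] by force
  qed
  also have "\<dots> \<le> liminf (\<lambda>n. \<integral>\<^sup>+x. ennreal (G n x powr q) \<partial>lborel)"
    by (rule nn_integral_liminf) measurable
  also have "\<dots> \<le> liminf (\<lambda>n. ennreal (F / t))"
    by (intro Liminf_mono always_eventually allI bound)
  also have "\<dots> = ennreal (F / t)" by (simp add: Liminf_const)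
  also have "F / t = \<Lambda> powr (q - 1) * F"
    using powr_minus_divide[of \<Lambda> "1 - q"] by (simp add: t_def)
  finally show ?thesis unfolding real(2) \<Lambda>_def using real(1) by (simp add: ennreal_mult)
qed

end

text \<open>Transport by a map with Lipschitz constant \<open>C\<^sub>0 / (w\<^sup>b D\<^sup>a)\<close> yields the exponent \<open>1 / q'\<close>;
  as \<open>w\<^sup>b D\<^sup>a\<close> is bounded, the larger exponent \<open>q'\<close> costs only a constant.\<close>

lemma constant_bound:
  fixes C\<^sub>0 X D a b w q' :: real and d :: nat
  assumes "0 < C\<^sub>0" "0 < X" "1 < q'" "0 \<le> a" "0 \<le> b" "0 < w" "w \<le> 1" "0 < D" "D \<le> X"
  shows "((3 * (C\<^sub>0 / (w powr b * D powr a))) ^ d) powr (1 / q')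
    \<le> ((3 * C\<^sub>0) ^ d) powr (1 / q') * ((X powr a) ^ d) powr (q' - 1 / q')
      / (w powr (d * b) * D powr (d * a)) powr q'"
proof -
  define S where "S = w powr b * D powr a"
  have S: "0 < S" using assms by (simp add: S_def)
  have "S \<le> 1 * X powr a" unfolding S_def using assms by (intro mult_mono powr_le1 powr_mono2) auto
  then have SX: "S ^ d \<le> (X powr a) ^ d" using S by (intro power_mono) auto
  have T: "w powr (d * b) * D powr (d * a) = S ^ d"
    using assms by (simp add: S_def power_mult_distrib powr_powr mult.commute flip: powr_realpow)
  have e: "1 / q' \<le> q'" using assms mult_mono[of 1 q' 1 q'] by (simp add: field_simps)
  have "((3 * (C\<^sub>0 / S)) ^ d) powr (1 / q') = ((3 * C\<^sub>0) ^ d) powr (1 / q') / (S ^ d) powr (1 / q')"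
    using S assms by (simp add: power_mult_distrib power_divide powr_divide powr_mult)
  also have "\<dots> = ((3 * C\<^sub>0) ^ d) powr (1 / q') * (S ^ d) powr (q' - 1 / q') / (S ^ d) powr q'"
    using S by (simp add: powr_diff)
  also have "\<dots> \<le> ((3 * C\<^sub>0) ^ d) powr (1 / q') * ((X powr a) ^ d) powr (q' - 1 / q') / (S ^ d) powr q'"
    using S SX e by (intro divide_right_mono mult_left_mono powr_mono2) auto
  finally show ?thesis unfolding T S_def[symmetric] .
qed

section \<open>The norm bound and its constants\<close>

context barycenter_setting
begin

text \<open>The q-th root turns the factor (3 L)^(d (q - 1)) of the power integrals into (3 L)^(d /
  q').\<close>

lemma Lq_bound:
  assumes q: "1 < q" "1 / q + 1 / q' = 1" and L: "0 < L"
    and lip: "lipschitz_on_stable_pairs L"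
    and f: "has_lebesgue_density (\<mu> 1) f" "in_Lq q f" and g: "has_lebesgue_density \<nu> g"
  shows "in_Lq q g \<and> Lq_norm q g \<le> ((3 * L) ^ DIM('a)) powr (1 / q') * Lq_norm q f"
proof -
  have null: "asymptotically_null (lipschitz_violation L R \<delta>)" if "0 < \<delta>" for R \<delta>
    using lip that by (rule null_of_lipschitz_violation)
  define \<Lambda> F where "\<Lambda> = (3 * L) ^ DIM('a)" and "F = (\<integral>x. \<bar>f x\<bar> powr q \<partial>lborel)"
  have \<Lambda>: "0 < \<Lambda>" using L by (simp add: \<Lambda>_def)
  have F0: "0 \<le> F" unfolding F_def by (intro integral_nonneg_AE) auto
  have gm: "g \<in> borel_measurable borel" using g by (simp add: has_lebesgue_density_def)
  have "AE x in lborel. 0 \<le> f x" using f by (simp add: has_lebesgue_density_def)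
  then have "(\<integral>\<^sup>+x. ennreal (f x powr q) \<partial>lborel) = (\<integral>\<^sup>+x. ennreal (\<bar>f x\<bar> powr q) \<partial>lborel)"
    by (intro nn_integral_cong_AE) (auto elim: eventually_mono)
  also have "\<dots> = ennreal F"
    unfolding F_def using f(2) by (intro nn_integral_eq_integral) (auto simp: in_Lq_def)
  finally have "(\<integral>\<^sup>+x. ennreal (\<bar>g x\<bar> powr q) \<partial>lborel) \<le> ennreal (\<Lambda> powr (q - 1)) * ennreal F"
    using density_power_integral_le[OF q f(1) null L g] by (simp only: \<Lambda>_def)
  then have le: "(\<integral>\<^sup>+x. ennreal (\<bar>g x\<bar> powr q) \<partial>lborel) \<le> ennreal (\<Lambda> powr (q - 1) * F)"
    using F0 by (simp add: ennreal_mult)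
  have int: "integrable lborel (\<lambda>x. \<bar>g x\<bar> powr q)"
    using gm le by (intro integrableI_nonneg) (auto intro: le_less_trans)
  then have gL: "in_Lq q g" using gm by (simp add: in_Lq_def)
  have "(\<integral>\<^sup>+x. ennreal (\<bar>g x\<bar> powr q) \<partial>lborel) = ennreal (\<integral>x. \<bar>g x\<bar> powr q \<partial>lborel)"
    using int by (intro nn_integral_eq_integral) auto
  then have "(\<integral>x. \<bar>g x\<bar> powr q \<partial>lborel) \<le> \<Lambda> powr (q - 1) * F"
    using le F0 by (simp add: ennreal_le_iff)
  then have "Lq_norm q g \<le> (\<Lambda> powr (q - 1) * F) powr (1 / q)"
    unfolding Lq_norm_def using q by (intro powr_mono2 integral_nonneg_AE) auto
  also have "\<dots> = \<Lambda> powr ((q - 1) / q) * Lq_norm q f"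
    using F0 by (simp add: powr_mult powr_powr Lq_norm_def F_def)
  finally show ?thesis using gL by (simp add: \<Lambda>_def conjugate_exponent(1)[OF q])
qed

text \<open>An infimum of reals over the empty set carries no information; this makes the infima
  that define the separation quantities genuine.\<close>

lemma spt_tuples_nonempty: "spt_tuples \<noteq> {}"
proof -
  have "spt (\<mu> i) \<noteq> {}" if "i \<in> {1..N}" for i
  proof
    assume "spt (\<mu> i) = {}"
    then have "AE x in \<mu> i. False" using AE_spt_index[OF that] by simp
    then show False using \<mu>(1)[OF that] prob_space.AE_False by (auto simp: borel_prob_def)
  qed
  then show ?thesis by (simp add: PiE_eq_empty_iff)
qed

lemma barycenter_eq:
  "(\<And>y. bary_cost p {1..N} w x z \<le> bary_cost p {1..N} w x y) \<Longrightarrow> euclidean_barycenter p {1..N} w x = z"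
  using p N w by (intro euclidean_barycenter_unique) auto

lemma norm_barycenter_le:
  assumes "x \<in> spt_tuples" "I \<subseteq> {1..N}" "I \<noteq> {}"
  shows "norm (euclidean_barycenter p I w x) \<le> 2 * r"
proof (rule norm_bary_cost_minimizer)
  show fin: "finite I" using assms(2) by (rule finite_subset) simp
  show "0 < p" "I \<noteq> {}" using p assms by auto
  show "0 < w i" "norm (x i) \<le> r" if "i \<in> I" for i using w norm_spt_le assms that by auto
  then show "bary_cost p I w x (euclidean_barycenter p I w x) \<le> bary_cost p I w x y" for y
    using p assms fin by (intro euclidean_barycenter_minimal) auto
qed

lemma bary_separation_le:
  "x \<in> spt_tuples \<Longrightarrow> bary_separation p N w \<mu>
    \<le> norm (euclidean_barycenter p {1..N} w x - euclidean_barycenter p {2..N} w x)"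
  unfolding bary_separation_def by (intro cINF_lower) (auto intro!: bdd_belowI[of _ 0])

text \<open>The infimum is nested: the inner infima are nonnegative, so the outer one is bounded
  below and may be compared with its i-th member.\<close>

lemma bary_point_distance_le:
  assumes "x \<in> spt_tuples" "i \<in> {1..N}"
  shows "bary_point_distance p N w \<mu> \<le> norm (x i - euclidean_barycenter p {1..N} w x)"
proof -
  have "0 \<le> (INF x\<in>(spt_tuples). norm (x i - euclidean_barycenter p {1..N} w x))" for i
    using spt_tuples_nonempty by (intro cINF_greatest) auto
  then have "bary_point_distance p N w \<mu>
      \<le> (INF x\<in>(spt_tuples). norm (x i - euclidean_barycenter p {1..N} w x))"
    unfolding bary_point_distance_def using assms(2)
    by (intro cINF_lower) (auto intro!: bdd_belowI[of _ 0])
  also have "\<dots> \<le> norm (x i - euclidean_barycenter p {1..N} w x)"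
    using assms(1) by (intro cINF_lower) (auto intro!: bdd_belowI[of _ 0])
  finally show ?thesis .
qed

lemma first_weight_le_1: "0 < w 1" "w 1 \<le> 1"
proof -
  show "0 < w 1" by (rule w[OF one_in_index])
  show "w 1 \<le> 1" unfolding w1[symmetric] using one_in_index w
    by (intro member_le_sum) (auto intro: less_imp_le)
qed

lemma Lq_bound_of_scaled_lipschitz:
  fixes a C\<^sub>0 D q q' :: real
  assumes q: "1 < q" "1 / q + 1 / q' = 1" and C: "0 < C\<^sub>0" and a: "0 \<le> a" and D: "0 < D" "D \<le> 4 * r"
    and lip: "lipschitz_on_stable_pairs (C\<^sub>0 / (w 1 powr (1 / (p - 1)) * D powr a))"
    and f: "has_lebesgue_density (\<mu> 1) f" "in_Lq q f" and g: "has_lebesgue_density \<nu> g"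
  shows "in_Lq q g \<and> Lq_norm q g
    \<le> ((3 * C\<^sub>0) ^ DIM('a)) powr (1 / q') * (((4 * r) powr a) ^ DIM('a)) powr (q' - 1 / q')
      / (w 1 powr (DIM('a) * (1 - alpha_exp p)) * D powr (DIM('a) * a)) powr q' * Lq_norm q f"
    (is "_ \<and> _ \<le> ?K * _")
proof -
  define L where "L = C\<^sub>0 / (w 1 powr (1 / (p - 1)) * D powr a)"
  have L: "0 < L" using C D first_weight_le_1 by (simp add: L_def)
  have al: "1 - alpha_exp p = 1 / (p - 1)" using p by (simp add: alpha_exp_def field_simps)
  have "((3 * L) ^ DIM('a)) powr (1 / q') \<le> ?K"
    unfolding L_def al using C conjugate_exponent(3)[OF q] a D first_weight_le_1 p
    by (intro constant_bound) auto
  then have "((3 * L) ^ DIM('a)) powr (1 / q') * Lq_norm q f \<le> ?K * Lq_norm q f"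
    by (rule mult_right_mono) (simp add: Lq_norm_def)
  with Lq_bound[OF q L lip[folded L_def] f g] show ?thesis by linarith
qed

text \<open>Supplies the upper bound on D with which \<open>constant_bound\<close> trades the
  exponent 1 / q' for q'.\<close>

lemma bary_separation_le_radius: "bary_separation p N w \<mu> \<le> 4 * r"
proof -
  obtain x where x: "x \<in> spt_tuples" using spt_tuples_nonempty by blast
  have "norm (euclidean_barycenter p {1..N} w x) \<le> 2 * r" "norm (euclidean_barycenter p {2..N} w x) \<le> 2 * r"
    using norm_barycenter_le[OF x, of "{1..N}"] norm_barycenter_le[OF x, of "{2..N}"] N by auto
  then show ?thesis
    using bary_separation_le[OF x]
      norm_triangle_ineq4[of "euclidean_barycenter p {1..N} w x" "euclidean_barycenter p {2..N} w x"]
    by linarith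
qed

lemma bary_point_distance_le_radius: "bary_point_distance p N w \<mu> \<le> 4 * r"
proof -
  obtain x where x: "x \<in> spt_tuples" using spt_tuples_nonempty by blast
  have "norm (euclidean_barycenter p {1..N} w x) \<le> 2 * r"
    using norm_barycenter_le[OF x, of "{1..N}"] N by auto
  then show ?thesis
    using bary_point_distance_le[OF x one_in_index] norm_spt_le[OF x one_in_index]
      norm_triangle_ineq4[of "x 1" "euclidean_barycenter p {1..N} w x"] norm_ge_zero[of "x 1"]
    by linarith
qed

lemma stable_pair_barycenters:
  assumes "stable_pair p N w r x z x' z'"
  shows "euclidean_barycenter p {1..N} w x = z" "euclidean_barycenter p {1..N} w x' = z'"
  using assms barycenter_eq by (auto simp: stable_pair_def)

end

theorem theorem1p1:
  fixes p q q' M :: real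
  assumes "1 < p" and "1 < q" and "1 / q + 1 / q' = 1" and "0 < M"
  shows "\<exists>C>0. \<forall>(N::nat) (w::nat \<Rightarrow> real) (\<mu>::nat \<Rightarrow> (real ^ 'd) measure)
            (f\<^sub>1::real ^ 'd \<Rightarrow> real) (\<nu>::(real ^ 'd) measure) (g::real ^ 'd \<Rightarrow> real).
      2 \<le> N \<and> (\<forall>i\<in>{1..N}. 0 < w i) \<and> (\<Sum>i=1..N. w i) = 1 \<and>
      (\<forall>i\<in>{1..N}. borel_prob (\<mu> i) \<and> spt (\<mu> i) \<subseteq> ball 0 (M / 2)) \<and>
      has_lebesgue_density (\<mu> 1) f\<^sub>1 \<and> in_Lq q f\<^sub>1 \<and>
      is_wasserstein_barycenter p N w \<mu> \<nu> \<and> has_lebesgue_density \<nu> g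
      \<longrightarrow>
      (2 \<le> p \<and> 0 < bary_separation p N w \<mu> \<longrightarrow>
         in_Lq q g \<and>
         Lq_norm q g \<le>
           C / (w 1 powr (CARD('d) * (1 - alpha_exp p)) *
                bary_separation p N w \<mu> powr (CARD('d) * (p - 2))) powr q' * Lq_norm q f\<^sub>1) \<and>
      (p < 2 \<and> 0 < bary_point_distance p N w \<mu> \<longrightarrow>
         in_Lq q g \<and>
         Lq_norm q g \<le>
           C / (w 1 powr (CARD('d) * (1 - alpha_exp p)) *
                bary_point_distance p N w \<mu> powr (CARD('d) * (2 - p))) powr q' * Lq_norm q f\<^sub>1)"
    (is "\<exists>C>0. \<forall>N w \<mu> f\<^sub>1 \<nu> g. ?H N w \<mu> f\<^sub>1 \<nu> g \<longrightarrow> ?T C N w \<mu> f\<^sub>1 \<nu> g")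
proof -
  note q = assms(2,3)
  let ?B = "\<lambda>(C :: real) (N :: nat) (w :: nat \<Rightarrow> real) (\<mu> :: nat \<Rightarrow> (real ^ 'd) measure) f\<^sub>1 g (D :: real) (a :: real). in_Lq q g \<and> Lq_norm q g
    \<le> C / (w 1 powr (CARD('d) * (1 - alpha_exp p)) * D powr (CARD('d) * a)) powr q' * Lq_norm q f\<^sub>1"
  \<comment> \<open>Here 2 M is the bound 4 r on both separation quantities, for r = M / 2. Like
    \<open>C\<^sub>0\<close>, which is obtained for fixed p and M, the constant K is fixed before N,
    the weights and the measures are introduced.\<close>
  define K where "K C\<^sub>0 a = ((3 * C\<^sub>0) ^ CARD('d)) powr (1 / q') * (((2 * M) powr a) ^ CARD('d)) powr (q' - 1 / q')"
    for C\<^sub>0 a :: real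
  have K: "0 < K C\<^sub>0 a" if "0 < C\<^sub>0" for C\<^sub>0 a using that assms(4) by (simp add: K_def)
  show ?thesis
  proof (cases "2 \<le> p")
    case True
    obtain C\<^sub>0 where C: "0 < C\<^sub>0" and lip: "\<And>N w (x :: nat \<Rightarrow> real ^ 'd) x' z z' D.
        stable_pair p N w (M / 2) x z x' z' \<Longrightarrow> 0 < D \<Longrightarrow> D \<le> norm (z - euclidean_barycenter p {2..N} w x) \<Longrightarrow>
        norm (x 1 - x' 1) \<le> C\<^sub>0 / (w 1 powr (1 / (p - 1)) * D powr (p - 2)) * norm (z - z')"
      using swap_stable_lipschitz_ge_2[OF True assms(4), where 'a = "real ^ 'd"] by (elim exE conjE) blast
    show ?thesis
    proof (intro exI[of _ "K C\<^sub>0 (p - 2)"] conjI[OF K[OF C]] allI, rule impI)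
      fix N w and \<mu> :: "nat \<Rightarrow> (real ^ 'd) measure" and f\<^sub>1 \<nu> g
      assume A: "?H N w \<mu> f\<^sub>1 \<nu> g"
      interpret barycenter_setting p N w \<mu> \<nu> "M / 2"
        using A assms(1) ball_subset_cball[of "0 :: real ^ 'd" "M / 2"] unfolding barycenter_setting_def by blast
      have "?B (K C\<^sub>0 (p - 2)) N w \<mu> f\<^sub>1 g (bary_separation p N w \<mu>) (p - 2)" if D: "0 < bary_separation p N w \<mu>"
      proof -
        have "norm (x 1 - x' 1) \<le> C\<^sub>0 / (w 1 powr (1 / (p - 1)) * bary_separation p N w \<mu> powr (p - 2)) * norm (z - z')"
          if x: "x \<in> spt_tuples" "x' \<in> spt_tuples" and s: "stable_pair p N w (M / 2) x z x' z'" for x x' z z'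
        proof -
          have "bary_separation p N w \<mu> \<le> norm (z - euclidean_barycenter p {2..N} w x)"
            using bary_separation_le[OF x(1)] stable_pair_barycenters(1)[OF s] by simp
          from lip[OF s D this] show ?thesis .
        qed
        then have "lipschitz_on_stable_pairs (C\<^sub>0 / (w 1 powr (1 / (p - 1)) * bary_separation p N w \<mu> powr (p - 2)))"
          unfolding lipschitz_on_stable_pairs_def by blast
        then show ?thesis
          using Lq_bound_of_scaled_lipschitz[OF q C _ D bary_separation_le_radius, of "p - 2" f\<^sub>1 g] A True by (simp add: K_def)
      qed
      then show "?T (K C\<^sub>0 (p - 2)) N w \<mu> f\<^sub>1 \<nu> g"
        using True by linarith
    qed
  next
    case False
    then have p2: "p < 2" by simp
    obtain C\<^sub>0 where C: "0 < C\<^sub>0" and lip: "\<And>N w (x :: nat \<Rightarrow> real ^ 'd) x' z z' D.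
        stable_pair p N w (M / 2) x z x' z' \<Longrightarrow> 0 < D \<Longrightarrow> (\<forall>i\<in>{1..N}. D \<le> norm (x i - z) \<and> D \<le> norm (x' i - z')) \<Longrightarrow>
        norm (x 1 - x' 1) \<le> C\<^sub>0 / (w 1 powr (1 / (p - 1)) * D powr (2 - p)) * norm (z - z')"
      using swap_stable_lipschitz_less_2[OF assms(1) p2 assms(4), where 'a = "real ^ 'd"] by (elim exE conjE) blast
    show ?thesis
    proof (intro exI[of _ "K C\<^sub>0 (2 - p)"] conjI[OF K[OF C]] allI, rule impI)
      fix N w and \<mu> :: "nat \<Rightarrow> (real ^ 'd) measure" and f\<^sub>1 \<nu> g
      assume A: "?H N w \<mu> f\<^sub>1 \<nu> g"
      interpret barycenter_setting p N w \<mu> \<nu> "M / 2"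
        using A assms(1) ball_subset_cball[of "0 :: real ^ 'd" "M / 2"] unfolding barycenter_setting_def by blast
      have "?B (K C\<^sub>0 (2 - p)) N w \<mu> f\<^sub>1 g (bary_point_distance p N w \<mu>) (2 - p)" if D: "0 < bary_point_distance p N w \<mu>"
      proof -
        have "norm (x 1 - x' 1) \<le> C\<^sub>0 / (w 1 powr (1 / (p - 1)) * bary_point_distance p N w \<mu> powr (2 - p)) * norm (z - z')"
          if x: "x \<in> spt_tuples" "x' \<in> spt_tuples" and s: "stable_pair p N w (M / 2) x z x' z'" for x x' z z'
        proof -
          have "\<forall>i\<in>{1..N}. bary_point_distance p N w \<mu> \<le> norm (x i - z) \<and> bary_point_distance p N w \<mu> \<le> norm (x' i - z')"
            using bary_point_distance_le[OF x(1)] bary_point_distance_le[OF x(2)] stable_pair_barycenters[OF s] by auto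
          from lip[OF s D this] show ?thesis .
        qed
        then have "lipschitz_on_stable_pairs (C\<^sub>0 / (w 1 powr (1 / (p - 1)) * bary_point_distance p N w \<mu> powr (2 - p)))"
          unfolding lipschitz_on_stable_pairs_def by blast
        then show ?thesis
          using Lq_bound_of_scaled_lipschitz[OF q C _ D bary_point_distance_le_radius, of "2 - p" f\<^sub>1 g] A p2 by (simp add: K_def)
      qed
      then show "?T (K C\<^sub>0 (2 - p)) N w \<mu> f\<^sub>1 \<nu> g"
        using p2 by linarith
    qed
  qed
qed

end
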